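(* Let $R$ be a Cohen-Macaulay local ring and let $I$ be a height two perfect ideal of $R$. Then for all $i$ with $H_i\neq 0$ one has $\operatorname{Ann}(H_i)=I$.
   Context: $H_i=H_i(I)$ denotes the $i$-th homology module of the Koszul complex built on a minimal generating set of $I$. An ideal $I$ is perfect if the projective dimension of $R/I$ over $R$ equals the grade of $I$. *)

theory Defs
  imports "HOL-Library.Extended_Nat" "HOL-Algebra.Algebra"
begin

section \<open>Height, regular sequences, Cohen--Macaulay local rings\<close>

definition prime_chain :: "('a, 'b) ring_scheme \<Rightarrow> nat \<Rightarrow> (nat \<Rightarrow> 'a set) \<Rightarrow> bool" where
  "prime_chain R n Q \<longleftrightarrow> (\<forall>i\<le>n. primeideal (Q i) R) \<and> (\<forall>i<n. Q i \<subset> Q (Suc i))"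

definition krull_dim :: "('a, 'b) ring_scheme \<Rightarrow> enat" where
  "krull_dim R = Sup {enat n | n. \<exists>Q. prime_chain R n Q}"

definition prime_height :: "('a, 'b) ring_scheme \<Rightarrow> 'a set \<Rightarrow> enat" where
  "prime_height R P = Sup {enat n | n. \<exists>Q. prime_chain R n Q \<and> Q n = P}"

definition ideal_height :: "('a, 'b) ring_scheme \<Rightarrow> 'a set \<Rightarrow> enat" where
  "ideal_height R I = Inf {prime_height R P | P. primeideal P R \<and> I \<subseteq> P}"

definition regular_sequence :: "('a, 'b) ring_scheme \<Rightarrow> 'a list \<Rightarrow> bool" where
  "regular_sequence R xs \<longleftrightarrow>
     set xs \<subseteq> carrier R \<and>
     (\<forall>i<length xs. \<forall>a\<in>carrier R.
        xs ! i \<otimes>\<^bsub>R\<^esub> a \<in> Idl\<^bsub>R\<^esub> (set (take i xs)) \<longrightarrow> a \<in> Idl\<^bsub>R\<^esub> (set (take i xs))) \<and>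
     Idl\<^bsub>R\<^esub> (set xs) \<noteq> carrier R"

definition grade :: "('a, 'b) ring_scheme \<Rightarrow> 'a set \<Rightarrow> enat" where
  "grade R I = Sup {enat (length xs) | xs. regular_sequence R xs \<and> set xs \<subseteq> I}"

locale noetherian_local_ring = cring R + noetherian_ring R for R (structure) +
  assumes unique_maximalideal: "\<exists>!M. maximalideal M R"

definition max_ideal :: "('a, 'b) ring_scheme \<Rightarrow> 'a set" where
  "max_ideal R = (THE M. maximalideal M R)"

definition depth :: "('a, 'b) ring_scheme \<Rightarrow> enat" where
  "depth R = grade R (max_ideal R)"

locale cohen_macaulay_local_ring = noetherian_local_ring +
  assumes depth_eq_dim: "depth R = krull_dim R"


section \<open>Modules\<close>

text \<open>A module record extends a ring record.  Its fields \<^const>\<open>monoid.mult\<close> and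
  \<^const>\<open>monoid.one\<close> are not constrained by the locale \<^locale>\<open>Module.module\<close>; they are left
  undefined below.\<close>

definition mod_hom ::
  "('a, 'b) ring_scheme \<Rightarrow> ('a, 'm) module \<Rightarrow> ('a, 'n) module \<Rightarrow> ('m \<Rightarrow> 'n) set" where
  "mod_hom R M N = {f \<in> carrier M \<rightarrow> carrier N.
     (\<forall>x\<in>carrier M. \<forall>y\<in>carrier M. f (x \<oplus>\<^bsub>M\<^esub> y) = f x \<oplus>\<^bsub>N\<^esub> f y) \<and>
     (\<forall>r\<in>carrier R. \<forall>x\<in>carrier M. f (r \<odot>\<^bsub>M\<^esub> x) = r \<odot>\<^bsub>N\<^esub> f x)}"

definition annihilator :: "('a, 'b) ring_scheme \<Rightarrow> ('a, 'm) module \<Rightarrow> 'a set" where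
  "annihilator R M = {r \<in> carrier R. \<forall>x\<in>carrier M. r \<odot>\<^bsub>M\<^esub> x = \<zero>\<^bsub>M\<^esub>}"

definition zero_module :: "('a, 'm) module \<Rightarrow> bool" where
  "zero_module M \<longleftrightarrow> carrier M = {\<zero>\<^bsub>M\<^esub>}"

definition quotient_module :: "('a, 'm) module \<Rightarrow> 'm set \<Rightarrow> ('a, 'm set) module" where
  "quotient_module M N =
     \<lparr>carrier = a_rcosets\<^bsub>M\<^esub> N, monoid.mult = undefined, one = undefined, ring.zero = N,
      add = (\<lambda>A B. A <+>\<^bsub>M\<^esub> B), smult = (\<lambda>r A. \<Union>x\<in>A. N +>\<^bsub>M\<^esub> (r \<odot>\<^bsub>M\<^esub> x))\<rparr>"

definition regular_module :: "('a, 'b) ring_scheme \<Rightarrow> ('a, 'a) module" where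
  "regular_module R =
     \<lparr>carrier = carrier R, monoid.mult = undefined, one = undefined, ring.zero = \<zero>\<^bsub>R\<^esub>,
      add = (\<lambda>x y. x \<oplus>\<^bsub>R\<^esub> y), smult = (\<lambda>r x. r \<otimes>\<^bsub>R\<^esub> x)\<rparr>"


section \<open>Projective dimension and perfect ideals\<close>

text \<open>The lifting property can only quantify over modules whose elements live in fixed types.
  The types chosen here suffice: with \<open>N = P\<close>, \<open>f = id\<close> and \<open>M\<close> the free module on the set
  \<open>carrier P\<close> (functions \<open>'p \<Rightarrow> 'a\<close> of finite support), the property makes \<open>P\<close> a direct summand
  of a free module, hence it gives the lifting property for modules over arbitrary types.\<close>

definition projective_module :: "('a, 'b) ring_scheme \<Rightarrow> ('a, 'p) module \<Rightarrow> bool" where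
  "projective_module R P \<longleftrightarrow> Module.module R P \<and>
     (\<forall>(M :: ('a, 'p \<Rightarrow> 'a) module) (N :: ('a, 'p) module) g f.
        Module.module R M \<and> Module.module R N \<and>
        g \<in> mod_hom R M N \<and> g ` carrier M = carrier N \<and> f \<in> mod_hom R P N \<longrightarrow>
        (\<exists>h\<in>mod_hom R P M. \<forall>x\<in>carrier P. g (h x) = f x))"

text \<open>\<open>\<dots> \<rightarrow> P 2 \<rightarrow> P 1 \<rightarrow> P 0 \<rightarrow> M \<rightarrow> 0\<close>, with \<open>d i : P (i + 1) \<rightarrow> P i\<close> and augmentation
  \<open>e : P 0 \<rightarrow> M\<close>.\<close>

definition projective_resolution ::
  "('a, 'b) ring_scheme \<Rightarrow> ('a, 'm) module \<Rightarrow>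
   (nat \<Rightarrow> ('a, 'p) module) \<Rightarrow> (nat \<Rightarrow> 'p \<Rightarrow> 'p) \<Rightarrow> ('p \<Rightarrow> 'm) \<Rightarrow> bool" where
  "projective_resolution R M P d e \<longleftrightarrow>
     (\<forall>i. projective_module R (P i)) \<and>
     (\<forall>i. d i \<in> mod_hom R (P (Suc i)) (P i)) \<and>
     e \<in> mod_hom R (P 0) M \<and>
     e ` carrier (P 0) = carrier M \<and>
     d 0 ` carrier (P 1) = a_kernel (P 0) M e \<and>
     (\<forall>i. d (Suc i) ` carrier (P (Suc (Suc i))) = a_kernel (P (Suc i)) (P i) (d i))"

text \<open>The type argument is the type of the elements of the modules in the resolutions.\<close>

definition proj_dim ::
  "'p itself \<Rightarrow> ('a, 'b) ring_scheme \<Rightarrow> ('a, 'm) module \<Rightarrow> enat" where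
  "proj_dim t R M =
     Inf {enat n | n. \<exists>(P :: nat \<Rightarrow> ('a, 'p) module) d e.
            projective_resolution R M P d e \<and> (\<forall>i>n. zero_module (P i))}"

text \<open>Over a Noetherian ring the type \<open>nat \<Rightarrow> 'a\<close> is large enough to compute the projective
  dimension of the finitely generated module \<open>R/I\<close>: if this is at most \<open>n\<close>, then there is a
  resolution of length \<open>n\<close> by finitely generated projective modules, and each of these embeds into
  some \<open>R\<^sup>k\<close>, hence into the functions \<open>nat \<Rightarrow> 'a\<close> vanishing from \<open>k\<close> on.\<close>

definition perfect_ideal :: "('a, 'b) ring_scheme \<Rightarrow> 'a set \<Rightarrow> bool" where
  "perfect_ideal R I \<longleftrightarrow> ideal I R \<and>
     proj_dim TYPE(nat \<Rightarrow> 'a) R (quotient_module (regular_module R) I) = grade R I"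


section \<open>Koszul homology\<close>

definition minimal_generating_list :: "('a, 'b) ring_scheme \<Rightarrow> 'a set \<Rightarrow> 'a list \<Rightarrow> bool" where
  "minimal_generating_list R I xs \<longleftrightarrow>
     set xs \<subseteq> carrier R \<and> distinct xs \<and> Idl\<^bsub>R\<^esub> (set xs) = I \<and>
     (\<forall>S. S \<subset> set xs \<longrightarrow> Idl\<^bsub>R\<^esub> S \<noteq> I)"

text \<open>The exterior power \<open>\<Lambda>\<^sup>p(R\<^sup>n)\<close> in coordinates: \<open>f\<close> stands for the sum of all \<open>f S \<cdot> e\<^sub>S\<close>, where
  \<open>S\<close> runs through the \<open>p\<close>-element subsets of \<open>{0, \<dots>, n - 1}\<close> and \<open>e\<^sub>S\<close> is the wedge product, in
  increasing order, of the basis vectors with index in \<open>S\<close>.\<close>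

definition ext_power :: "('a, 'b) ring_scheme \<Rightarrow> nat \<Rightarrow> nat \<Rightarrow> ('a, nat set \<Rightarrow> 'a) module" where
  "ext_power R n p =
     \<lparr>carrier = {f. (\<forall>S. f S \<in> carrier R) \<and>
                    (\<forall>S. \<not> (S \<subseteq> {..<n} \<and> card S = p) \<longrightarrow> f S = \<zero>\<^bsub>R\<^esub>)},
      monoid.mult = undefined, one = undefined, ring.zero = (\<lambda>S. \<zero>\<^bsub>R\<^esub>),
      add = (\<lambda>f g S. f S \<oplus>\<^bsub>R\<^esub> g S), smult = (\<lambda>r f S. r \<otimes>\<^bsub>R\<^esub> f S)\<rparr>"

text \<open>The differential sends \<open>e\<^sub>S\<close> to the alternating sum of \<open>x\<^sub>i \<cdot> e\<^sub>T\<close> over \<open>i \<in> S\<close>, where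
  \<open>T = S - {i}\<close> and the sign is given by the number of elements of \<open>S\<close> below \<open>i\<close>.  The formula
  below is the resulting coefficient of \<open>e\<^sub>T\<close>; it covers all degrees and vanishes in degree \<open>0\<close>.\<close>

definition koszul_diff ::
  "('a, 'b) ring_scheme \<Rightarrow> 'a list \<Rightarrow> (nat set \<Rightarrow> 'a) \<Rightarrow> (nat set \<Rightarrow> 'a)" where
  "koszul_diff R xs f = (\<lambda>T. \<Oplus>\<^bsub>R\<^esub>i\<in>{..<length xs} - T.
     ((\<ominus>\<^bsub>R\<^esub> \<one>\<^bsub>R\<^esub>) [^]\<^bsub>R\<^esub> card {j \<in> T. j < i}) \<otimes>\<^bsub>R\<^esub> (xs ! i \<otimes>\<^bsub>R\<^esub> f (insert i T)))"

definition koszul_cycles ::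
  "('a, 'b) ring_scheme \<Rightarrow> 'a list \<Rightarrow> nat \<Rightarrow> (nat set \<Rightarrow> 'a) set" where
  "koszul_cycles R xs p = {f \<in> carrier (ext_power R (length xs) p). koszul_diff R xs f = (\<lambda>S. \<zero>\<^bsub>R\<^esub>)}"

definition koszul_boundaries ::
  "('a, 'b) ring_scheme \<Rightarrow> 'a list \<Rightarrow> nat \<Rightarrow> (nat set \<Rightarrow> 'a) set" where
  "koszul_boundaries R xs p = koszul_diff R xs ` carrier (ext_power R (length xs) (Suc p))"

definition koszul_homology ::
  "('a, 'b) ring_scheme \<Rightarrow> 'a list \<Rightarrow> nat \<Rightarrow> ('a, (nat set \<Rightarrow> 'a) set) module" where
  "koszul_homology R xs p =
     quotient_module ((ext_power R (length xs) p)\<lparr>carrier := koszul_cycles R xs p\<rparr>)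
       (koszul_boundaries R xs p)"

end

theory Submission
  imports Defs
begin

text \<open>Let \<open>x\<^sub>1, \<dots>, x\<^sub>n\<close> be the minimal generators, \<open>d : R\<^sup>n \<rightarrow> I\<close> the map given by them and \<open>Z\<close> its
kernel, the module of syzygies.  Regular sequences in \<open>I\<close> are no longer than the height
(\<open>regular_sequence_length_le_height\<close>), so the projective dimension of \<open>R/I\<close>, being the grade, is
at most two.  Comparing a resolution of that length with the first two terms of the Koszul complex
gives finitely many elements of \<open>Z\<close> and linear functionals on \<open>Z\<close> that reconstruct every syzygy
(\<open>syzygies_dual_basis\<close>; \<open>ideal_dual_basis\<close> does the same for \<open>I\<close> if the length is at most one),
and over a local ring such a dual basis can be thinned out to a basis (\<open>local_free_basis\<close>).

If the projective dimension is at most one, then \<open>I\<close> is free, hence zero or generated by a single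
nonzerodivisor.  Then \<open>n \<le> 1\<close>, and only \<open>H\<^sub>0 = R/I\<close> survives.

If it is two, then so is the grade, and \<open>Z\<close> has a basis \<open>f\<^sub>1, \<dots>, f\<^sub>m\<close>.  The argument takes place in
the exterior algebra of \<open>R\<^sup>n\<close> and uses one relation only, \<open>\<iota>\<^sub>u (v \<and> w) + v \<and> \<iota>\<^sub>u w = \<langle>u, v\<rangle> w\<close> for
the contraction \<open>\<iota>\<^sub>u\<close> with a functional \<open>u\<close> and the wedge product with a vector \<open>v\<close>
(\<open>contract_wedge\<close>); the Koszul differential is the contraction with \<open>(x\<^sub>1, \<dots>, x\<^sub>n)\<close>.  The coordinate
functionals of the basis need not extend to \<open>R\<^sup>n\<close>, but their multiples by any element of \<open>I\<close> do.
Contracting products of vectors with these extensions yields three facts: \<open>n = m + 1\<close>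
(\<open>rank_syzygies\<close>); a product of distinct \<open>f\<^sub>j\<close> is only killed by zero (\<open>wedge_list_f_faithful\<close>);
and \<open>f\<^sub>1 \<and> \<dots> \<and> f\<^sub>m = c \<cdot> \<partial>(e\<^sub>1 \<and> \<dots> \<and> e\<^sub>n)\<close> with \<open>c\<close> invertible (\<open>wedge_list_f_unit\<close>), which is the
Hilbert--Burch theorem in a form free of determinants.  Here \<open>c\<close> exists because a regular sequence
of length two in \<open>I\<close> makes every cycle of degree \<open>m\<close> a multiple of \<open>\<partial>(e\<^sub>1 \<and> \<dots> \<and> e\<^sub>n)\<close>; this also
gives \<open>H\<^sub>p = 0\<close> for \<open>p \<ge> m\<close>.

Now let \<open>r\<close> kill \<open>H\<^sub>p\<close> with \<open>p < m\<close>.  Wedging a boundary with a syzygy gives a boundary, so \<open>r\<close>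
times any product of at least \<open>p\<close> of the \<open>f\<^sub>j\<close> is a boundary.  In particular \<open>r\<close> times the product
of all basis elements except \<open>f\<^sub>j\<close> is \<open>\<partial> b\<^sub>j\<close> for some \<open>b\<^sub>j\<close> of degree \<open>m = n - 1\<close>.  Up to an
invertible factor, \<open>v \<mapsto> v \<and> b\<^sub>j\<close> is a functional \<open>\<rho>\<^sub>j\<close> on all of \<open>R\<^sup>n\<close> with \<open>\<rho>\<^sub>j (f\<^sub>k) = r \<delta>\<^sub>j\<^sub>k\<close>
(\<open>killed_functional\<close>).  So \<open>\<pi> v = \<Sum>\<^sub>j \<rho>\<^sub>j (v) f\<^sub>j\<close> extends the multiplication by \<open>r\<close> on \<open>Z\<close>, and
\<open>d \<circ> \<pi> = 0\<close>.  For a regular sequence \<open>d g, d h\<close> in \<open>I\<close> the syzygy \<open>d h \<cdot> g - d g \<cdot> h\<close> shows that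
\<open>d h\<close> times \<open>r g - \<pi> g\<close> is divisible by \<open>d g\<close>, hence \<open>r g - \<pi> g = d g \<cdot> c\<close> for some vector \<open>c\<close>.
Applying \<open>d\<close> gives \<open>r = d c \<in> I\<close> (\<open>annihilator_homology_in_ideal\<close>).  The inclusion of \<open>I\<close> in the
annihilator is the usual homotopy (\<open>ideal_subset_annihilator\<close>).\<close>

section \<open>Operators on the exterior algebra\<close>

text \<open>The coordinate form of \<open>R\<^sup>A\<close> for finite \<open>A\<close>.  The index type is left open: vectors are
indexed by natural numbers, whereas coefficients with respect to generators of a module are
indexed by elements of that module.\<close>

definition free_module :: "('a, 'b) ring_scheme \<Rightarrow> 'i set \<Rightarrow> ('a, 'i \<Rightarrow> 'a) module" where
  "free_module R A =
     \<lparr>carrier = {f. (\<forall>i. f i \<in> carrier R) \<and> (\<forall>i. i \<notin> A \<longrightarrow> f i = \<zero>\<^bsub>R\<^esub>)},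
      monoid.mult = undefined, one = undefined, ring.zero = (\<lambda>i. \<zero>\<^bsub>R\<^esub>),
      add = (\<lambda>f g i. f i \<oplus>\<^bsub>R\<^esub> g i), smult = (\<lambda>r f i. r \<otimes>\<^bsub>R\<^esub> f i)\<rparr>"

text \<open>The sign of \<^const>\<open>koszul_diff\<close>: moving \<open>e\<^sub>i\<close> to its place in \<open>e\<^sub>T\<close> passes the factors with smaller
index.\<close>

definition koszul_sign :: "('a, 'b) ring_scheme \<Rightarrow> nat \<Rightarrow> nat set \<Rightarrow> 'a" where
  "koszul_sign R i T = (\<ominus>\<^bsub>R\<^esub> \<one>\<^bsub>R\<^esub>) [^]\<^bsub>R\<^esub> card {j \<in> T. j < i}"

definition wedge_at :: "('a, 'b) ring_scheme \<Rightarrow> nat \<Rightarrow> (nat set \<Rightarrow> 'a) \<Rightarrow> nat set \<Rightarrow> 'a" where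
  "wedge_at R k f = (\<lambda>T. if k \<in> T then koszul_sign R k T \<otimes>\<^bsub>R\<^esub> f (T - {k}) else \<zero>\<^bsub>R\<^esub>)"

definition contract_at :: "('a, 'b) ring_scheme \<Rightarrow> nat \<Rightarrow> (nat set \<Rightarrow> 'a) \<Rightarrow> nat set \<Rightarrow> 'a" where
  "contract_at R i f = (\<lambda>T. if i \<in> T then \<zero>\<^bsub>R\<^esub> else koszul_sign R i T \<otimes>\<^bsub>R\<^esub> f (insert i T))"

definition dot :: "('a, 'b) ring_scheme \<Rightarrow> nat \<Rightarrow> (nat \<Rightarrow> 'a) \<Rightarrow> (nat \<Rightarrow> 'a) \<Rightarrow> 'a" where
  "dot R n u v = (\<Oplus>\<^bsub>R\<^esub>i\<in>{..<n}. u i \<otimes>\<^bsub>R\<^esub> v i)"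

definition wedge ::
  "('a, 'b) ring_scheme \<Rightarrow> nat \<Rightarrow> (nat \<Rightarrow> 'a) \<Rightarrow> (nat set \<Rightarrow> 'a) \<Rightarrow> nat set \<Rightarrow> 'a" where
  "wedge R n v f = (\<lambda>T. \<Oplus>\<^bsub>R\<^esub>k\<in>{..<n}. v k \<otimes>\<^bsub>R\<^esub> wedge_at R k f T)"

definition contract ::
  "('a, 'b) ring_scheme \<Rightarrow> nat \<Rightarrow> (nat \<Rightarrow> 'a) \<Rightarrow> (nat set \<Rightarrow> 'a) \<Rightarrow> nat set \<Rightarrow> 'a" where
  "contract R n u f = (\<lambda>T. \<Oplus>\<^bsub>R\<^esub>i\<in>{..<n}. u i \<otimes>\<^bsub>R\<^esub> contract_at R i f T)"

context cring
begin

lemma finsum_swap: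
  assumes "finite A" "finite B" "\<And>i j. i \<in> A \<Longrightarrow> j \<in> B \<Longrightarrow> h i j \<in> carrier R"
  shows "(\<Oplus>i\<in>A. \<Oplus>j\<in>B. h i j) = (\<Oplus>j\<in>B. \<Oplus>i\<in>A. h i j)"
  using assms(1,3)
proof (induction A rule: finite_induct)
  case empty
  then show ?case using assms(2) by simp
next
  case (insert a A)
  have "(\<Oplus>i\<in>insert a A. \<Oplus>j\<in>B. h i j) = (\<Oplus>j\<in>B. h a j) \<oplus> (\<Oplus>j\<in>B. \<Oplus>i\<in>A. h i j)"
    using insert assms(2) by (subst finsum_insert) (auto intro!: finsum_closed)
  also have "\<dots> = (\<Oplus>j\<in>B. h a j \<oplus> (\<Oplus>i\<in>A. h i j))"
    using insert assms(2) by (subst finsum_addf) (auto intro!: finsum_closed)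
  also have "\<dots> = (\<Oplus>j\<in>B. \<Oplus>i\<in>insert a A. h i j)"
    using insert by (intro finsum_cong') (auto intro!: finsum_closed)
  finally show ?case .
qed

lemma finsum_delta:
  assumes "finite A" "k \<in> A" "c \<in> carrier R"
  shows "(\<Oplus>i\<in>A. if i = k then c else \<zero>) = c"
  using finsum_singleton[of k A "\<lambda>_. c"] assms by (simp add: eq_commute)

lemma finsum_mult_zero: "(\<And>i. i \<in> A \<Longrightarrow> u i \<in> carrier R) \<Longrightarrow> (\<Oplus>i\<in>A. u i \<otimes> \<zero>) = \<zero>"
  by (rule add.finprod_one_eqI) simp

lemma koszul_sign_closed [simp]: "koszul_sign R i T \<in> carrier R"
  by (simp add: koszul_sign_def)

lemma koszul_sign_square: "koszul_sign R i T \<otimes> koszul_sign R i T = \<one>"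
proof -
  have "(\<ominus> \<one>) [^] (k::nat) \<otimes> (\<ominus> \<one>) [^] k = \<one>" for k
    by (subst nat_pow_distrib[symmetric]) (auto simp: l_minus r_minus)
  then show ?thesis by (simp add: koszul_sign_def)
qed

lemma koszul_sign_remove: "koszul_sign R i (T - {i}) = koszul_sign R i T"
proof -
  have "{j \<in> T - {i}. j < i} = {j \<in> T. j < i}" by auto
  then show ?thesis by (simp add: koszul_sign_def)
qed

lemma koszul_sign_insert: "koszul_sign R i (insert i T) = koszul_sign R i T"
proof -
  have "{j \<in> insert i T. j < i} = {j \<in> T. j < i}" by auto
  then show ?thesis by (simp add: koszul_sign_def)
qed

text \<open>Exactly one of \<open>i < k\<close> and \<open>k < i\<close> holds, so inserting \<open>i\<close> and removing \<open>k\<close> in the two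
possible orders changes the total number of factors passed by one.  All anticommutation comes from
this.\<close>

lemma koszul_sign_anti:
  assumes "i \<noteq> k" "i \<notin> T" "k \<in> T"
  shows "koszul_sign R i T \<otimes> koszul_sign R k (insert i T)
       = \<ominus> (koszul_sign R k T \<otimes> koszul_sign R i (T - {k}))"
proof (cases "i < k")
  case True
  have 1: "{j \<in> T - {k}. j < i} = {j \<in> T. j < i}" using True by auto
  have 2: "{j \<in> insert i T. j < k} = insert i {j \<in> T. j < k}" using True by auto
  have "card {j \<in> insert i T. j < k} = Suc (card {j \<in> T. j < k})"
    unfolding 2 using assms by (subst card_insert_disjoint) auto
  then have "koszul_sign R k (insert i T) = \<ominus> koszul_sign R k T"
    unfolding koszul_sign_def by (simp only:) (simp add: r_minus)
  moreover have "koszul_sign R i (T - {k}) = koszul_sign R i T"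
    unfolding koszul_sign_def 1 ..
  ultimately show ?thesis by (simp add: r_minus m_comm)
next
  case False
  then have ki: "k < i" using assms by simp
  have 1: "{j \<in> insert i T. j < k} = {j \<in> T. j < k}" using ki by auto
  have 2: "{j \<in> T. j < i} = insert k {j \<in> T - {k}. j < i}" using ki assms by auto
  have "card {j \<in> T. j < i} = Suc (card {j \<in> T - {k}. j < i})"
    unfolding 2 by (subst card_insert_disjoint) auto
  then have "koszul_sign R i T = \<ominus> koszul_sign R i (T - {k})"
    unfolding koszul_sign_def by (simp only:) (simp add: r_minus)
  moreover have "koszul_sign R k (insert i T) = koszul_sign R k T"
    unfolding koszul_sign_def 1 ..
  ultimately show ?thesis by (simp add: l_minus m_comm[of "koszul_sign R k T"])
qed

lemma wedge_at_closed [simp]: "(\<And>T. f T \<in> carrier R) \<Longrightarrow> wedge_at R k f T \<in> carrier R"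
  by (simp add: wedge_at_def)

lemma contract_at_closed [simp]: "(\<And>T. f T \<in> carrier R) \<Longrightarrow> contract_at R k f T \<in> carrier R"
  by (simp add: contract_at_def)

lemma dot_closed [simp]:
  "(\<And>i. i < n \<Longrightarrow> u i \<in> carrier R) \<Longrightarrow> (\<And>i. i < n \<Longrightarrow> v i \<in> carrier R) \<Longrightarrow> dot R n u v \<in> carrier R"
  by (auto simp: dot_def intro!: finsum_closed)

lemma wedge_closed [simp]:
  "(\<And>i. i < n \<Longrightarrow> v i \<in> carrier R) \<Longrightarrow> (\<And>T. f T \<in> carrier R) \<Longrightarrow> wedge R n v f T \<in> carrier R"
  by (auto simp: wedge_def intro!: finsum_closed)

lemma contract_closed [simp]:
  "(\<And>i. i < n \<Longrightarrow> v i \<in> carrier R) \<Longrightarrow> (\<And>T. f T \<in> carrier R) \<Longrightarrow> contract R n v f T \<in> carrier R"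
  by (auto simp: contract_def intro!: finsum_closed)

text \<open>For \<open>i = k\<close> exactly one of the two terms is present, according to whether \<open>k \<in> T\<close>, and its
two signs cancel; for \<open>i \<noteq> k\<close> the terms are opposite by \<open>koszul_sign_anti\<close>.\<close>

lemma contract_at_wedge_at:
  assumes f: "\<And>T. f T \<in> carrier R"
  shows "contract_at R i (wedge_at R k f) T \<oplus> wedge_at R k (contract_at R i f) T
       = (if i = k then f T else \<zero>)"
proof (cases "i = k")
  case True
  show ?thesis
  proof (cases "k \<in> T")
    case kT: True
    then have "insert k (T - {k}) = T" by auto
    with kT True f show ?thesis
      by (simp add: contract_at_def wedge_at_def koszul_sign_remove koszul_sign_square
          flip: m_assoc)
  next
    case False
    with True f show ?thesis
      by (simp add: contract_at_def wedge_at_def koszul_sign_insert koszul_sign_square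
          flip: m_assoc)
  qed
next
  case False
  show ?thesis
  proof (cases "i \<notin> T \<and> k \<in> T")
    case True
    have s: "insert i T - {k} = insert i (T - {k})" using False by auto
    let ?w = "f (insert i (T - {k}))"
    have "contract_at R i (wedge_at R k f) T
        = koszul_sign R i T \<otimes> koszul_sign R k (insert i T) \<otimes> ?w"
      using True f by (simp add: contract_at_def wedge_at_def s m_assoc)
    also have "\<dots> = \<ominus> (koszul_sign R k T \<otimes> koszul_sign R i (T - {k}) \<otimes> ?w)"
      using koszul_sign_anti[OF False, of T] True f by (simp add: l_minus)
    finally have "contract_at R i (wedge_at R k f) T = \<ominus> wedge_at R k (contract_at R i f) T"
      using True f by (simp add: contract_at_def wedge_at_def m_assoc)
    then show ?thesis using False f by (simp add: l_neg)
  next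
    case False': False
    then show ?thesis using False f by (auto simp: contract_at_def wedge_at_def)
  qed
qed

lemma contract_at_wedge:
  assumes "\<And>T. f T \<in> carrier R" "\<And>k. k < n \<Longrightarrow> v k \<in> carrier R"
  shows "contract_at R i (wedge R n v f) T
       = (\<Oplus>k\<in>{..<n}. v k \<otimes> contract_at R i (wedge_at R k f) T)"
proof (cases "i \<in> T")
  case True
  then show ?thesis using assms by (simp add: contract_at_def) (rule finsum_mult_zero[symmetric], simp)
next
  case False
  then show ?thesis using assms
    by (auto simp: contract_at_def wedge_def finsum_rdistr Pi_def m_lcomm intro!: finsum_cong')
qed

lemma wedge_at_contract:
  assumes "\<And>T. f T \<in> carrier R" "\<And>k. k < n \<Longrightarrow> u k \<in> carrier R"
  shows "wedge_at R k (contract R n u f) T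
       = (\<Oplus>i\<in>{..<n}. u i \<otimes> wedge_at R k (contract_at R i f) T)"
proof (cases "k \<in> T")
  case False
  then show ?thesis using assms by (simp add: wedge_at_def) (rule finsum_mult_zero[symmetric], simp)
next
  case True
  then show ?thesis using assms
    by (auto simp: wedge_at_def contract_def finsum_rdistr Pi_def m_lcomm intro!: finsum_cong')
qed

text \<open>Contraction is an antiderivation.  For basis vectors and coordinate functionals this is
\<open>contract_at_wedge_at\<close>, and both sides are bilinear in \<open>u\<close> and \<open>v\<close>.  With the generators of the
ideal as \<open>u\<close> it is the homotopy formula of the Koszul complex, with dual functionals it isolates
the factors of a product.\<close>

lemma contract_wedge:
  assumes f: "\<And>T. f T \<in> carrier R"
    and u: "\<And>i. i < n \<Longrightarrow> u i \<in> carrier R" and v: "\<And>i. i < n \<Longrightarrow> v i \<in> carrier R"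
  shows "contract R n u (wedge R n v f) T \<oplus> wedge R n v (contract R n u f) T = dot R n u v \<otimes> f T"
proof -
  let ?C = "\<lambda>i k. contract_at R i (wedge_at R k f) T"
  let ?W = "\<lambda>i k. wedge_at R k (contract_at R i f) T"
  have 1: "contract R n u (wedge R n v f) T = (\<Oplus>i\<in>{..<n}. \<Oplus>k\<in>{..<n}. u i \<otimes> (v k \<otimes> ?C i k))"
    unfolding contract_def[of R n u "wedge R n v f"]
    using f u v by (auto simp: contract_at_wedge finsum_rdistr Pi_def intro!: finsum_cong' finsum_closed)
  have "wedge R n v (contract R n u f) T = (\<Oplus>k\<in>{..<n}. \<Oplus>i\<in>{..<n}. v k \<otimes> (u i \<otimes> ?W i k))"
    unfolding wedge_def[of R n v "contract R n u f"]
    using f u v by (auto simp: wedge_at_contract finsum_rdistr Pi_def intro!: finsum_cong' finsum_closed)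
  also have "\<dots> = (\<Oplus>i\<in>{..<n}. \<Oplus>k\<in>{..<n}. v k \<otimes> (u i \<otimes> ?W i k))"
    using f u v by (intro finsum_swap) auto
  also have "\<dots> = (\<Oplus>i\<in>{..<n}. \<Oplus>k\<in>{..<n}. u i \<otimes> (v k \<otimes> ?W i k))"
    using f u v by (intro finsum_cong' finsum_closed) (auto simp: m_lcomm)
  finally have 2: "wedge R n v (contract R n u f) T
      = (\<Oplus>i\<in>{..<n}. \<Oplus>k\<in>{..<n}. u i \<otimes> (v k \<otimes> ?W i k))" .
  have "contract R n u (wedge R n v f) T \<oplus> wedge R n v (contract R n u f) T
      = (\<Oplus>i\<in>{..<n}. (\<Oplus>k\<in>{..<n}. u i \<otimes> (v k \<otimes> ?C i k)) \<oplus> (\<Oplus>k\<in>{..<n}. u i \<otimes> (v k \<otimes> ?W i k)))"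
    unfolding 1 2 using f u v by (intro finsum_addf[symmetric]) (auto intro!: finsum_closed)
  also have "\<dots> = (\<Oplus>i\<in>{..<n}. \<Oplus>k\<in>{..<n}. u i \<otimes> (v k \<otimes> (?C i k \<oplus> ?W i k)))"
  proof (intro finsum_cong')
    fix i assume "i \<in> {..<n}"
    then show "(\<Oplus>k\<in>{..<n}. u i \<otimes> (v k \<otimes> ?C i k)) \<oplus> (\<Oplus>k\<in>{..<n}. u i \<otimes> (v k \<otimes> ?W i k))
        = (\<Oplus>k\<in>{..<n}. u i \<otimes> (v k \<otimes> (?C i k \<oplus> ?W i k)))"
      using f u v by (intro trans[OF finsum_addf[symmetric]] finsum_cong') (auto simp: r_distr)
  qed (use f u v in \<open>auto intro!: finsum_closed\<close>)
  also have "\<dots> = (\<Oplus>i\<in>{..<n}. u i \<otimes> (v i \<otimes> f T))"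
  proof (intro finsum_cong')
    fix i assume i: "i \<in> {..<n}"
    have "(\<Oplus>k\<in>{..<n}. u i \<otimes> (v k \<otimes> (?C i k \<oplus> ?W i k)))
        = (\<Oplus>k\<in>{..<n}. if k = i then u i \<otimes> (v i \<otimes> f T) else \<zero>)"
      using f u v i by (intro finsum_cong') (auto simp: contract_at_wedge_at)
    then show "(\<Oplus>k\<in>{..<n}. u i \<otimes> (v k \<otimes> (?C i k \<oplus> ?W i k))) = u i \<otimes> (v i \<otimes> f T)"
      using f u v i by (simp add: finsum_delta)
  qed (use f u v in auto)
  also have "\<dots> = dot R n u v \<otimes> f T"
    unfolding dot_def using f u v
    by (subst finsum_ldistr) (auto simp: m_assoc intro!: finsum_cong')
  finally show ?thesis .
qed

end

section \<open>Products of vectors\<close>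

text \<open>The product of the vectors \<open>f k\<close> for \<open>k\<close> in the list, built by successive wedging from the
unit of the exterior algebra.\<close>

definition wedge_list ::
  "('a, 'b) ring_scheme \<Rightarrow> nat \<Rightarrow> ('i \<Rightarrow> nat \<Rightarrow> 'a) \<Rightarrow> 'i list \<Rightarrow> nat set \<Rightarrow> 'a" where
  "wedge_list R n f ks =
     foldr (\<lambda>k. wedge R n (f k)) ks (\<lambda>T. if T = {} then \<one>\<^bsub>R\<^esub> else \<zero>\<^bsub>R\<^esub>)"

context cring
begin

lemma wedge_list_Nil: "wedge_list R n f [] = (\<lambda>T. if T = {} then \<one> else \<zero>)"
  by (simp add: wedge_list_def)

lemma wedge_list_Cons: "wedge_list R n f (k # ks) = wedge R n (f k) (wedge_list R n f ks)"
  by (simp add: wedge_list_def)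

lemma wedge_list_closed [simp]:
  assumes "\<And>k i. k \<in> set ks \<Longrightarrow> i < n \<Longrightarrow> f k i \<in> carrier R"
  shows "wedge_list R n f ks T \<in> carrier R"
  using assms by (induction ks arbitrary: T) (simp_all add: wedge_list_Nil wedge_list_Cons)

lemma contract_smult:
  assumes "\<And>T. f T \<in> carrier R" "\<And>i. i < n \<Longrightarrow> u i \<in> carrier R" "a \<in> carrier R"
  shows "contract R n u (\<lambda>T. a \<otimes> f T) T = a \<otimes> contract R n u f T"
  using assms
  by (auto simp: contract_def contract_at_def finsum_rdistr Pi_def m_lcomm intro!: finsum_cong')

lemma wedge_smult:
  assumes "\<And>T. f T \<in> carrier R" "\<And>i. i < n \<Longrightarrow> v i \<in> carrier R" "a \<in> carrier R"
  shows "wedge R n v (\<lambda>T. a \<otimes> f T) T = a \<otimes> wedge R n v f T"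
  using assms
  by (auto simp: wedge_def wedge_at_def finsum_rdistr Pi_def m_lcomm intro!: finsum_cong')

lemma contract_unit:
  assumes "\<And>i. i < n \<Longrightarrow> u i \<in> carrier R"
  shows "contract R n u (\<lambda>T. if T = {} then \<one> else \<zero>) T = \<zero>"
  unfolding contract_def
  by (rule add.finprod_one_eqI) (use assms in \<open>auto simp: contract_at_def\<close>)

lemma wedge_eq_zero:
  assumes "\<And>T. f T = \<zero>" "\<And>i. i < n \<Longrightarrow> v i \<in> carrier R"
  shows "wedge R n v f T = \<zero>"
  unfolding wedge_def
  by (rule add.finprod_one_eqI) (use assms in \<open>auto simp: wedge_at_def\<close>)

text \<open>The contraction moves past every factor by \<open>contract_wedge\<close> and finally kills the unit
form.\<close>

lemma contract_wedge_list_orthogonal: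
  assumes "\<And>i. i < n \<Longrightarrow> u i \<in> carrier R"
    and "\<And>k i. k \<in> set ks \<Longrightarrow> i < n \<Longrightarrow> f k i \<in> carrier R"
    and "\<And>k. k \<in> set ks \<Longrightarrow> dot R n u (f k) = \<zero>"
  shows "contract R n u (wedge_list R n f ks) T = \<zero>"
  using assms(2,3)
proof (induction ks arbitrary: T)
  case Nil
  then show ?case using assms(1) by (simp add: wedge_list_Nil contract_unit)
next
  case (Cons k ks)
  have "wedge R n (f k) (contract R n u (wedge_list R n f ks)) T = \<zero>"
    using Cons by (intro wedge_eq_zero) auto
  moreover have "contract R n u (wedge R n (f k) (wedge_list R n f ks)) T
      \<oplus> wedge R n (f k) (contract R n u (wedge_list R n f ks)) T
      = dot R n u (f k) \<otimes> wedge_list R n f ks T"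
    using Cons.prems assms(1) by (intro contract_wedge) auto
  ultimately show ?case using Cons.prems assms(1) by (simp add: wedge_list_Cons)
qed

lemma contract_wedge_list_Cons:
  assumes "\<And>i. i < n \<Longrightarrow> u i \<in> carrier R"
    and "\<And>j i. j \<in> set (k # ks) \<Longrightarrow> i < n \<Longrightarrow> f j i \<in> carrier R"
    and "\<And>j. j \<in> set ks \<Longrightarrow> dot R n u (f j) = \<zero>"
  shows "contract R n u (wedge_list R n f (k # ks)) T = dot R n u (f k) \<otimes> wedge_list R n f ks T"
proof -
  have "wedge R n (f k) (contract R n u (wedge_list R n f ks)) T = \<zero>"
    using assms by (intro wedge_eq_zero contract_wedge_list_orthogonal) auto
  moreover have "contract R n u (wedge R n (f k) (wedge_list R n f ks)) T
      \<oplus> wedge R n (f k) (contract R n u (wedge_list R n f ks)) T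
      = dot R n u (f k) \<otimes> wedge_list R n f ks T"
    using assms by (intro contract_wedge) auto
  ultimately show ?thesis using assms by (simp add: wedge_list_Cons)
qed

text \<open>A substitute for determinants: contracting with the functionals dual to the factors, from
the outermost one inwards, turns the product into \<open>x\<close> to the number of factors.  Whatever divides
the product therefore divides that power of \<open>x\<close>.  The scalar \<open>a\<close> collects the powers of \<open>x\<close> in the
induction; the case \<open>u = \<zero>\<close> says that only annihilators of the power of \<open>x\<close> can annihilate the
product.\<close>

lemma wedge_list_divides:
  assumes "x \<in> carrier R"
    and l: "\<And>k i. k \<in> set ks \<Longrightarrow> i < n \<Longrightarrow> l k i \<in> carrier R"
    and f: "\<And>k i. k \<in> set ks \<Longrightarrow> i < n \<Longrightarrow> f k i \<in> carrier R"
    and lf: "\<And>j k. j \<in> set ks \<Longrightarrow> k \<in> set ks \<Longrightarrow> dot R n (l j) (f k) = (if j = k then x else \<zero>)"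
    and "distinct ks"
    and "a \<in> carrier R" "u \<in> carrier R" "\<And>T. w T \<in> carrier R"
    and "\<And>T. a \<otimes> wedge_list R n f ks T = u \<otimes> w T"
  shows "\<exists>q\<in>carrier R. a \<otimes> x [^] length ks = u \<otimes> q"
  using assms(2-)
proof (induction ks arbitrary: a w)
  case Nil
  from Nil.prems(8)[of "{}"] Nil.prems(5) have "a = u \<otimes> w {}"
    by (simp add: wedge_list_Nil)
  then show ?case using Nil.prems by auto
next
  case (Cons k ks)
  have eq: "(\<lambda>T. a \<otimes> wedge_list R n f (k # ks) T) = (\<lambda>T. u \<otimes> w T)"
    using Cons.prems(8) by auto
  have "(a \<otimes> x) \<otimes> wedge_list R n f ks T = u \<otimes> contract R n (l k) w T" for T
  proof -
    have wl: "wedge_list R n f ks T \<in> carrier R"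
      using Cons.prems(2) by (intro wedge_list_closed) auto
    have orth: "dot R n (l k) (f j) = \<zero>" if "j \<in> set ks" for j
      using Cons.prems(3)[of k j] Cons.prems(4) that by auto
    have "contract R n (l k) (wedge_list R n f (k # ks)) T
        = dot R n (l k) (f k) \<otimes> wedge_list R n f ks T"
      using Cons.prems(1,2) orth by (intro contract_wedge_list_Cons) auto
    then have "(a \<otimes> x) \<otimes> wedge_list R n f ks T
        = a \<otimes> contract R n (l k) (wedge_list R n f (k # ks)) T"
      using Cons.prems(3)[of k k] Cons.prems(5) assms(1) wl by (simp add: m_assoc)
    also have "\<dots> = contract R n (l k) (\<lambda>T. a \<otimes> wedge_list R n f (k # ks) T) T"
      using Cons.prems(1,2,5) by (intro contract_smult[symmetric] wedge_list_closed) auto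
    also have "\<dots> = u \<otimes> contract R n (l k) w T"
      unfolding eq using Cons.prems by (intro contract_smult) auto
    finally show ?thesis .
  qed
  then have "\<exists>q\<in>carrier R. (a \<otimes> x) \<otimes> x [^] length ks = u \<otimes> q"
    using Cons.prems assms(1) by (intro Cons.IH[of _ "contract R n (l k) w"]) auto
  then show ?case using Cons.prems(5) assms(1)
    by (auto simp: m_assoc m_comm[of x])
qed

lemma wedge_in_ext_power:
  assumes "f \<in> carrier (ext_power R n p)" "\<And>i. i < n \<Longrightarrow> v i \<in> carrier R"
  shows "wedge R n v f \<in> carrier (ext_power R n (Suc p))"
proof -
  have "wedge R n v f T = \<zero>" if T: "\<not> (T \<subseteq> {..<n} \<and> card T = Suc p)" for T
    unfolding wedge_def
  proof (rule add.finprod_one_eqI)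
    fix k assume k: "k \<in> {..<n}"
    have "wedge_at R k f T = \<zero>"
    proof (cases "k \<in> T")
      case True
      have "\<not> (T - {k} \<subseteq> {..<n} \<and> card (T - {k}) = p)"
      proof
        assume a: "T - {k} \<subseteq> {..<n} \<and> card (T - {k}) = p"
        then have "T \<subseteq> {..<n}" using k by auto
        moreover from this have "finite T" by (rule finite_subset) simp
        ultimately show False using T a True
          by (metis card_Suc_Diff1)
      qed
      then have "f (T - {k}) = \<zero>" using assms(1) unfolding ext_power_def by simp
      then show ?thesis by (simp add: wedge_at_def)
    qed (simp add: wedge_at_def)
    then show "v k \<otimes> wedge_at R k f T = \<zero>" using assms k by simp
  qed
  then show ?thesis using assms by (auto simp: ext_power_def)
qed

lemma wedge_list_in_ext_power:
  assumes "\<And>k i. k \<in> set ks \<Longrightarrow> i < n \<Longrightarrow> f k i \<in> carrier R"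
  shows "wedge_list R n f ks \<in> carrier (ext_power R n (length ks))"
  using assms
proof (induction ks)
  case Nil
  show ?case by (auto simp: wedge_list_Nil ext_power_def)
next
  case (Cons k ks)
  then show ?case by (auto simp: wedge_list_Cons intro!: wedge_in_ext_power)
qed

lemma ext_power_trivial:
  assumes "f \<in> carrier (ext_power R n p)" "n < p"
  shows "f T = \<zero>"
proof -
  have "\<not> (T \<subseteq> {..<n} \<and> card T = p)"
    using assms(2) card_mono[of "{..<n}" T] by auto
  then show ?thesis using assms(1) by (auto simp: ext_power_def)
qed

text \<open>More than \<open>n\<close> vectors of \<open>R\<^sup>n\<close> have product zero for reasons of degree, which contradicts
\<open>wedge_list_divides\<close> since \<open>x\<close> has no vanishing power.\<close>

lemma biorthogonal_le:
  assumes x: "x \<in> carrier R" and reg: "\<And>a. a \<in> carrier R \<Longrightarrow> x \<otimes> a = \<zero> \<Longrightarrow> a = \<zero>"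
    and "\<one> \<noteq> \<zero>"
    and l: "\<And>k i. k < N \<Longrightarrow> i < n \<Longrightarrow> l k i \<in> carrier R"
    and f: "\<And>k i. k < N \<Longrightarrow> i < n \<Longrightarrow> f k i \<in> carrier R"
    and lf: "\<And>j k. j < N \<Longrightarrow> k < N \<Longrightarrow> dot R n (l j) (f k) = (if j = k then x else \<zero>)"
  shows "N \<le> n"
proof (rule ccontr)
  assume "\<not> N \<le> n"
  then have "wedge_list R n f [0..<N] T = \<zero>" for T
    using f by (intro ext_power_trivial[OF wedge_list_in_ext_power]) auto
  then have "\<exists>q\<in>carrier R. \<one> \<otimes> x [^] length [0..<N] = \<zero> \<otimes> q"
    using x l f lf by (intro wedge_list_divides[where l = l and f = f and n = n and w = "\<lambda>_. \<zero>"]) auto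
  then have z: "x [^] N = \<zero>" using x by auto
  have "x [^] (k::nat) \<noteq> \<zero>" for k
  proof (induction k)
    case (Suc k)
    then show ?case using reg[of "x [^] k"] x by (auto simp: m_comm)
  qed (use assms(3) in simp)
  with z show False by simp
qed

section \<open>Free modules, submodules and linear functionals\<close>

lemma free_module_module: "module R (free_module R A)"
proof (rule moduleI)
  show "cring R" by (rule is_cring)
  show "abelian_group (free_module R A)"
  proof (rule abelian_groupI)
    fix f assume f: "f \<in> carrier (free_module R A)"
    show "\<exists>g\<in>carrier (free_module R A). g \<oplus>\<^bsub>free_module R A\<^esub> f = \<zero>\<^bsub>free_module R A\<^esub>"
      using f by (intro bexI[of _ "\<lambda>i. \<ominus> f i"]) (auto simp: free_module_def l_neg)
  qed (auto simp: free_module_def a_ac intro!: ext)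
qed (auto simp: free_module_def l_distr r_distr m_assoc)

lemma regular_module_module: "module R (regular_module R)"
proof (rule moduleI)
  show "cring R" by (rule is_cring)
  show "abelian_group (regular_module R)"
  proof (rule abelian_groupI)
    fix a assume "a \<in> carrier (regular_module R)"
    then show "\<exists>b\<in>carrier (regular_module R). b \<oplus>\<^bsub>regular_module R\<^esub> a = \<zero>\<^bsub>regular_module R\<^esub>"
      by (intro bexI[of _ "\<ominus> a"]) (auto simp: regular_module_def l_neg)
  qed (auto simp: regular_module_def a_ac)
qed (auto simp: regular_module_def l_distr r_distr m_assoc)

text \<open>Negation is multiplication by \<open>\<ominus> \<one>\<close>.\<close>

lemma submodule_moduleI:
  assumes M: "module R M" and H: "H \<subseteq> carrier M" "\<zero>\<^bsub>M\<^esub> \<in> H"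
    and add: "\<And>a b. a \<in> H \<Longrightarrow> b \<in> H \<Longrightarrow> a \<oplus>\<^bsub>M\<^esub> b \<in> H"
    and smult: "\<And>r a. r \<in> carrier R \<Longrightarrow> a \<in> H \<Longrightarrow> r \<odot>\<^bsub>M\<^esub> a \<in> H"
  shows "module R (M\<lparr>carrier := H\<rparr>)"
proof -
  interpret M: module R M by fact
  have "\<ominus>\<^bsub>M\<^esub> a \<in> H" if "a \<in> H" for a
    using smult[OF a_inv_closed[OF one_closed] that] that H M.smult_l_minus[of \<one> a] by auto
  then have "submodule H R M"
    using assms by (intro M.submoduleI) auto
  then show ?thesis using M by (rule submodule.submodule_is_module)
qed

lemma mod_hom_zero:
  assumes "module R M" "module R N" "f \<in> mod_hom R M N"
  shows "f \<zero>\<^bsub>M\<^esub> = \<zero>\<^bsub>N\<^esub>"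
proof -
  interpret M: module R M by fact
  interpret N: module R N by fact
  have "f (\<zero> \<odot>\<^bsub>M\<^esub> \<zero>\<^bsub>M\<^esub>) = \<zero> \<odot>\<^bsub>N\<^esub> f \<zero>\<^bsub>M\<^esub>"
    using assms(3) M.zero_closed zero_closed unfolding mod_hom_def by blast
  moreover have "f \<zero>\<^bsub>M\<^esub> \<in> carrier N" using assms(3) by (auto simp: mod_hom_def)
  ultimately show ?thesis by simp
qed

lemma mod_hom_lincomb:
  assumes M: "module R M" and N: "module R N" and f: "f \<in> mod_hom R M N"
    and "finite A" "\<And>k. k \<in> A \<Longrightarrow> c k \<in> carrier R" "\<And>k. k \<in> A \<Longrightarrow> z k \<in> carrier M"
  shows "f (\<Oplus>\<^bsub>M\<^esub>k\<in>A. c k \<odot>\<^bsub>M\<^esub> z k) = (\<Oplus>\<^bsub>N\<^esub>k\<in>A. c k \<odot>\<^bsub>N\<^esub> f (z k))"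
  using assms(4-)
proof (induction A rule: finite_induct)
  case empty
  interpret M: module R M by fact
  interpret N: module R N by fact
  show ?case using mod_hom_zero[OF M N f] by simp
next
  case (insert a A)
  interpret M: module R M by fact
  interpret N: module R N by fact
  have fz: "f w \<in> carrier N" if "w \<in> carrier M" for w
    using f that by (auto simp: mod_hom_def)
  have "f (\<Oplus>\<^bsub>M\<^esub>k\<in>insert a A. c k \<odot>\<^bsub>M\<^esub> z k) = f (c a \<odot>\<^bsub>M\<^esub> z a \<oplus>\<^bsub>M\<^esub> (\<Oplus>\<^bsub>M\<^esub>k\<in>A. c k \<odot>\<^bsub>M\<^esub> z k))"
    using insert by (subst M.finsum_insert) auto
  also have "\<dots> = c a \<odot>\<^bsub>N\<^esub> f (z a) \<oplus>\<^bsub>N\<^esub> f (\<Oplus>\<^bsub>M\<^esub>k\<in>A. c k \<odot>\<^bsub>M\<^esub> z k)"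
    using f insert by (auto simp: mod_hom_def intro!: M.finsum_closed)
  also have "\<dots> = (\<Oplus>\<^bsub>N\<^esub>k\<in>insert a A. c k \<odot>\<^bsub>N\<^esub> f (z k))"
    using insert fz by (subst N.finsum_insert) auto
  finally show ?case .
qed

lemma finsum_regular_module:
  assumes "finite A" "\<And>k. k \<in> A \<Longrightarrow> c k \<in> carrier R"
  shows "finsum (regular_module R) c A = finsum R c A"
proof -
  interpret M: module R "regular_module R" by (rule regular_module_module)
  show ?thesis using assms
    by (induction A rule: finite_induct)
      (auto simp: regular_module_def M.finsum_insert[unfolded regular_module_def]
        M.finsum_empty[unfolded regular_module_def])
qed

lemma finsum_submodule:
  assumes M: "module R M" and M': "module R (M\<lparr>carrier := H\<rparr>)" and H: "H \<subseteq> carrier M"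
    and "finite A" "\<And>k. k \<in> A \<Longrightarrow> c k \<in> H"
  shows "finsum (M\<lparr>carrier := H\<rparr>) c A = finsum M c A"
  using assms(4-)
proof (induction A rule: finite_induct)
  case empty
  interpret M: module R M by fact
  interpret M': module R "M\<lparr>carrier := H\<rparr>" by (rule M')
  have "finsum (M\<lparr>carrier := H\<rparr>) c {} = \<zero>\<^bsub>M\<lparr>carrier := H\<rparr>\<^esub>" by (rule M'.finsum_empty)
  then show ?case by simp
next
  case (insert a A)
  interpret M: module R M by fact
  interpret M': module R "M\<lparr>carrier := H\<rparr>" by (rule M')
  have "finsum (M\<lparr>carrier := H\<rparr>) c (insert a A)
      = c a \<oplus>\<^bsub>M\<lparr>carrier := H\<rparr>\<^esub> finsum (M\<lparr>carrier := H\<rparr>) c A"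
    using insert by (intro M'.finsum_insert) auto
  also have "\<dots> = finsum M c (insert a A)"
    using insert H by (subst M.finsum_insert) auto
  finally show ?case .
qed

lemma finsum_free_submodule:
  assumes M: "module R ((free_module R B)\<lparr>carrier := H\<rparr>)" and H: "H \<subseteq> carrier (free_module R B)"
    and A: "finite A" and c: "\<And>k. k \<in> A \<Longrightarrow> c k \<in> H"
  shows "finsum ((free_module R B)\<lparr>carrier := H\<rparr>) c A = (\<lambda>i. \<Oplus>k\<in>A. c k i)"
proof -
  interpret F: module R "free_module R B" by (rule free_module_module)
  have "finsum (free_module R B) c A = (\<lambda>i. \<Oplus>k\<in>A. c k i)"
    using A subsetD[OF H c]
  proof (induction A rule: finite_induct)
    case empty
    have "finsum (free_module R B) c {} = \<zero>\<^bsub>free_module R B\<^esub>" by (rule F.finsum_empty)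
    then show ?case by (simp add: free_module_def)
  next
    case (insert a A)
    have "finsum (free_module R B) c (insert a A)
        = c a \<oplus>\<^bsub>free_module R B\<^esub> finsum (free_module R B) c A"
      using insert by (intro F.finsum_insert) auto
    also have "\<dots> = (\<lambda>i. c a i \<oplus> (\<Oplus>k\<in>A. c k i))"
      using insert by (simp add: free_module_def)
    also have "\<dots> = (\<lambda>i. \<Oplus>k\<in>insert a A. c k i)"
    proof
      fix i
      have "c k i \<in> carrier R" if "k \<in> insert a A" for k
        using insert.prems[OF that] by (simp add: free_module_def)
      then show "c a i \<oplus> (\<Oplus>k\<in>A. c k i) = (\<Oplus>k\<in>insert a A. c k i)"
        using insert by (subst finsum_insert) auto
    qed
    finally show ?case .
  qed
  then show ?thesis using finsum_submodule[OF free_module_module M H A c] by simp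
qed

lemma functional_lincomb:
  assumes M: "module R M" and f: "f \<in> mod_hom R M (regular_module R)"
    and "finite A" "\<And>k. k \<in> A \<Longrightarrow> c k \<in> carrier R" "\<And>k. k \<in> A \<Longrightarrow> z k \<in> carrier M"
  shows "f (\<Oplus>\<^bsub>M\<^esub>k\<in>A. c k \<odot>\<^bsub>M\<^esub> z k) = (\<Oplus>k\<in>A. c k \<otimes> f (z k))"
proof -
  have fz: "f w \<in> carrier R" if "w \<in> carrier M" for w
    using f that by (auto simp: mod_hom_def regular_module_def)
  have "f (\<Oplus>\<^bsub>M\<^esub>k\<in>A. c k \<odot>\<^bsub>M\<^esub> z k) = finsum (regular_module R) (\<lambda>k. c k \<otimes> f (z k)) A"
    using mod_hom_lincomb[OF M regular_module_module f assms(3-)] by (simp add: regular_module_def)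
  also have "\<dots> = (\<Oplus>k\<in>A. c k \<otimes> f (z k))"
    using assms(3-) fz by (intro finsum_regular_module) auto
  finally show ?thesis .
qed

end

section \<open>Bases of the syzygy module\<close>

definition syzygies :: "('a, 'b) ring_scheme \<Rightarrow> 'a list \<Rightarrow> (nat \<Rightarrow> 'a) set" where
  "syzygies R xs = {z \<in> carrier (free_module R {..<length xs}). dot R (length xs) ((!) xs) z = \<zero>\<^bsub>R\<^esub>}"

definition syzygy_module :: "('a, 'b) ring_scheme \<Rightarrow> 'a list \<Rightarrow> ('a, nat \<Rightarrow> 'a) module" where
  "syzygy_module R xs = (free_module R {..<length xs})\<lparr>carrier := syzygies R xs\<rparr>"

text \<open>The dual basis criterion for finitely generated projective modules: the elements \<open>f j\<close>
generate \<open>M\<close> and the functionals provide coefficients.\<close>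

definition dual_basis ::
  "('a, 'b) ring_scheme \<Rightarrow> ('a, 'm) module \<Rightarrow> nat \<Rightarrow> (nat \<Rightarrow> 'm) \<Rightarrow> (nat \<Rightarrow> 'm \<Rightarrow> 'a) \<Rightarrow> bool" where
  "dual_basis R M m f \<psi> \<longleftrightarrow>
     (\<forall>j<m. f j \<in> carrier M) \<and> (\<forall>j<m. \<psi> j \<in> mod_hom R M (regular_module R)) \<and>
     (\<forall>z\<in>carrier M. z = (\<Oplus>\<^bsub>M\<^esub>j\<in>{..<m}. \<psi> j z \<odot>\<^bsub>M\<^esub> f j))"

definition free_basis ::
  "('a, 'b) ring_scheme \<Rightarrow> ('a, 'm) module \<Rightarrow> nat \<Rightarrow> (nat \<Rightarrow> 'm) \<Rightarrow> (nat \<Rightarrow> 'm \<Rightarrow> 'a) \<Rightarrow> bool" where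
  "free_basis R M m f \<psi> \<longleftrightarrow> dual_basis R M m f \<psi> \<and>
     (\<forall>i<m. \<forall>j<m. \<psi> i (f j) = (if i = j then \<one>\<^bsub>R\<^esub> else \<zero>\<^bsub>R\<^esub>))"

context cring
begin

lemma dot_add:
  assumes "\<And>i. i < n \<Longrightarrow> u i \<in> carrier R" "\<And>i. i < n \<Longrightarrow> v i \<in> carrier R" "\<And>i. i < n \<Longrightarrow> w i \<in> carrier R"
  shows "dot R n u (\<lambda>i. v i \<oplus> w i) = dot R n u v \<oplus> dot R n u w"
proof -
  have "dot R n u (\<lambda>i. v i \<oplus> w i) = (\<Oplus>i\<in>{..<n}. u i \<otimes> v i \<oplus> u i \<otimes> w i)"
    unfolding dot_def using assms by (intro finsum_cong') (auto simp: r_distr)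
  also have "\<dots> = dot R n u v \<oplus> dot R n u w"
    unfolding dot_def using assms by (intro finsum_addf) auto
  finally show ?thesis .
qed

lemma dot_smult:
  assumes "\<And>i. i < n \<Longrightarrow> u i \<in> carrier R" "\<And>i. i < n \<Longrightarrow> v i \<in> carrier R" "a \<in> carrier R"
  shows "dot R n u (\<lambda>i. a \<otimes> v i) = a \<otimes> dot R n u v"
  unfolding dot_def using assms
  by (auto simp: finsum_rdistr Pi_def m_lcomm intro!: finsum_cong')

lemma dot_minus:
  assumes u: "\<And>i. i < n \<Longrightarrow> u i \<in> carrier R" and v: "\<And>i. i < n \<Longrightarrow> v i \<in> carrier R"
    and w: "\<And>i. i < n \<Longrightarrow> w i \<in> carrier R"
  shows "dot R n u (\<lambda>i. v i \<ominus> w i) = dot R n u v \<ominus> dot R n u w"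
proof -
  have "dot R n u (\<lambda>i. v i \<ominus> w i) = dot R n u (\<lambda>i. v i \<oplus> \<ominus> \<one> \<otimes> w i)"
    unfolding dot_def using assms by (intro finsum_cong') (auto simp: minus_eq l_minus)
  also have "\<dots> = dot R n u v \<oplus> dot R n u (\<lambda>i. \<ominus> \<one> \<otimes> w i)"
    using assms by (intro dot_add) auto
  also have "dot R n u (\<lambda>i. \<ominus> \<one> \<otimes> w i) = \<ominus> \<one> \<otimes> dot R n u w"
    using assms by (intro dot_smult) auto
  finally show ?thesis using assms by (simp add: minus_eq l_minus)
qed

lemma dot_unit:
  assumes "\<And>i. i < n \<Longrightarrow> u i \<in> carrier R" "k < n"
  shows "dot R n u (\<lambda>i. if i = k then \<one> else \<zero>) = u k"
proof -
  have "dot R n u (\<lambda>i. if i = k then \<one> else \<zero>) = (\<Oplus>i\<in>{..<n}. if i = k then u k else \<zero>)"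
    unfolding dot_def using assms by (intro finsum_cong') auto
  then show ?thesis using assms by (simp add: finsum_delta)
qed

lemma syzygies_subset: "syzygies R xs \<subseteq> carrier (free_module R {..<length xs})"
  by (auto simp: syzygies_def)

lemma syzygy_module_module:
  assumes "set xs \<subseteq> carrier R"
  shows "module R (syzygy_module R xs)"
  unfolding syzygy_module_def
proof (rule submodule_moduleI[OF free_module_module])
  have xs: "xs ! i \<in> carrier R" if "i < length xs" for i using assms that by auto
  show "syzygies R xs \<subseteq> carrier (free_module R {..<length xs})" by (rule syzygies_subset)
  show "\<zero>\<^bsub>free_module R {..<length xs}\<^esub> \<in> syzygies R xs"
    using xs by (auto simp: syzygies_def free_module_def dot_def intro!: add.finprod_one_eqI)
  show "a \<oplus>\<^bsub>free_module R {..<length xs}\<^esub> b \<in> syzygies R xs"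
    if "a \<in> syzygies R xs" "b \<in> syzygies R xs" for a b
    using xs that by (auto simp: syzygies_def free_module_def dot_add)
  show "r \<odot>\<^bsub>free_module R {..<length xs}\<^esub> a \<in> syzygies R xs"
    if "r \<in> carrier R" "a \<in> syzygies R xs" for r a
    using xs that by (auto simp: syzygies_def free_module_def dot_smult)
qed

text \<open>The two sums differ only in the terms with index in \<open>T\<close>, which vanish on the right.\<close>

lemma koszul_diff_eq_contract:
  assumes "set xs \<subseteq> carrier R" "\<And>T. f T \<in> carrier R"
  shows "koszul_diff R xs f = contract R (length xs) ((!) xs) f"
proof
  fix T
  have xs: "xs ! i \<in> carrier R" if "i < length xs" for i using assms that by auto
  show "koszul_diff R xs f T = contract R (length xs) ((!) xs) f T"
    unfolding koszul_diff_def contract_def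
    using xs assms(2)
    by (intro add.finprod_mono_neutral_cong_left)
      (auto simp: contract_at_def m_lcomm simp flip: koszul_sign_def)
qed

end

text \<open>The situation of projective dimension two.  The vectors \<open>g\<close> and \<open>h\<close> are preimages under \<open>d\<close>
of the two terms of a regular sequence in the ideal; keeping the preimages instead of the ideal
elements gives access to the homotopies \<open>g \<and> _\<close> and \<open>h \<and> _\<close>.\<close>

locale free_syzygies = cring R for R (structure) +
  fixes xs :: "'a list" and g h :: "nat \<Rightarrow> 'a" and m :: nat
    and f :: "nat \<Rightarrow> nat \<Rightarrow> 'a" and \<psi> :: "nat \<Rightarrow> (nat \<Rightarrow> 'a) \<Rightarrow> 'a"
  assumes xs_closed: "set xs \<subseteq> carrier R"
    and g: "g \<in> carrier (free_module R {..<length xs})"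
    and h: "h \<in> carrier (free_module R {..<length xs})"
    and regular1: "\<And>a. a \<in> carrier R \<Longrightarrow> dot R (length xs) ((!) xs) g \<otimes> a = \<zero> \<Longrightarrow> a = \<zero>"
    and regular2: "\<And>a b. a \<in> carrier R \<Longrightarrow> b \<in> carrier R \<Longrightarrow>
       dot R (length xs) ((!) xs) h \<otimes> a = dot R (length xs) ((!) xs) g \<otimes> b \<Longrightarrow>
       \<exists>c\<in>carrier R. a = dot R (length xs) ((!) xs) g \<otimes> c"
    and nontrivial: "\<one> \<noteq> \<zero>"
    and basis: "free_basis R (syzygy_module R xs) m f \<psi>"
begin

abbreviation "n \<equiv> length xs"
abbreviation "d \<equiv> dot R n ((!) xs)"
abbreviation "V \<equiv> carrier (free_module R {..<n})"

lemma xs_nth [simp]: "i < n \<Longrightarrow> xs ! i \<in> carrier R"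
  using xs_closed by auto

lemma V_closed: "v \<in> V \<Longrightarrow> v i \<in> carrier R"
  by (simp add: free_module_def)

lemma d_closed [simp]: "v \<in> V \<Longrightarrow> d v \<in> carrier R"
  by (auto intro!: dot_closed simp: V_closed)

lemma regular_cancel:
  assumes "a \<in> carrier R" "b \<in> carrier R" "d g \<otimes> a = d g \<otimes> b"
  shows "a = b"
proof -
  have "d g \<otimes> (a \<ominus> b) = \<zero>"
    using assms g by (simp add: minus_eq r_distr r_minus r_neg)
  then show ?thesis using regular1[of "a \<ominus> b"] assms by simp
qed

lemma f_syzygy: "j < m \<Longrightarrow> f j \<in> syzygies R xs"
  using basis by (simp add: free_basis_def dual_basis_def syzygy_module_def)

lemma f_V: "j < m \<Longrightarrow> f j \<in> V"
  using f_syzygy syzygies_subset by blast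

lemma f_closed [simp]: "j < m \<Longrightarrow> f j i \<in> carrier R"
  using f_V V_closed by blast

lemma d_f: "j < m \<Longrightarrow> d (f j) = \<zero>"
  using f_syzygy by (simp add: syzygies_def)

lemma psi_hom: "j < m \<Longrightarrow> \<psi> j \<in> mod_hom R (syzygy_module R xs) (regular_module R)"
  using basis by (simp add: free_basis_def dual_basis_def)

lemma psi_closed: "j < m \<Longrightarrow> z \<in> syzygies R xs \<Longrightarrow> \<psi> j z \<in> carrier R"
  using psi_hom[of j] by (auto simp: mod_hom_def syzygy_module_def regular_module_def)

lemma psi_smult: "j < m \<Longrightarrow> z \<in> syzygies R xs \<Longrightarrow> a \<in> carrier R \<Longrightarrow> \<psi> j (\<lambda>i. a \<otimes> z i) = a \<otimes> \<psi> j z"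
  using psi_hom[of j] by (auto simp: mod_hom_def syzygy_module_def regular_module_def free_module_def)

lemma psi_f: "i < m \<Longrightarrow> j < m \<Longrightarrow> \<psi> i (f j) = (if i = j then \<one> else \<zero>)"
  using basis by (simp add: free_basis_def)

lemma syzygy_expansion:
  assumes "z \<in> syzygies R xs"
  shows "z i = (\<Oplus>j\<in>{..<m}. \<psi> j z \<otimes> f j i)"
proof -
  let ?M = "syzygy_module R xs"
  have 1: "z = (\<Oplus>\<^bsub>?M\<^esub>j\<in>{..<m}. \<psi> j z \<odot>\<^bsub>?M\<^esub> f j)"
    using basis assms by (simp add: free_basis_def dual_basis_def syzygy_module_def)
  interpret M: module R ?M by (rule syzygy_module_module[OF xs_closed])
  have 2: "\<psi> j z \<odot>\<^bsub>?M\<^esub> f j \<in> syzygies R xs" if "j \<in> {..<m}" for j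
    using M.smult_closed[of "\<psi> j z" "f j"] that psi_closed[OF _ assms] f_syzygy
    by (simp add: syzygy_module_def)
  have "finsum ?M (\<lambda>j. \<psi> j z \<odot>\<^bsub>?M\<^esub> f j) {..<m} = (\<lambda>i. \<Oplus>j\<in>{..<m}. (\<psi> j z \<odot>\<^bsub>?M\<^esub> f j) i)"
    using syzygy_module_module[OF xs_closed] 2 unfolding syzygy_module_def
    by (intro finsum_free_submodule syzygies_subset) auto
  with 1 have "z i = (\<Oplus>j\<in>{..<m}. (\<psi> j z \<odot>\<^bsub>?M\<^esub> f j) i)" by metis
  then show ?thesis by (simp add: syzygy_module_def free_module_def)
qed

end

context cring
begin

lemma dot_comm:
  assumes "\<And>i. i < n \<Longrightarrow> u i \<in> carrier R" "\<And>i. i < n \<Longrightarrow> v i \<in> carrier R"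
  shows "dot R n u v = dot R n v u"
  unfolding dot_def using assms by (intro finsum_cong') (auto simp: m_comm)

lemma dot_Suc:
  assumes "\<And>i. i < Suc n \<Longrightarrow> u i \<in> carrier R" "\<And>i. i < Suc n \<Longrightarrow> v i \<in> carrier R"
  shows "dot R (Suc n) u v = dot R n u v \<oplus> u n \<otimes> v n"
  unfolding dot_def lessThan_Suc using assms by (subst finsum_insert) (auto simp: a_comm)

lemma dot_cong:
  assumes "\<And>i. i < n \<Longrightarrow> u i = u' i" "\<And>i. i < n \<Longrightarrow> v i = v' i"
    "\<And>i. i < n \<Longrightarrow> u' i \<in> carrier R" "\<And>i. i < n \<Longrightarrow> v' i \<in> carrier R"
  shows "dot R n u v = dot R n u' v'"
  unfolding dot_def using assms by (intro finsum_cong') auto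

end

context free_syzygies
begin

section \<open>The rank of the syzygies and the top of the Koszul complex\<close>

text \<open>The image of \<open>u \<and> v\<close> under the Koszul differential.  For fixed \<open>u\<close>, this is a map \<open>R\<^sup>n \<rightarrow> Z\<close>
whose restriction to the syzygies is multiplication by \<open>d u\<close>.\<close>

definition koszul_relation :: "(nat \<Rightarrow> 'a) \<Rightarrow> (nat \<Rightarrow> 'a) \<Rightarrow> nat \<Rightarrow> 'a" where
  "koszul_relation u v = (\<lambda>i. d u \<otimes> v i \<ominus> d v \<otimes> u i)"

text \<open>Coordinates of the functional \<open>\<psi> j \<circ> koszul_relation u\<close> on \<open>R\<^sup>n\<close>: the extension of
\<open>d u \<cdot> \<psi> j\<close> from the syzygies to all vectors.\<close>

definition coframe :: "(nat \<Rightarrow> 'a) \<Rightarrow> nat \<Rightarrow> nat \<Rightarrow> 'a" where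
  "coframe u j k = \<psi> j (koszul_relation u (\<lambda>i. if i = k then \<one> else \<zero>))"

lemma unit_V: "k < n \<Longrightarrow> (\<lambda>i. if i = k then \<one> else \<zero>) \<in> V"
  by (simp add: free_module_def)

lemma koszul_relation_syzygy:
  assumes "u \<in> V" "v \<in> V"
  shows "koszul_relation u v \<in> syzygies R xs"
proof -
  have "d (koszul_relation u v) = d (\<lambda>i. d u \<otimes> v i) \<ominus> d (\<lambda>i. d v \<otimes> u i)"
    unfolding koszul_relation_def using assms by (intro dot_minus) (auto simp: V_closed)
  also have "\<dots> = d u \<otimes> d v \<ominus> d v \<otimes> d u"
    using assms by (simp add: dot_smult V_closed)
  also have "\<dots> = \<zero>" using assms by (simp add: m_comm minus_eq r_neg)
  finally show ?thesis
    using assms by (auto simp: syzygies_def koszul_relation_def free_module_def minus_eq)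
qed

lemma coframe_closed [simp]:
  "u \<in> V \<Longrightarrow> j < m \<Longrightarrow> k < n \<Longrightarrow> coframe u j k \<in> carrier R"
  unfolding coframe_def by (intro psi_closed koszul_relation_syzygy unit_V)

text \<open>Expand \<open>v\<close> in the standard basis and use linearity of \<open>\<psi> j\<close>.\<close>

lemma dot_coframe:
  assumes u: "u \<in> V" and v: "v \<in> V" and j: "j < m"
  shows "dot R n (coframe u j) v = \<psi> j (koszul_relation u v)"
proof -
  let ?M = "syzygy_module R xs"
  let ?e = "\<lambda>k i. if i = k then \<one> else \<zero>"
  have syz: "koszul_relation u (?e k) \<in> carrier ?M" if "k \<in> {..<n}" for k
    using koszul_relation_syzygy[OF u unit_V] that by (simp add: syzygy_module_def)
  interpret M: module R ?M by (rule syzygy_module_module[OF xs_closed])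
  have "(\<Oplus>\<^bsub>?M\<^esub>k\<in>{..<n}. v k \<odot>\<^bsub>?M\<^esub> koszul_relation u (?e k))
      = (\<lambda>i. \<Oplus>k\<in>{..<n}. (v k \<odot>\<^bsub>?M\<^esub> koszul_relation u (?e k)) i)"
    unfolding syzygy_module_def
  proof (intro finsum_free_submodule syzygies_subset)
    show "module R (free_module R {..<n}\<lparr>carrier := syzygies R xs\<rparr>)"
      using syzygy_module_module[OF xs_closed] by (simp add: syzygy_module_def)
    fix k assume k: "k \<in> {..<n}"
    show "v k \<odot>\<^bsub>free_module R {..<n}\<lparr>carrier := syzygies R xs\<rparr>\<^esub> koszul_relation u (?e k) \<in> syzygies R xs"
      using M.smult_closed[of "v k", OF _ syz[OF k]] V_closed[OF v] by (simp add: syzygy_module_def)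
  qed auto
  also have "\<dots> = koszul_relation u v"
  proof
    fix i
    have "(\<Oplus>k\<in>{..<n}. (v k \<odot>\<^bsub>?M\<^esub> koszul_relation u (?e k)) i)
        = dot R n v (\<lambda>k. d u \<otimes> (if k = i then \<one> else \<zero>) \<ominus> u i \<otimes> xs ! k)"
      unfolding dot_def[of R n v] using u v
      by (intro finsum_cong')
        (auto simp: koszul_relation_def syzygy_module_def free_module_def dot_unit m_comm)
    also have "\<dots> = dot R n v (\<lambda>k. d u \<otimes> (if k = i then \<one> else \<zero>)) \<ominus> dot R n v (\<lambda>k. u i \<otimes> xs ! k)"
      using u v by (intro dot_minus) (auto simp: V_closed)
    also have "dot R n v (\<lambda>k. u i \<otimes> xs ! k) = u i \<otimes> dot R n v ((!) xs)"
      using u v by (intro dot_smult) (auto simp: V_closed)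
    also have "dot R n v ((!) xs) = d v"
      using v by (intro dot_comm) (auto simp: V_closed)
    also have "dot R n v (\<lambda>k. d u \<otimes> (if k = i then \<one> else \<zero>))
        = d u \<otimes> dot R n v (\<lambda>k. if k = i then \<one> else \<zero>)"
      using u v by (intro dot_smult) (auto simp: V_closed)
    also have "dot R n v (\<lambda>k. if k = i then \<one> else \<zero>) = v i"
    proof (cases "i < n")
      case True
      then show ?thesis using v by (intro dot_unit) (auto simp: V_closed)
    next
      case False
      then have "v i = \<zero>" using v by (simp add: free_module_def)
      moreover have "dot R n v (\<lambda>k. if k = i then \<one> else \<zero>) = \<zero>"
        unfolding dot_def[of R n v] using False v by (intro add.finprod_one_eqI) (auto simp: V_closed)
      ultimately show ?thesis by simp
    qed
    finally show "(\<Oplus>k\<in>{..<n}. (v k \<odot>\<^bsub>?M\<^esub> koszul_relation u (?e k)) i) = koszul_relation u v i"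
      using u v by (simp add: koszul_relation_def V_closed m_comm)
  qed
  finally have "\<psi> j (koszul_relation u v) = (\<Oplus>k\<in>{..<n}. v k \<otimes> coframe u j k)"
    using functional_lincomb[OF M.module_axioms psi_hom[OF j], of "{..<n}" v
        "\<lambda>k. koszul_relation u (?e k)"] syz V_closed[OF v]
    by (simp add: coframe_def)
  also have "\<dots> = dot R n (coframe u j) v"
    unfolding dot_def[of R n "coframe u j"] using u v j by (intro finsum_cong') (auto simp: V_closed m_comm)
  finally show ?thesis by simp
qed

lemma psi_zero: "j < m \<Longrightarrow> \<psi> j (\<lambda>i. \<zero>) = \<zero>"
  using mod_hom_zero[OF syzygy_module_module[OF xs_closed] regular_module_module psi_hom]
  by (simp add: syzygy_module_def regular_module_def free_module_def)

lemma dot_coframe_syzygy: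
  assumes "u \<in> V" "z \<in> syzygies R xs" "j < m"
  shows "dot R n (coframe u j) z = d u \<otimes> \<psi> j z"
proof -
  have z: "z \<in> V" "d z = \<zero>" using assms(2) by (auto simp: syzygies_def)
  have "koszul_relation u z = (\<lambda>i. d u \<otimes> z i)"
    using z assms(1) by (simp add: koszul_relation_def V_closed minus_eq)
  then show ?thesis using dot_coframe[OF assms(1) z(1) assms(3)] psi_smult assms by simp
qed

lemma dot_coframe_self:
  assumes "u \<in> V" "j < m"
  shows "dot R n (coframe u j) u = \<zero>"
proof -
  have "koszul_relation u u = (\<lambda>i. \<zero>)"
    using assms(1) by (simp add: koszul_relation_def V_closed minus_eq r_neg)
  then show ?thesis using dot_coframe[OF assms(1) assms(1) assms(2)] psi_zero assms by simp
qed

lemma dot_coframe_f: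
  assumes "u \<in> V" "i < m" "j < m"
  shows "dot R n (coframe u i) (f j) = (if i = j then d u else \<zero>)"
  using dot_coframe_syzygy[OF assms(1) f_syzygy assms(2)] assms by (simp add: psi_f)

text \<open>Adding \<open>g\<close> to the basis of the syzygies, and \<open>d\<close> to the coordinate functionals, gives a
pair of matrices with both products equal to \<open>d g\<close> times an identity matrix.  Since \<open>d g\<close> is a
nonzerodivisor, \<open>biorthogonal_le\<close> applies to the columns and to the rows.\<close>

lemma rank_syzygies: "n = Suc m"
proof (rule antisym)
  \<comment> \<open>Index \<open>m\<close> stands for the additional vector \<open>g\<close> and the functional \<open>d\<close>.\<close>
  define F where "F = (\<lambda>j. if j < m then f j else g)"
  define L where "L = (\<lambda>j. if j < m then coframe g j else (!) xs)"
  have F: "F j k \<in> carrier R" if "j < Suc m" for j k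
    using that g by (auto simp: F_def V_closed)
  have L: "L j k \<in> carrier R" if "j < Suc m" "k < n" for j k
    using that g by (auto simp: L_def)
  show "Suc m \<le> n"
  proof (rule biorthogonal_le[of "d g"])
    fix j k assume "j < Suc m" "k < Suc m"
    then show "dot R n (L j) (F k) = (if j = k then d g else \<zero>)"
      using g by (auto simp: L_def F_def dot_coframe_f dot_coframe_self d_f)
  qed (use g regular1 nontrivial F L in auto)
  \<comment> \<open>The roles of rows and columns are exchanged: the \<open>n\<close> vectors and functionals
    now live in \<open>R\<^sup>m\<^sup>+\<^sup>1\<close>, and the pairing is the expansion of the Koszul relations in the basis.\<close>
  show "n \<le> Suc m"
  proof (rule biorthogonal_le[of "d g"])
    fix j k assume jk: "j < n" "k < n"
    let ?e = "\<lambda>i. if i = k then \<one> else \<zero>"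
    have "koszul_relation g ?e j = (\<Oplus>i\<in>{..<m}. \<psi> i (koszul_relation g ?e) \<otimes> f i j)"
      by (intro syzygy_expansion koszul_relation_syzygy g unit_V jk)
    also have "\<dots> = dot R m (\<lambda>i. F i j) (\<lambda>i. L i k)"
      unfolding dot_def[of R m] F_def L_def coframe_def using jk g
      by (intro finsum_cong') (auto simp: m_comm psi_closed koszul_relation_syzygy unit_V)
    finally have *: "dot R m (\<lambda>i. F i j) (\<lambda>i. L i k) = d g \<otimes> ?e j \<ominus> xs ! k \<otimes> g j"
      using jk by (simp add: koszul_relation_def dot_unit)
    have "dot R (Suc m) (\<lambda>i. F i j) (\<lambda>i. L i k) = (d g \<otimes> ?e j \<ominus> xs ! k \<otimes> g j) \<oplus> g j \<otimes> xs ! k"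
      using jk F L by (subst dot_Suc) (auto simp: *, auto simp: F_def L_def)
    then show "dot R (Suc m) (\<lambda>i. F i j) (\<lambda>i. L i k) = (if j = k then d g else \<zero>)"
      using jk g by (auto simp: minus_eq a_assoc l_neg m_comm V_closed)
  qed (use g regular1 nontrivial F L in auto)
qed

definition top_form :: "nat set \<Rightarrow> 'a" where
  "top_form = (\<lambda>T. if T = {..<n} then \<one> else \<zero>)"

text \<open>The generator of the cycles in degree \<open>n - 1\<close>; its coefficients are the \<open>x\<^sub>i\<close> up to sign.\<close>

definition top_boundary :: "nat set \<Rightarrow> 'a" where
  "top_boundary = contract R n ((!) xs) top_form"

lemma top_form_closed [simp]: "top_form T \<in> carrier R"
  by (simp add: top_form_def)

lemma top_boundary_closed [simp]: "top_boundary T \<in> carrier R"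
  by (simp add: top_boundary_def)

lemma top_degree_eq:
  assumes "w \<in> carrier (ext_power R n n)"
  shows "w = (\<lambda>T. w {..<n} \<otimes> top_form T)"
proof
  fix T
  show "w T = w {..<n} \<otimes> top_form T"
  proof (cases "T = {..<n}")
    case False
    then have "\<not> (T \<subseteq> {..<n} \<and> card T = n)"
      using card_subset_eq[of "{..<n}" T] by auto
    then show ?thesis using False assms by (auto simp: top_form_def ext_power_def)
  qed (use assms in \<open>auto simp: top_form_def ext_power_def\<close>)
qed

text \<open>Wedging with \<open>g\<close> sends it to \<open>d g\<close> times the top form.\<close>

lemma top_boundary_faithful:
  assumes "a \<in> carrier R" "\<And>T. a \<otimes> top_boundary T = \<zero>"
  shows "a = \<zero>"
proof -
  let ?T = "{..<n}"
  have "top_form \<in> carrier (ext_power R n n)" by (auto simp: top_form_def ext_power_def)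
  then have top: "wedge R n g top_form T = \<zero>" for T
    using g by (intro ext_power_trivial[OF wedge_in_ext_power]) (auto simp: V_closed)
  have "contract R n ((!) xs) (wedge R n g top_form) ?T = \<zero>"
    unfolding contract_def contract_at_def by (intro add.finprod_one_eqI) (auto simp: top)
  then have "wedge R n g top_boundary ?T = d g"
    using contract_wedge[of top_form n "(!) xs" g ?T] g V_closed[OF g]
    by (simp add: top_boundary_def top_form_def)
  moreover have "wedge R n g (\<lambda>T. a \<otimes> top_boundary T) ?T = a \<otimes> wedge R n g top_boundary ?T"
    using assms(1) V_closed[OF g] by (intro wedge_smult) auto
  moreover have "wedge R n g (\<lambda>T. a \<otimes> top_boundary T) ?T = \<zero>"
    using assms V_closed[OF g] by (intro wedge_eq_zero) auto
  ultimately have "d g \<otimes> a = \<zero>" using assms(1) g by (simp add: m_comm)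
  then show ?thesis using regular1 assms(1) by blast
qed

lemma top_boundary_cancel:
  assumes "a \<in> carrier R" "b \<in> carrier R" "\<And>T. a \<otimes> top_boundary T = b \<otimes> top_boundary T"
  shows "a = b"
proof -
  have "(a \<ominus> b) \<otimes> top_boundary T = \<zero>" for T
    using assms(1,2) by (simp add: minus_eq l_distr l_minus r_neg assms(3)[of T])
  then have "a \<ominus> b = \<zero>" using assms(1,2) by - (rule top_boundary_faithful, auto)
  then show ?thesis using assms(1,2) by simp
qed

text \<open>The homotopy \<open>\<partial> (v \<and> w) + v \<and> \<partial> w = d v \<cdot> w\<close> for a cycle \<open>w\<close>; as \<open>v \<and> w\<close> has top degree, it
is a multiple of the top form.\<close>

lemma cycle_wedge_vector:
  assumes w: "w \<in> carrier (ext_power R n m)" and cyc: "\<And>T. contract R n ((!) xs) w T = \<zero>"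
    and v: "v \<in> V"
  shows "d v \<otimes> w T = wedge R n v w {..<n} \<otimes> top_boundary T"
proof -
  have wc: "w T \<in> carrier R" for T using w by (auto simp: ext_power_def)
  have "wedge R n v w \<in> carrier (ext_power R n n)"
    using wedge_in_ext_power[OF w, of v] v V_closed rank_syzygies by auto
  then have *: "wedge R n v w = (\<lambda>T. wedge R n v w {..<n} \<otimes> top_form T)"
    by (rule top_degree_eq)
  have "contract R n ((!) xs) (wedge R n v w) T = wedge R n v w {..<n} \<otimes> top_boundary T"
    unfolding top_boundary_def
    by (subst *) (use wc V_closed[OF v] in \<open>auto intro!: contract_smult\<close>)
  moreover have "wedge R n v (contract R n ((!) xs) w) T = \<zero>"
    using cyc V_closed[OF v] by (intro wedge_eq_zero) auto
  moreover have "wedge R n v w {..<n} \<in> carrier R"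
    using wc V_closed[OF v] by auto
  ultimately show ?thesis
    using contract_wedge[of w n "(!) xs" v T] wc V_closed[OF v] by simp
qed

text \<open>By the preceding lemma \<open>d g \<cdot> w\<close> and \<open>d h \<cdot> w\<close> are both multiples of the top boundary.
Comparing \<open>d h \<cdot> (d g \<cdot> w)\<close> with \<open>d g \<cdot> (d h \<cdot> w)\<close> shows that \<open>d g\<close> divides the first multiplier,
since \<open>d g, d h\<close> is a regular sequence; then \<open>d g\<close> can be cancelled.  The vanishing of
\<open>Ext\<^sup>1 (R/I, R)\<close> enters here.\<close>

lemma cycle_multiple_top_boundary:
  assumes w: "w \<in> carrier (ext_power R n m)" and cyc: "\<And>T. contract R n ((!) xs) w T = \<zero>"
  shows "\<exists>c\<in>carrier R. \<forall>T. w T = c \<otimes> top_boundary T"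
proof -
  have wc: "w T \<in> carrier R" for T using w by (auto simp: ext_power_def)
  let ?c = "\<lambda>v. wedge R n v w {..<n}"
  have c: "?c v \<in> carrier R" if "v \<in> V" for v using that wc by (auto simp: V_closed)
  have "(d h \<otimes> ?c g) \<otimes> top_boundary T = (d g \<otimes> ?c h) \<otimes> top_boundary T" for T
  proof -
    have "(d h \<otimes> ?c g) \<otimes> top_boundary T = d h \<otimes> (d g \<otimes> w T)"
      using cycle_wedge_vector[OF w cyc g] c[OF g] h g by (simp add: m_assoc)
    also have "\<dots> = d g \<otimes> (d h \<otimes> w T)" using h g wc by (intro m_lcomm) auto
    also have "\<dots> = (d g \<otimes> ?c h) \<otimes> top_boundary T"
      using cycle_wedge_vector[OF w cyc h] c[OF h] h g by (simp add: m_assoc)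
    finally show ?thesis .
  qed
  then have "d h \<otimes> ?c g = d g \<otimes> ?c h" using c g h by - (rule top_boundary_cancel, auto)
  then obtain a where a: "a \<in> carrier R" "?c g = d g \<otimes> a"
    using regular2[of "?c g" "?c h"] c g h by blast
  have "w T = a \<otimes> top_boundary T" for T
  proof (rule regular_cancel)
    show "d g \<otimes> w T = d g \<otimes> (a \<otimes> top_boundary T)"
      using cycle_wedge_vector[OF w cyc g, of T] a g by (simp add: m_assoc)
  qed (use wc a in auto)
  then show ?thesis using a by auto
qed

end

context cring
begin

section \<open>Killing a Koszul homology module\<close>

lemma dot_lincomb:
  assumes u: "\<And>i. i < n \<Longrightarrow> u i \<in> carrier R" and "finite J"
    and a: "\<And>j. j \<in> J \<Longrightarrow> a j \<in> carrier R" and f: "\<And>j i. j \<in> J \<Longrightarrow> i < n \<Longrightarrow> f j i \<in> carrier R"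
  shows "dot R n u (\<lambda>i. \<Oplus>j\<in>J. a j \<otimes> f j i) = (\<Oplus>j\<in>J. a j \<otimes> dot R n u (f j))"
proof -
  have "dot R n u (\<lambda>i. \<Oplus>j\<in>J. a j \<otimes> f j i) = (\<Oplus>i\<in>{..<n}. \<Oplus>j\<in>J. u i \<otimes> (a j \<otimes> f j i))"
    unfolding dot_def using assms
    by (intro finsum_cong') (auto simp: finsum_rdistr Pi_def intro!: finsum_closed)
  also have "\<dots> = (\<Oplus>j\<in>J. \<Oplus>i\<in>{..<n}. u i \<otimes> (a j \<otimes> f j i))"
    using assms by (intro finsum_swap) auto
  also have "\<dots> = (\<Oplus>j\<in>J. a j \<otimes> dot R n u (f j))"
    unfolding dot_def using assms
    by (intro finsum_cong') (auto simp: finsum_rdistr Pi_def m_lcomm intro!: finsum_cong' finsum_closed)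
  finally show ?thesis .
qed

lemma nat_pow_Suc_mult:
  assumes "a \<in> carrier R" "b \<in> carrier R"
  shows "a [^] Suc l \<otimes> b = a \<otimes> (a [^] l \<otimes> b)"
  unfolding nat_pow_Suc2[OF assms(1)] by (rule m_assoc) (use assms in auto)

lemma minus_exchange:
  assumes "a \<ominus> b = c \<ominus> e"
    and "a \<in> carrier R" "b \<in> carrier R" "c \<in> carrier R" "e \<in> carrier R"
  shows "a \<ominus> c = b \<ominus> e"
proof -
  have "a \<ominus> c = (a \<ominus> b) \<oplus> (b \<ominus> c)"
    using assms(2-) by (simp add: minus_eq a_assoc) (simp add: a_assoc[symmetric] l_neg)
  also have "\<dots> = (c \<ominus> e) \<oplus> (b \<ominus> c)" using assms(1) by simp
  also have "\<dots> = b \<ominus> e"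
    using assms(2-) by (simp add: minus_eq a_ac r_neg r_neg1 r_neg2)
  finally show ?thesis .
qed

lemma neg_eq_if_add_zero:
  assumes "a \<in> carrier R" "b \<in> carrier R" "a \<oplus> b = \<zero>"
  shows "b = \<ominus> a"
  using assms by (metis add.inv_comm add.inv_equality)

end

context free_syzygies
begin

lemma regular2_power:
  assumes "a \<in> carrier R" "b \<in> carrier R" "d h \<otimes> a = d g [^] (l::nat) \<otimes> b"
  shows "\<exists>c\<in>carrier R. a = d g [^] l \<otimes> c"
  using assms
proof (induction l arbitrary: a b)
  case (Suc l)
  have "d h \<otimes> a = d g \<otimes> (d g [^] l \<otimes> b)"
    unfolding Suc.prems(3) using Suc.prems(2) g by (intro nat_pow_Suc_mult d_closed)
  then obtain a' where a': "a' \<in> carrier R" "a = d g \<otimes> a'"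
    using regular2[of a "d g [^] l \<otimes> b"] Suc.prems g by auto
  have "d g \<otimes> (d h \<otimes> a') = d g \<otimes> (d g [^] l \<otimes> b)"
    using \<open>d h \<otimes> a = d g \<otimes> (d g [^] l \<otimes> b)\<close> m_lcomm[of "d h" "d g" a'] a' g h by simp
  then have "d h \<otimes> a' = d g [^] l \<otimes> b"
    by (rule regular_cancel[rotated 2]) (use a'(1) Suc.prems(2) g h in simp_all)
  then obtain c where c: "c \<in> carrier R" "a' = d g [^] l \<otimes> c"
    using Suc.IH a' Suc.prems by blast
  then have "a = d g [^] Suc l \<otimes> c" unfolding a'(2) c(2)
    using c(1) g by (intro nat_pow_Suc_mult[symmetric] d_closed)
  then show ?case using c by blast
qed (use h in auto)

lemma regular2_powers:
  assumes "a \<in> carrier R" "b \<in> carrier R" "d h [^] (k::nat) \<otimes> a = d g [^] (l::nat) \<otimes> b"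
  shows "\<exists>c\<in>carrier R. a = d g [^] l \<otimes> c"
  using assms
proof (induction k arbitrary: a)
  case 0
  then show ?case by auto
next
  case (Suc k)
  then have "d h [^] k \<otimes> (d h \<otimes> a) = d g [^] l \<otimes> b" using h by (simp add: m_assoc)
  then obtain c where "c \<in> carrier R" "d h \<otimes> a = d g [^] l \<otimes> c"
    using Suc.IH[of "d h \<otimes> a"] Suc.prems h by auto
  then show ?case using regular2_power Suc.prems by blast
qed

lemma regular_power_cancel:
  assumes "a \<in> carrier R" "d g [^] (l::nat) \<otimes> a = \<zero>"
  shows "a = \<zero>"
  using assms
proof (induction l)
  case (Suc l)
  then have "d g \<otimes> (d g [^] l \<otimes> a) = \<zero>" using g by (simp only: nat_pow_Suc_mult d_closed)
  then have "d g [^] l \<otimes> a = \<zero>" using Suc.prems(1) g by - (rule regular1, auto)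
  then show ?case using Suc.IH Suc.prems(1) by blast
qed (simp)

text \<open>Powers of \<open>d g\<close> and \<open>d h\<close> form a regular sequence again, and two consecutive elements of a
regular sequence only have units as common divisors.\<close>

lemma common_divisor_of_powers_unit:
  assumes u: "u \<in> carrier R" and a: "a \<in> carrier R" "d g [^] (l::nat) = u \<otimes> a"
    and b: "b \<in> carrier R" "d h [^] (l::nat) = u \<otimes> b"
  shows "\<exists>v\<in>carrier R. u \<otimes> v = \<one>"
proof -
  have "d h [^] l \<otimes> a = d g [^] l \<otimes> b"
    unfolding a(2) b(2) using u a(1) b(1) by (simp add: m_assoc m_comm[of b a])
  then obtain c where c: "c \<in> carrier R" "a = d g [^] l \<otimes> c"
    using regular2_powers a(1) b(1) by blast
  have "d g [^] l \<otimes> (u \<otimes> c \<ominus> \<one>) = u \<otimes> (d g [^] l \<otimes> c) \<ominus> d g [^] l"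
    using u c(1) g by (simp add: minus_eq r_distr r_minus m_lcomm[of "d g [^] l" u c])
  also have "u \<otimes> (d g [^] l \<otimes> c) = d g [^] l"
    by (simp only: c(2)[symmetric] a(2)[symmetric])
  also have "d g [^] l \<ominus> d g [^] l = \<zero>" using g by (simp add: minus_eq r_neg)
  finally have "u \<otimes> c \<ominus> \<one> = \<zero>" using regular_power_cancel[of "u \<otimes> c \<ominus> \<one>" l] u c(1) by simp
  then show ?thesis using u c(1) by (intro bexI[of _ c]) auto
qed

lemma wedge_list_f_cycle:
  assumes "set ks \<subseteq> {..<m}"
  shows "contract R n ((!) xs) (wedge_list R n f ks) T = \<zero>"
  using assms d_f by (intro contract_wedge_list_orthogonal) auto

lemma wedge_list_f_multiple:
  assumes "set ks \<subseteq> {..<m}" "length ks = m"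
  shows "\<exists>c\<in>carrier R. \<forall>T. wedge_list R n f ks T = c \<otimes> top_boundary T"
proof (rule cycle_multiple_top_boundary)
  have "wedge_list R n f ks \<in> carrier (ext_power R n (length ks))"
    using assms(1) by (intro wedge_list_in_ext_power) auto
  then show "wedge_list R n f ks \<in> carrier (ext_power R n m)" using assms(2) by simp
qed (rule wedge_list_f_cycle[OF assms(1)])

lemma wedge_list_f_closed: "set ks \<subseteq> {..<m} \<Longrightarrow> wedge_list R n f ks T \<in> carrier R"
  by (intro wedge_list_closed) auto

lemma wedge_list_f_divides:
  assumes "u \<in> V" "set ks \<subseteq> {..<m}" "distinct ks"
    and "a \<in> carrier R" "c \<in> carrier R" "\<And>T. w T \<in> carrier R"
    and "\<And>T. a \<otimes> wedge_list R n f ks T = c \<otimes> w T"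
  shows "\<exists>q\<in>carrier R. a \<otimes> d u [^] length ks = c \<otimes> q"
proof (rule wedge_list_divides[where l = "coframe u" and f = f and n = n and w = w])
  show "dot R n (coframe u j) (f k) = (if j = k then d u else \<zero>)" if "j \<in> set ks" "k \<in> set ks" for j k
    using assms(1,2) that by (intro dot_coframe_f) auto
qed (use assms in auto)

lemma wedge_list_f_faithful:
  assumes "set ks \<subseteq> {..<m}" "distinct ks" "a \<in> carrier R"
    and "\<And>T. a \<otimes> wedge_list R n f ks T = \<zero>"
  shows "a = \<zero>"
proof -
  have "\<exists>q\<in>carrier R. a \<otimes> d g [^] length ks = \<zero> \<otimes> q"
    using assms g by (intro wedge_list_f_divides[where w = "\<lambda>_. \<zero>"]) auto
  then have "d g [^] length ks \<otimes> a = \<zero>" using assms(3) g by (auto simp: m_comm)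
  then show ?thesis using regular_power_cancel assms(3) by blast
qed

text \<open>By \<open>wedge_list_divides\<close>, applied with the coframes of \<open>g\<close> and of \<open>h\<close>, the factor \<open>c\<close>
divides powers of \<open>d g\<close> and of \<open>d h\<close>.  This is the part of the Hilbert--Burch theorem saying that
the maximal minors of the matrix of syzygies generate \<open>I\<close> itself and not a proper multiple of it.\<close>

lemma wedge_list_f_unit:
  assumes "set ks \<subseteq> {..<m}" "distinct ks" "length ks = m"
    and "c \<in> carrier R" "\<And>T. wedge_list R n f ks T = c \<otimes> top_boundary T"
  shows "\<exists>v\<in>carrier R. c \<otimes> v = \<one>"
proof -
  have "\<exists>q\<in>carrier R. \<one> \<otimes> d u [^] length ks = c \<otimes> q" if "u \<in> V" for u
    using assms(1-4) that wedge_list_f_closed[OF assms(1)]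
    by (intro wedge_list_f_divides[where w = top_boundary]) (auto simp: assms(5))
  from this[OF g] this[OF h] g h show ?thesis
    using common_divisor_of_powers_unit[OF assms(4)] g h assms(3) by auto
qed

text \<open>A product without the factor \<open>f j\<close> that is a multiple of the top boundary vanishes:
contraction with the \<open>j\<close>-th coframe kills the product, hence kills \<open>c\<close> times the top boundary,
whereas on the product of all basis elements it gives \<open>d g\<close> times the faithful product over \<open>L\<close>.\<close>

lemma wedge_list_f_zero:
  assumes ks: "set ks \<subseteq> {..<m}" and j: "j < m" "j \<notin> set ks"
    and L: "set L = {..<m} - {j}" "distinct L"
    and c: "c \<in> carrier R" "\<And>T. wedge_list R n f ks T = c \<otimes> top_boundary T"
  shows "c = \<zero>"
proof -
  let ?i = "contract R n (coframe g j)"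
  have len: "length (j # L) = m"
    using L j distinct_card[OF L(2)] by simp
  have jL: "set (j # L) \<subseteq> {..<m}" "distinct (j # L)" using L j by auto
  obtain u where u: "u \<in> carrier R" "\<And>T. wedge_list R n f (j # L) T = u \<otimes> top_boundary T"
    using wedge_list_f_multiple[OF jL(1) len] by blast
  have "c \<otimes> d g \<otimes> wedge_list R n f L T = \<zero>" for T
  proof -
    have "?i (wedge_list R n f ks) T = \<zero>"
      using ks j g by (intro contract_wedge_list_orthogonal) (auto simp: dot_coframe_f)
    moreover have "wedge_list R n f ks = (\<lambda>T. c \<otimes> top_boundary T)" using c(2) by (rule ext)
    moreover have "?i (\<lambda>T. c \<otimes> top_boundary T) T = c \<otimes> ?i top_boundary T"
      using c(1) g j by (intro contract_smult) auto
    ultimately have *: "c \<otimes> ?i top_boundary T = \<zero>" by metis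
    have "d g \<otimes> wedge_list R n f L T = ?i (wedge_list R n f (j # L)) T"
    proof (subst contract_wedge_list_Cons)
      show "dot R n (coframe g j) (f k) = \<zero>" if "k \<in> set L" for k
        using that L(1) j g by (simp add: dot_coframe_f)
      show "f k i \<in> carrier R" if "k \<in> set (j # L)" "i < n" for k i
        using that jL(1) by (intro f_closed) auto
      show "coframe g j i \<in> carrier R" if "i < n" for i
        using that g j by simp
      show "d g \<otimes> wedge_list R n f L T = dot R n (coframe g j) (f j) \<otimes> wedge_list R n f L T"
        using g j by (simp add: dot_coframe_f)
    qed
    also have "wedge_list R n f (j # L) = (\<lambda>T. u \<otimes> top_boundary T)" using u(2) by (rule ext)
    also have "?i (\<lambda>T. u \<otimes> top_boundary T) T = u \<otimes> ?i top_boundary T"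
      using u(1) g j by (intro contract_smult) auto
    finally have "c \<otimes> (d g \<otimes> wedge_list R n f L T) = c \<otimes> (u \<otimes> ?i top_boundary T)" by simp
    also have "\<dots> = u \<otimes> (c \<otimes> ?i top_boundary T)"
      using c(1) u(1) g j by (intro m_lcomm) auto
    also have "\<dots> = \<zero>" using * u(1) by simp
    finally show ?thesis using c(1) g wedge_list_f_closed[of L T] L by (subst m_assoc) auto
  qed
  then have "c \<otimes> d g = \<zero>"
    by (rule wedge_list_f_faithful[rotated 3]) (use L c(1) g in auto)
  then have "d g \<otimes> c = \<zero>" using m_comm[of c "d g"] c(1) g by simp
  then show ?thesis by (rule regular1[OF c(1)])
qed

text \<open>Wedging with a syzygy anticommutes with the differential, so it preserves boundaries;
starting from lists of length \<open>p\<close>, whose products are cycles, one can prepend any further basis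
elements.\<close>

lemma wedge_list_f_boundary:
  assumes r: "r \<in> carrier R"
    and kill: "\<And>w. w \<in> koszul_cycles R xs p \<Longrightarrow> (\<lambda>T. r \<otimes> w T) \<in> koszul_boundaries R xs p"
    and "set ks \<subseteq> {..<m}" "p \<le> length ks"
  shows "\<exists>b\<in>carrier (ext_power R n (Suc (length ks))).
    \<forall>T. r \<otimes> wedge_list R n f ks T = contract R n ((!) xs) b T"
  using assms(3,4)
proof (induction "length ks - p" arbitrary: ks)
  case 0
  then have p: "p = length ks" by simp
  have "wedge_list R n f ks \<in> carrier (ext_power R n p)"
    unfolding p using 0 by (intro wedge_list_in_ext_power) auto
  moreover have "koszul_diff R xs (wedge_list R n f ks) = (\<lambda>T. \<zero>)"
    using koszul_diff_eq_contract[OF xs_closed wedge_list_f_closed] wedge_list_f_cycle 0 by auto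
  ultimately have "wedge_list R n f ks \<in> koszul_cycles R xs p"
    by (simp add: koszul_cycles_def)
  then obtain b where b: "b \<in> carrier (ext_power R n (Suc p))"
    "(\<lambda>T. r \<otimes> wedge_list R n f ks T) = koszul_diff R xs b"
    using kill unfolding koszul_boundaries_def by blast
  have "koszul_diff R xs b = contract R n ((!) xs) b"
    using b(1) by (intro koszul_diff_eq_contract[OF xs_closed]) (auto simp: ext_power_def)
  then show ?case using b p by (metis (no_types, lifting))
next
  case (Suc l)
  then obtain k ks' where ks: "ks = k # ks'" by (cases ks) auto
  have k: "k < m" using Suc.prems ks by auto
  obtain b where b: "b \<in> carrier (ext_power R n (length ks))"
    "\<And>T. r \<otimes> wedge_list R n f ks' T = contract R n ((!) xs) b T"
  proof -
    have "l = length ks' - p" "p \<le> length ks'" using Suc.hyps(2) ks by auto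
    then show thesis using Suc.hyps(1)[of ks'] Suc.prems(1) ks that by auto
  qed
  have bc: "b T \<in> carrier R" for T using b(1) by (auto simp: ext_power_def)
  let ?b = "\<lambda>T. \<ominus> \<one> \<otimes> wedge R n (f k) b T"
  have wb: "wedge R n (f k) b \<in> carrier (ext_power R n (Suc (length ks)))"
    using b(1) k by (intro wedge_in_ext_power) auto
  then have "?b \<in> carrier (ext_power R n (Suc (length ks)))"
    by (auto simp: ext_power_def)
  moreover have "r \<otimes> wedge_list R n f ks T = contract R n ((!) xs) ?b T" for T
  proof -
    have "r \<otimes> wedge_list R n f ks T = wedge R n (f k) (\<lambda>T. r \<otimes> wedge_list R n f ks' T) T"
      unfolding ks wedge_list_Cons using Suc.prems ks k r wedge_list_f_closed
      by (intro wedge_smult[symmetric]) auto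
    also have "\<dots> = wedge R n (f k) (contract R n ((!) xs) b) T"
      using b(2) by simp
    also have "\<dots> = \<ominus> contract R n ((!) xs) (wedge R n (f k) b) T"
      using contract_wedge[of b n "(!) xs" "f k" T] bc k d_f[OF k]
      by (intro neg_eq_if_add_zero) auto
    also have "\<dots> = contract R n ((!) xs) ?b T"
      using bc k by (subst contract_smult) (auto simp: l_minus)
    finally show ?thesis .
  qed
  ultimately show ?case by blast
qed

text \<open>Let \<open>b\<close> be a chain with boundary \<open>r\<close> times the product of the basis elements other than
\<open>f j\<close>.  The functional sends \<open>v\<close> to the top coefficient of \<open>v \<and> b\<close>.  Evaluating it at \<open>f k\<close> and
taking boundaries reproduces, up to sign, \<open>r\<close> times the product of \<open>f k\<close> with these elements, and
that product is zero for \<open>k \<noteq> j\<close> and an invertible multiple of the top boundary for \<open>k = j\<close>.\<close>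

lemma killed_functional:
  assumes r: "r \<in> carrier R"
    and kill: "\<And>w. w \<in> koszul_cycles R xs p \<Longrightarrow> (\<lambda>T. r \<otimes> w T) \<in> koszul_boundaries R xs p"
    and p: "p < m" and j: "j < m"
  shows "\<exists>\<rho>. (\<forall>i. \<rho> i \<in> carrier R) \<and> (\<forall>k<m. dot R n \<rho> (f k) = (if k = j then r else \<zero>))"
proof -
  define L where "L = filter (\<lambda>k. k \<noteq> j) [0..<m]"
  have L: "set L = {..<m} - {j}" "distinct L" by (auto simp: L_def)
  have len: "Suc (length L) = m" using L j distinct_card[OF L(2)] by simp
  obtain b where b: "b \<in> carrier (ext_power R n m)"
    "\<And>T. r \<otimes> wedge_list R n f L T = contract R n ((!) xs) b T"
    using wedge_list_f_boundary[OF r kill, of L] L p len by auto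
  have bc: "b T \<in> carrier R" for T using b(1) by (auto simp: ext_power_def)
  let ?\<beta> = "\<lambda>i. wedge_at R i b {..<n}"
  \<comment> \<open>Both sides, multiplied by the top boundary, are the boundary of
    \<open>\<ominus> (f k \<and> b)\<close>.\<close>
  have \<beta>: "r \<otimes> c = \<ominus> dot R n ?\<beta> (f k)"
    if k: "k < m" and c: "c \<in> carrier R" "\<And>T. wedge_list R n f (k # L) T = c \<otimes> top_boundary T" for k c
  proof (rule top_boundary_cancel)
    fix T
    have wb: "wedge R n (f k) b \<in> carrier (ext_power R n n)"
      using wedge_in_ext_power[OF b(1), of "f k"] k rank_syzygies by auto
    have eq: "wedge R n (f k) b {..<n} = dot R n ?\<beta> (f k)"
      unfolding wedge_def dot_def using bc k by (intro finsum_cong') (auto simp: m_comm)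
    have "r \<otimes> c \<otimes> top_boundary T = r \<otimes> wedge_list R n f (k # L) T"
      using r c by (simp add: m_assoc)
    also have "\<dots> = wedge R n (f k) (\<lambda>T. r \<otimes> wedge_list R n f L T) T"
      unfolding wedge_list_Cons using L k r by (intro wedge_smult[symmetric] wedge_list_closed) auto
    also have "\<dots> = wedge R n (f k) (contract R n ((!) xs) b) T"
      using b(2) by simp
    also have "\<dots> = \<ominus> contract R n ((!) xs) (wedge R n (f k) b) T"
      using contract_wedge[of b n "(!) xs" "f k" T] bc k d_f[OF k]
      by (intro neg_eq_if_add_zero) auto
    also have "contract R n ((!) xs) (wedge R n (f k) b) T = dot R n ?\<beta> (f k) \<otimes> top_boundary T"
      unfolding top_boundary_def
      by (subst top_degree_eq[OF wb], unfold eq) (use bc k in \<open>auto intro!: contract_smult\<close>)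
    finally show "r \<otimes> c \<otimes> top_boundary T = \<ominus> dot R n ?\<beta> (f k) \<otimes> top_boundary T"
      using bc k by (simp add: l_minus)
  qed (use r c bc k in auto)
  have jL: "set (j # L) \<subseteq> {..<m}" "distinct (j # L)" "length (j # L) = m" using L j len by auto
  obtain u where u: "u \<in> carrier R" "\<And>T. wedge_list R n f (j # L) T = u \<otimes> top_boundary T"
    using wedge_list_f_multiple[OF jL(1,3)] by blast
  obtain v where v: "v \<in> carrier R" "u \<otimes> v = \<one>"
    using wedge_list_f_unit[OF jL u] by blast
  let ?\<rho> = "\<lambda>i. \<ominus> v \<otimes> ?\<beta> i"
  have \<rho>: "dot R n ?\<rho> (f k) = \<ominus> v \<otimes> dot R n ?\<beta> (f k)" if "k < m" for k
  proof -
    have "dot R n ?\<rho> (f k) = dot R n (f k) ?\<rho>" using bc v that by (intro dot_comm) auto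
    also have "\<dots> = \<ominus> v \<otimes> dot R n (f k) ?\<beta>" using bc v that by (intro dot_smult) auto
    also have "dot R n (f k) ?\<beta> = dot R n ?\<beta> (f k)" using bc that by (intro dot_comm) auto
    finally show ?thesis .
  qed
  have "dot R n ?\<rho> (f k) = (if k = j then r else \<zero>)" if k: "k < m" for k
  proof (cases "k = j")
    case True
    have "\<ominus> v \<otimes> dot R n ?\<beta> (f j) = v \<otimes> (r \<otimes> u)"
      using \<beta>[OF j u] v bc j by (simp add: l_minus r_minus)
    also have "\<dots> = r \<otimes> (u \<otimes> v)" using r u(1) v(1) by (simp add: m_ac)
    finally show ?thesis using True \<rho>[OF k] v r by simp
  next
    case False
    have kL: "set (k # L) \<subseteq> {..<m}" "length (k # L) = m" using L k len by auto
    obtain c where c: "c \<in> carrier R" "\<And>T. wedge_list R n f (k # L) T = c \<otimes> top_boundary T"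
      using wedge_list_f_multiple[OF kL] by blast
    have "c = \<zero>" using L j False by (intro wedge_list_f_zero[OF kL(1) j _ L c]) auto
    then have "\<ominus> dot R n ?\<beta> (f k) = \<zero>" using \<beta>[OF k c] r by simp
    moreover have "dot R n ?\<beta> (f k) \<in> carrier R" using bc k by auto
    ultimately have "dot R n ?\<beta> (f k) = \<zero>" by (metis minus_minus minus_zero)
    then show ?thesis using False \<rho>[OF k] v by simp
  qed
  then show ?thesis using bc v by (intro exI[of _ ?\<rho>]) auto
qed

text \<open>The functionals of \<open>killed_functional\<close> assemble to a map \<open>P\<close> from \<open>R\<^sup>n\<close> into the syzygies
that is multiplication by \<open>r\<close> on the syzygies.  So \<open>v \<mapsto> r v - P v\<close> vanishes on syzygies and
factors through \<open>d\<close>; because of the regular sequence it has the form \<open>v \<mapsto> d v \<cdot> c\<close>.  Only its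
value at \<open>g\<close> is computed.\<close>

lemma annihilator_homology_in_ideal:
  assumes r: "r \<in> carrier R"
    and kill: "\<And>w. w \<in> koszul_cycles R xs p \<Longrightarrow> (\<lambda>T. r \<otimes> w T) \<in> koszul_boundaries R xs p"
    and p: "p < m"
  shows "\<exists>c\<in>V. r = d c"
proof -
  have "\<exists>\<rho>. (\<forall>i. \<rho> i \<in> carrier R) \<and> (\<forall>k<m. dot R n \<rho> (f k) = (if k = j then r else \<zero>))" if "j < m" for j
    using killed_functional[OF r kill p that] .
  then obtain \<rho> where \<rho>: "\<And>j i. j < m \<Longrightarrow> \<rho> j i \<in> carrier R"
    "\<And>j k. j < m \<Longrightarrow> k < m \<Longrightarrow> dot R n (\<rho> j) (f k) = (if k = j then r else \<zero>)"
    by metis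
  \<comment> \<open>The map into the syzygies given by the functionals \<open>\<rho> j\<close>.\<close>
  define P where "P v i = (\<Oplus>j\<in>{..<m}. dot R n (\<rho> j) v \<otimes> f j i)" for v i
  have \<rho>c: "dot R n (\<rho> j) v \<in> carrier R" if "j < m" "v \<in> V" for j v
    using \<rho>(1) that V_closed by auto
  have Pc: "P v i \<in> carrier R" if "v \<in> V" for v i
    unfolding P_def using \<rho>c that by (intro finsum_closed) auto
  \<comment> \<open>Multiplication by \<open>r\<close> and \<open>P\<close> agree on this syzygy, which links the vectors
    \<open>g\<close> and \<open>h\<close>.\<close>
  let ?z = "koszul_relation h g"
  have z: "?z \<in> syzygies R xs" by (intro koszul_relation_syzygy g h)
  have \<rho>z: "dot R n (\<rho> j) ?z = r \<otimes> \<psi> j ?z" if j: "j < m" for j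
  proof -
    have "dot R n (\<rho> j) ?z = dot R n (\<rho> j) (\<lambda>i. \<Oplus>k\<in>{..<m}. \<psi> k ?z \<otimes> f k i)"
      using syzygy_expansion[OF z] by (metis (no_types, lifting) ext)
    also have "\<dots> = (\<Oplus>k\<in>{..<m}. \<psi> k ?z \<otimes> dot R n (\<rho> j) (f k))"
      using \<rho>(1) j psi_closed[OF _ z] by (intro dot_lincomb) auto
    also have "\<dots> = (\<Oplus>k\<in>{..<m}. if k = j then r \<otimes> \<psi> j ?z else \<zero>)"
      using j r \<rho>(2) psi_closed[OF _ z] by (intro finsum_cong') (auto simp: m_comm)
    also have "\<dots> = r \<otimes> \<psi> j ?z" using j r psi_closed[OF _ z] by (intro finsum_delta) auto
    finally show ?thesis .
  qed
  have key: "r \<otimes> ?z i = d h \<otimes> P g i \<ominus> d g \<otimes> P h i" for i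
  proof -
    have "r \<otimes> ?z i = r \<otimes> (\<Oplus>j\<in>{..<m}. \<psi> j ?z \<otimes> f j i)"
      using syzygy_expansion[OF z, of i] by simp
    also have "\<dots> = (\<Oplus>j\<in>{..<m}. r \<otimes> (\<psi> j ?z \<otimes> f j i))"
      using r psi_closed[OF _ z] by (intro finsum_rdistr) auto
    also have "\<dots> = dot R m (\<lambda>j. f j i) (\<lambda>j. dot R n (\<rho> j) ?z)"
      unfolding dot_def[of R m] using r psi_closed[OF _ z]
      by (intro finsum_cong') (auto simp: \<rho>z m_assoc m_comm[of "f _ _"])
    also have "\<dots> = dot R m (\<lambda>j. f j i) (\<lambda>j. d h \<otimes> dot R n (\<rho> j) g \<ominus> d g \<otimes> dot R n (\<rho> j) h)"
    proof (intro dot_cong)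
      fix j assume j: "j < m"
      have "dot R n (\<rho> j) ?z = dot R n (\<rho> j) (\<lambda>i. d h \<otimes> g i) \<ominus> dot R n (\<rho> j) (\<lambda>i. d g \<otimes> h i)"
        unfolding koszul_relation_def using \<rho>(1)[OF j] g h by (intro dot_minus) (auto simp: V_closed)
      also have "dot R n (\<rho> j) (\<lambda>i. d h \<otimes> g i) = d h \<otimes> dot R n (\<rho> j) g"
        using \<rho>(1)[OF j] g h by (intro dot_smult) (auto simp: V_closed)
      also have "dot R n (\<rho> j) (\<lambda>i. d g \<otimes> h i) = d g \<otimes> dot R n (\<rho> j) h"
        using \<rho>(1)[OF j] g h by (intro dot_smult) (auto simp: V_closed)
      finally show "dot R n (\<rho> j) ?z = d h \<otimes> dot R n (\<rho> j) g \<ominus> d g \<otimes> dot R n (\<rho> j) h" .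
    qed (use \<rho>c g h in auto)
    also have "\<dots> = dot R m (\<lambda>j. f j i) (\<lambda>j. d h \<otimes> dot R n (\<rho> j) g)
        \<ominus> dot R m (\<lambda>j. f j i) (\<lambda>j. d g \<otimes> dot R n (\<rho> j) h)"
      using \<rho>c g h by (intro dot_minus) auto
    also have "dot R m (\<lambda>j. f j i) (\<lambda>j. d h \<otimes> dot R n (\<rho> j) g) = d h \<otimes> dot R m (\<lambda>j. f j i) (\<lambda>j. dot R n (\<rho> j) g)"
      using \<rho>c g h by (intro dot_smult) auto
    also have "dot R m (\<lambda>j. f j i) (\<lambda>j. d g \<otimes> dot R n (\<rho> j) h) = d g \<otimes> dot R m (\<lambda>j. f j i) (\<lambda>j. dot R n (\<rho> j) h)"
      using \<rho>c g h by (intro dot_smult) auto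
    also have "dot R m (\<lambda>j. f j i) (\<lambda>j. dot R n (\<rho> j) g) = P g i"
      unfolding P_def dot_def[of R m] using \<rho>c g by (intro finsum_cong') (auto simp: m_comm)
    also have "dot R m (\<lambda>j. f j i) (\<lambda>j. dot R n (\<rho> j) h) = P h i"
      unfolding P_def dot_def[of R m] using \<rho>c h by (intro finsum_cong') (auto simp: m_comm)
    finally show ?thesis .
  qed
  have "\<exists>c\<in>carrier R. r \<otimes> g i \<ominus> P g i = d g \<otimes> c" for i
  proof (rule regular2)
    have gi: "g i \<in> carrier R" "h i \<in> carrier R" "P g i \<in> carrier R" "P h i \<in> carrier R"
      "d g \<in> carrier R" "d h \<in> carrier R"
      using g h V_closed Pc by auto
    have "d h \<otimes> (r \<otimes> g i) \<ominus> d g \<otimes> (r \<otimes> h i) = r \<otimes> ?z i"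
      unfolding koszul_relation_def using r gi by (simp add: minus_eq r_distr r_minus m_lcomm)
    then have "d h \<otimes> (r \<otimes> g i) \<ominus> d g \<otimes> (r \<otimes> h i) = d h \<otimes> P g i \<ominus> d g \<otimes> P h i"
      using key[of i] by simp
    then have "d h \<otimes> (r \<otimes> g i) \<ominus> d h \<otimes> P g i = d g \<otimes> (r \<otimes> h i) \<ominus> d g \<otimes> P h i"
      by (rule minus_exchange) (use r gi in auto)
    then show "d h \<otimes> (r \<otimes> g i \<ominus> P g i) = d g \<otimes> (r \<otimes> h i \<ominus> P h i)"
      using r gi by (simp add: minus_eq r_distr r_minus)
  qed (use r g h Pc V_closed in auto)
  then obtain c where c: "\<And>i. c i \<in> carrier R" "\<And>i. r \<otimes> g i \<ominus> P g i = d g \<otimes> c i"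
    by metis
  define c' where "c' i = (if i < n then c i else \<zero>)" for i
  have c': "c' \<in> V" using c(1) by (auto simp: c'_def free_module_def)
  have "d (P g) = (\<Oplus>j\<in>{..<m}. dot R n (\<rho> j) g \<otimes> d (f j))"
    unfolding P_def using \<rho>c g by (intro dot_lincomb) auto
  also have "\<dots> = \<zero>"
    using \<rho>c[OF _ g] by (intro add.finprod_one_eqI) (auto simp: d_f)
  finally have dP: "d (P g) = \<zero>" .
  have "d g \<otimes> d c' = d (\<lambda>i. d g \<otimes> c' i)"
    using g c' by (intro dot_smult[symmetric]) (auto simp: V_closed)
  also have "\<dots> = d (\<lambda>i. r \<otimes> g i \<ominus> P g i)"
    using c g r Pc V_closed by (intro dot_cong) (auto simp: c'_def)
  also have "\<dots> = d (\<lambda>i. r \<otimes> g i) \<ominus> d (P g)"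
    using g r Pc by (intro dot_minus) (auto simp: V_closed)
  also have "d (\<lambda>i. r \<otimes> g i) = r \<otimes> d g"
    using g r by (intro dot_smult) (auto simp: V_closed)
  finally have "d g \<otimes> d c' = d g \<otimes> r" using dP r g by (simp add: minus_eq m_comm)
  then have "d c' = r" by (rule regular_cancel[rotated 2]) (use c' r in auto)
  then show ?thesis using c' by blast
qed

end

context cring
begin

section \<open>Koszul homology through cycles and boundaries\<close>

lemma genideal_eq_dot:
  assumes xs: "set xs \<subseteq> carrier R"
  shows "Idl (set xs) = dot R (length xs) ((!) xs) ` carrier (free_module R {..<length xs})" (is "_ = ?J")
proof
  let ?n = "length xs"
  let ?V = "carrier (free_module R {..<?n})"
  have nth: "xs ! i \<in> carrier R" if "i < ?n" for i using xs that by auto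
  have V: "v i \<in> carrier R" if "v \<in> ?V" for v i using that by (simp add: free_module_def)
  have J: "dot R ?n ((!) xs) v \<in> ?J" if "v \<in> ?V" for v using that by auto
  have "ideal ?J R"
  proof (rule idealI)
    show "ring R" by (rule ring_axioms)
    show "subgroup ?J (add_monoid R)"
    proof (rule add.subgroupI)
      show "?J \<subseteq> carrier R" using nth V by (auto intro!: dot_closed)
      have "(\<lambda>i. \<zero>) \<in> ?V" by (simp add: free_module_def)
      then show "?J \<noteq> {}" by blast
      show "\<ominus> a \<in> ?J" if a: "a \<in> ?J" for a
      proof -
        obtain v where v: "v \<in> ?V" "a = dot R ?n ((!) xs) v" using a by blast
        have "\<ominus> a = dot R ?n ((!) xs) (\<lambda>i. \<ominus> \<one> \<otimes> v i)"
          unfolding v(2) using nth V[OF v(1)] by (subst dot_smult) (auto simp: l_minus)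
        moreover have "(\<lambda>i. \<ominus> \<one> \<otimes> v i) \<in> ?V" using v(1) by (auto simp: free_module_def)
        ultimately show ?thesis using J by simp
      qed
      show "a \<oplus> b \<in> ?J" if ab: "a \<in> ?J" "b \<in> ?J" for a b
      proof -
        obtain v w where vw: "v \<in> ?V" "a = dot R ?n ((!) xs) v" "w \<in> ?V" "b = dot R ?n ((!) xs) w"
          using ab by blast
        have "a \<oplus> b = dot R ?n ((!) xs) (\<lambda>i. v i \<oplus> w i)"
          unfolding vw using nth V[OF vw(1)] V[OF vw(3)] by (subst dot_add) auto
        moreover have "(\<lambda>i. v i \<oplus> w i) \<in> ?V" using vw by (auto simp: free_module_def)
        ultimately show ?thesis using J by simp
      qed
    qed
    have l: "r \<otimes> a \<in> ?J" if a: "a \<in> ?J" and r: "r \<in> carrier R" for a r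
    proof -
      obtain v where v: "v \<in> ?V" "a = dot R ?n ((!) xs) v" using a by blast
      have "r \<otimes> a = dot R ?n ((!) xs) (\<lambda>i. r \<otimes> v i)"
        unfolding v(2) using nth V[OF v(1)] r by (subst dot_smult) auto
      moreover have "(\<lambda>i. r \<otimes> v i) \<in> ?V" using v(1) r by (auto simp: free_module_def)
      ultimately show ?thesis using J by simp
    qed
    show "r \<otimes> a \<in> ?J" if "a \<in> ?J" "r \<in> carrier R" for a r using l that .
    show "a \<otimes> r \<in> ?J" if a: "a \<in> ?J" and r: "r \<in> carrier R" for a r
    proof -
      have "a \<in> carrier R" using a nth V by (auto intro!: dot_closed)
      then show ?thesis using l[OF a r] m_comm[of a r] r by simp
    qed
  qed
  moreover have "set xs \<subseteq> ?J"
  proof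
    fix a assume "a \<in> set xs"
    then obtain k where k: "k < ?n" "a = xs ! k" by (auto simp: in_set_conv_nth)
    have "a = dot R ?n ((!) xs) (\<lambda>i. if i = k then \<one> else \<zero>)"
      using dot_unit[of ?n "(!) xs" k] nth k by simp
    moreover have "(\<lambda>i. if i = k then \<one> else \<zero>) \<in> ?V" using k by (simp add: free_module_def)
    ultimately show "a \<in> ?J" using J by simp
  qed
  ultimately show "Idl (set xs) \<subseteq> ?J" by (rule genideal_minimal)
  show "?J \<subseteq> Idl (set xs)"
  proof
    fix a assume "a \<in> ?J"
    then obtain v where v: "v \<in> ?V" "a = dot R ?n ((!) xs) v" by blast
    interpret I: ideal "Idl (set xs)" R by (rule genideal_ideal[OF xs])
    have "(\<Oplus>i\<in>A. xs ! i \<otimes> v i) \<in> Idl (set xs)" if "finite A" "A \<subseteq> {..<?n}" for A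
      using that
    proof (induction A rule: finite_induct)
      case (insert i A)
      have "xs ! i \<in> Idl (set xs)" using insert.prems genideal_self[OF xs] by auto
      then have "xs ! i \<otimes> v i \<in> Idl (set xs)" using V[OF v(1)] by (intro I.I_r_closed) auto
      then show ?case using insert V[OF v(1)] nth
        by (subst finsum_insert) (auto intro!: I.a_closed)
    qed (simp)
    then show "a \<in> Idl (set xs)" unfolding v(2) dot_def by blast
  qed
qed

lemma koszul_cycles_closed: "w \<in> koszul_cycles R xs p \<Longrightarrow> w T \<in> carrier R"
  by (simp add: koszul_cycles_def ext_power_def)

lemma koszul_boundaries_iff:
  assumes xs: "set xs \<subseteq> carrier R"
  shows "w \<in> koszul_boundaries R xs p \<longleftrightarrow>
    (\<exists>b\<in>carrier (ext_power R (length xs) (Suc p)). w = contract R (length xs) ((!) xs) b)"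
proof -
  have "koszul_diff R xs b = contract R (length xs) ((!) xs) b"
    if "b \<in> carrier (ext_power R (length xs) (Suc p))" for b
    using that by (intro koszul_diff_eq_contract xs) (auto simp: ext_power_def)
  then show ?thesis unfolding koszul_boundaries_def by auto
qed

lemma koszul_boundaries_closed:
  "set xs \<subseteq> carrier R \<Longrightarrow> w \<in> koszul_boundaries R xs p \<Longrightarrow> w T \<in> carrier R"
  by (auto simp: koszul_boundaries_iff ext_power_def intro!: contract_closed)

lemma contract_add:
  assumes "\<And>T. f T \<in> carrier R" "\<And>T. f' T \<in> carrier R" "\<And>i. i < n \<Longrightarrow> u i \<in> carrier R"
  shows "contract R n u (\<lambda>T. f T \<oplus> f' T) T = contract R n u f T \<oplus> contract R n u f' T"
proof -
  have "contract R n u (\<lambda>T. f T \<oplus> f' T) T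
      = (\<Oplus>i\<in>{..<n}. u i \<otimes> contract_at R i f T \<oplus> u i \<otimes> contract_at R i f' T)"
    unfolding contract_def using assms by (intro finsum_cong') (auto simp: contract_at_def r_distr)
  also have "\<dots> = contract R n u f T \<oplus> contract R n u f' T"
    unfolding contract_def using assms by (intro finsum_addf) auto
  finally show ?thesis .
qed

lemma koszul_boundaries_add:
  assumes xs: "set xs \<subseteq> carrier R"
    and "v \<in> koszul_boundaries R xs p" "w \<in> koszul_boundaries R xs p"
  shows "(\<lambda>T. v T \<oplus> w T) \<in> koszul_boundaries R xs p"
proof -
  obtain a b where ab: "a \<in> carrier (ext_power R (length xs) (Suc p))"
    "v = contract R (length xs) ((!) xs) a" "b \<in> carrier (ext_power R (length xs) (Suc p))"
    "w = contract R (length xs) ((!) xs) b"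
    using assms by (auto simp: koszul_boundaries_iff)
  have "(\<lambda>T. a T \<oplus> b T) \<in> carrier (ext_power R (length xs) (Suc p))"
    using ab by (auto simp: ext_power_def)
  moreover have "(\<lambda>T. v T \<oplus> w T) = contract R (length xs) ((!) xs) (\<lambda>T. a T \<oplus> b T)"
    unfolding ab(2,4) using xs ab(1,3) by (intro ext contract_add[symmetric]) (auto simp: ext_power_def)
  ultimately show ?thesis using xs by (auto simp: koszul_boundaries_iff)
qed

lemma koszul_boundaries_smult:
  assumes xs: "set xs \<subseteq> carrier R" and "v \<in> koszul_boundaries R xs p" and r: "r \<in> carrier R"
  shows "(\<lambda>T. r \<otimes> v T) \<in> koszul_boundaries R xs p"
proof -
  obtain a where a: "a \<in> carrier (ext_power R (length xs) (Suc p))"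
    "v = contract R (length xs) ((!) xs) a"
    using assms by (auto simp: koszul_boundaries_iff)
  have "(\<lambda>T. r \<otimes> a T) \<in> carrier (ext_power R (length xs) (Suc p))"
    using a r by (auto simp: ext_power_def)
  moreover have "(\<lambda>T. r \<otimes> v T) = contract R (length xs) ((!) xs) (\<lambda>T. r \<otimes> a T)"
    unfolding a(2) using xs a(1) r by (intro ext contract_smult[symmetric]) (auto simp: ext_power_def)
  ultimately show ?thesis using xs by (auto simp: koszul_boundaries_iff)
qed

lemma koszul_boundaries_zero:
  assumes "set xs \<subseteq> carrier R"
  shows "(\<lambda>T. \<zero>) \<in> koszul_boundaries R xs p"
proof -
  have "(\<lambda>T. \<zero>) \<in> carrier (ext_power R (length xs) (Suc p))" by (simp add: ext_power_def)
  moreover have "(\<lambda>T. \<zero>) = contract R (length xs) ((!) xs) (\<lambda>T. \<zero>)"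
    unfolding contract_def contract_at_def using subsetD[OF assms nth_mem]
    by (intro ext add.finprod_one_eqI[symmetric]) auto
  ultimately show ?thesis using assms by (auto simp: koszul_boundaries_iff)
qed

lemma koszul_cycles_zero: "(\<lambda>T. \<zero>) \<in> koszul_cycles R xs p" if "set xs \<subseteq> carrier R"
  using that subsetD[OF that nth_mem]
  by (auto simp: koszul_cycles_def ext_power_def koszul_diff_eq_contract
      contract_def contract_at_def intro!: ext add.finprod_one_eqI)

text \<open>The classes of \<^const>\<open>koszul_homology\<close> written without the group structure of the ambient module.\<close>

definition koszul_coset :: "'a list \<Rightarrow> nat \<Rightarrow> (nat set \<Rightarrow> 'a) \<Rightarrow> (nat set \<Rightarrow> 'a) set" where
  "koszul_coset xs p w = (\<lambda>b T. b T \<oplus> w T) ` koszul_boundaries R xs p"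

lemma koszul_homology_simps:
  "carrier (koszul_homology R xs p) = koszul_coset xs p ` koszul_cycles R xs p"
  "\<zero>\<^bsub>koszul_homology R xs p\<^esub> = koszul_boundaries R xs p"
  "r \<odot>\<^bsub>koszul_homology R xs p\<^esub> A = (\<Union>w\<in>A. koszul_coset xs p (\<lambda>T. r \<otimes> w T))"
  by (auto simp: koszul_homology_def quotient_module_def koszul_coset_def A_RCOSETS_def'
      a_r_coset_def' ext_power_def)

lemma koszul_coset_boundary:
  assumes xs: "set xs \<subseteq> carrier R" and v: "v \<in> koszul_boundaries R xs p"
  shows "koszul_coset xs p v = koszul_boundaries R xs p"
proof
  show "koszul_coset xs p v \<subseteq> koszul_boundaries R xs p"
    unfolding koszul_coset_def using koszul_boundaries_add[OF xs _ v] by auto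
  show "koszul_boundaries R xs p \<subseteq> koszul_coset xs p v"
  proof
    fix w assume w: "w \<in> koszul_boundaries R xs p"
    have "(\<lambda>T. w T \<oplus> \<ominus> \<one> \<otimes> v T) \<in> koszul_boundaries R xs p"
      by (intro koszul_boundaries_add koszul_boundaries_smult xs w v) simp
    moreover have "w = (\<lambda>T. (w T \<oplus> \<ominus> \<one> \<otimes> v T) \<oplus> v T)"
      using koszul_boundaries_closed[OF xs w] koszul_boundaries_closed[OF xs v]
      by (simp add: l_minus a_assoc l_neg)
    ultimately show "w \<in> koszul_coset xs p v" unfolding koszul_coset_def
      by (intro image_eqI[of w])
  qed
qed

lemma mem_koszul_coset:
  assumes "set xs \<subseteq> carrier R" "\<And>T. w T \<in> carrier R"
  shows "w \<in> koszul_coset xs p w"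
  unfolding koszul_coset_def
  by (rule image_eqI[OF _ koszul_boundaries_zero[OF assms(1)]]) (simp add: assms(2))

lemma zero_module_koszul_homology:
  assumes xs: "set xs \<subseteq> carrier R" and "koszul_cycles R xs p \<subseteq> koszul_boundaries R xs p"
  shows "zero_module (koszul_homology R xs p)"
  using assms koszul_cycles_zero[OF xs, of p]
  by (auto simp: zero_module_def koszul_homology_simps koszul_coset_boundary subset_iff image_iff)

lemma annihilator_koszul_homology:
  assumes xs: "set xs \<subseteq> carrier R"
  shows "annihilator R (koszul_homology R xs p)
    = {r \<in> carrier R. \<forall>w\<in>koszul_cycles R xs p. (\<lambda>T. r \<otimes> w T) \<in> koszul_boundaries R xs p}"
proof -
  let ?B = "koszul_boundaries R xs p"
  have "(\<Union>v\<in>koszul_coset xs p w. koszul_coset xs p (\<lambda>T. r \<otimes> v T)) = ?B \<longleftrightarrow> (\<lambda>T. r \<otimes> w T) \<in> ?B"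
    if r: "r \<in> carrier R" and w: "w \<in> koszul_cycles R xs p" for r w
  proof
    assume *: "(\<Union>v\<in>koszul_coset xs p w. koszul_coset xs p (\<lambda>T. r \<otimes> v T)) = ?B"
    have "(\<lambda>T. r \<otimes> w T) \<in> koszul_coset xs p (\<lambda>T. r \<otimes> w T)"
      using koszul_cycles_closed[OF w] r by (intro mem_koszul_coset[OF xs]) auto
    with mem_koszul_coset[where p = p and w = w, OF xs koszul_cycles_closed[OF w]]
    have "(\<lambda>T. r \<otimes> w T) \<in> (\<Union>v\<in>koszul_coset xs p w. koszul_coset xs p (\<lambda>T. r \<otimes> v T))"
      by (rule UN_I[where B = "\<lambda>v. koszul_coset xs p (\<lambda>T. r \<otimes> v T)"])
    then show "(\<lambda>T. r \<otimes> w T) \<in> ?B" unfolding * .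
  next
    have wc: "w T \<in> carrier R" for T using koszul_cycles_closed[OF w] .
    assume rw: "(\<lambda>T. r \<otimes> w T) \<in> ?B"
    have "koszul_coset xs p (\<lambda>T. r \<otimes> v T) = ?B" if v: "v \<in> koszul_coset xs p w" for v
    proof (rule koszul_coset_boundary[OF xs])
      obtain b where b: "b \<in> ?B" "v = (\<lambda>T. b T \<oplus> w T)" using v by (auto simp: koszul_coset_def)
      have "(\<lambda>T. r \<otimes> v T) = (\<lambda>T. r \<otimes> b T \<oplus> r \<otimes> w T)"
        unfolding b(2) using r wc koszul_boundaries_closed[OF xs b(1)] by (auto simp: r_distr)
      then show "(\<lambda>T. r \<otimes> v T) \<in> ?B"
        using koszul_boundaries_add[OF xs koszul_boundaries_smult[OF xs b(1) r] rw] by simp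
    qed
    then show "(\<Union>v\<in>koszul_coset xs p w. koszul_coset xs p (\<lambda>T. r \<otimes> v T)) = ?B"
      using mem_koszul_coset[where p = p and w = w, OF xs wc]
      by (metis (no_types, lifting) SUP_eq_const empty_iff)
  qed
  note eq = this
  show ?thesis
    unfolding annihilator_def koszul_homology_simps
    by (intro Collect_cong conj_cong refl) (simp only: ball_simps eq cong: ball_cong)
qed

text \<open>Wedging with \<open>v\<close> is a homotopy between multiplication by \<open>d v\<close> and zero.\<close>

lemma ideal_subset_annihilator:
  assumes xs: "set xs \<subseteq> carrier R"
  shows "Idl (set xs) \<subseteq> annihilator R (koszul_homology R xs p)"
proof
  let ?n = "length xs"
  have nth: "xs ! i \<in> carrier R" if "i < ?n" for i using xs that by auto
  fix a assume "a \<in> Idl (set xs)"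
  then obtain v where v: "v \<in> carrier (free_module R {..<?n})" "a = dot R ?n ((!) xs) v"
    by (auto simp: genideal_eq_dot[OF xs])
  have vc: "v i \<in> carrier R" for i using v by (simp add: free_module_def)
  have "(\<lambda>T. a \<otimes> w T) \<in> koszul_boundaries R xs p" if w: "w \<in> koszul_cycles R xs p" for w
  proof -
    have wc: "w T \<in> carrier R" for T using koszul_cycles_closed[OF w] .
    have we: "w \<in> carrier (ext_power R ?n p)" and "koszul_diff R xs w = (\<lambda>T. \<zero>)"
      using w by (auto simp: koszul_cycles_def)
    then have "contract R ?n ((!) xs) w T = \<zero>" for T
      using koszul_diff_eq_contract[OF xs, of w] wc by metis
    then have "wedge R ?n v (contract R ?n ((!) xs) w) T = \<zero>" for T
      using vc by (intro wedge_eq_zero) auto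
    then have "contract R ?n ((!) xs) (wedge R ?n v w) T = a \<otimes> w T" for T
      using contract_wedge[of w ?n "(!) xs" v T] wc vc nth v(2) by simp
    moreover have "wedge R ?n v w \<in> carrier (ext_power R ?n (Suc p))"
      using we vc by (intro wedge_in_ext_power)
    ultimately show ?thesis unfolding koszul_boundaries_iff[OF xs]
      by (intro bexI[of _ "wedge R ?n v w"] ext) simp_all
  qed
  moreover have "a \<in> carrier R" using v vc nth by auto
  ultimately show "a \<in> annihilator R (koszul_homology R xs p)"
    by (simp add: annihilator_koszul_homology[OF xs])
qed

end

context free_syzygies
begin

section \<open>Koszul homology when the syzygies are free\<close>

text \<open>In degree \<open>m = n - 1\<close> all cycles are multiples of the boundary of the top form; in degree
\<open>n\<close> the differential is injective because that boundary is faithful; above there are no chains.\<close>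

lemma koszul_homology_vanishes:
  assumes "m \<le> p"
  shows "zero_module (koszul_homology R xs p)"
proof (rule zero_module_koszul_homology[OF xs_closed], rule subsetI)
  fix w assume w: "w \<in> koszul_cycles R xs p"
  have wc: "w T \<in> carrier R" for T using koszul_cycles_closed[OF w] .
  have we: "w \<in> carrier (ext_power R n p)" and "koszul_diff R xs w = (\<lambda>T. \<zero>)"
    using w by (auto simp: koszul_cycles_def)
  then have cyc: "contract R n ((!) xs) w T = \<zero>" for T
    using koszul_diff_eq_contract[OF xs_closed, of w] wc by metis
  consider "p = m" | "p = n" | "n < p" using assms rank_syzygies by linarith
  then show "w \<in> koszul_boundaries R xs p"
  proof cases
    case 1
    obtain c where c: "c \<in> carrier R" "\<And>T. w T = c \<otimes> top_boundary T"
      using cycle_multiple_top_boundary[of w] we cyc 1 by blast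
    have "(\<lambda>T. c \<otimes> top_form T) \<in> carrier (ext_power R n (Suc p))"
      using c 1 rank_syzygies by (auto simp: ext_power_def top_form_def)
    moreover have "w = contract R n ((!) xs) (\<lambda>T. c \<otimes> top_form T)"
      using c by (auto simp: contract_smult top_boundary_def)
    ultimately show ?thesis by (auto simp: koszul_boundaries_iff[OF xs_closed])
  next
    case 2
    have eq: "w = (\<lambda>T. w {..<n} \<otimes> top_form T)" using top_degree_eq we 2 by simp
    have "w {..<n} \<otimes> top_boundary T = \<zero>" for T
      using cyc[of T] wc by (subst (asm) eq) (simp add: contract_smult top_boundary_def)
    then have "w {..<n} = \<zero>" using wc by (rule_tac top_boundary_faithful)
    then have "w = (\<lambda>T. \<zero>)" by (subst eq) simp
    then show ?thesis using koszul_boundaries_zero[OF xs_closed] by simp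
  next
    case 3
    then have "w = (\<lambda>T. \<zero>)" using ext_power_trivial[OF we] by auto
    then show ?thesis using koszul_boundaries_zero[OF xs_closed] by simp
  qed
qed

theorem annihilator_koszul_homology_eq:
  assumes "\<not> zero_module (koszul_homology R xs p)"
  shows "annihilator R (koszul_homology R xs p) = Idl (set xs)"
proof
  have p: "p < m" using assms koszul_homology_vanishes[of p] by fastforce
  show "annihilator R (koszul_homology R xs p) \<subseteq> Idl (set xs)"
    using annihilator_homology_in_ideal[OF _ _ p]
    by (auto simp: annihilator_koszul_homology[OF xs_closed] genideal_eq_dot[OF xs_closed])
qed (rule ideal_subset_annihilator[OF xs_closed])

end

section \<open>Lifting through finitely many generators\<close>

text \<open>An isomorphic copy of \<open>N\<close> on another type.  The lifting property in \<^const>\<open>projective_module\<close>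
speaks about modules over a fixed element type, whereas \<open>R/I\<close> and \<open>I\<close> live on other types.\<close>

definition transport_module :: "('a, 'm) module \<Rightarrow> ('m \<Rightarrow> 'p) \<Rightarrow> ('a, 'p) module" where
  "transport_module N j =
     \<lparr>carrier = j ` carrier N, monoid.mult = undefined, one = undefined, ring.zero = j \<zero>\<^bsub>N\<^esub>,
      add = (\<lambda>x y. j (the_inv_into (carrier N) j x \<oplus>\<^bsub>N\<^esub> the_inv_into (carrier N) j y)),
      smult = (\<lambda>r x. j (r \<odot>\<^bsub>N\<^esub> the_inv_into (carrier N) j x))\<rparr>"

context cring
begin

lemma transport_module_module:
  assumes N: "module R N" and j: "inj_on j (carrier N)"
  shows "module R (transport_module N j)"
proof -
  interpret N: module R N by fact
  note inv = the_inv_into_f_f[OF j]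
  show ?thesis
  proof (rule moduleI)
    show "cring R" by (rule is_cring)
    show "abelian_group (transport_module N j)"
    proof (rule abelian_groupI)
      fix x assume "x \<in> carrier (transport_module N j)"
      then obtain y where "y \<in> carrier N" "x = j y" by (auto simp: transport_module_def)
      then show "\<exists>y\<in>carrier (transport_module N j). y \<oplus>\<^bsub>transport_module N j\<^esub> x = \<zero>\<^bsub>transport_module N j\<^esub>"
        by (intro bexI[of _ "j (\<ominus>\<^bsub>N\<^esub> y)"]) (auto simp: transport_module_def inv N.l_neg)
    qed (auto simp: transport_module_def inv N.a_ac)
  qed (auto simp: transport_module_def inv N.smult_l_distr N.smult_r_distr N.smult_assoc1)
qed

text \<open>A map from a projective module to a module with finite generating family \<open>s\<close> lifts to the
free module on that family.  The coordinates of the lift express the map in terms of the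
generators by linear functionals.  The free module is indexed by the images \<open>j (s k)\<close>, so that it
lives on the type that the lifting property provides.\<close>

lemma projective_coordinates:
  fixes P :: "('a, 'p) module" and N :: "('a, 'm) module"
  assumes P: "projective_module R P" and N: "module R N" and j: "inj_on (j :: 'm \<Rightarrow> 'p) (carrier N)"
    and K: "finite K" "inj_on s K" and s: "\<And>k. k \<in> K \<Longrightarrow> s k \<in> carrier N"
    and gen: "\<And>x. x \<in> carrier N \<Longrightarrow>
      \<exists>a. (\<forall>k\<in>K. a k \<in> carrier R) \<and> x = (\<Oplus>\<^bsub>N\<^esub>k\<in>K. a k \<odot>\<^bsub>N\<^esub> s k)"
    and f: "f \<in> mod_hom R P N"
  shows "\<exists>c. (\<forall>k\<in>K. c k \<in> mod_hom R P (regular_module R)) \<and>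
    (\<forall>p\<in>carrier P. f p = (\<Oplus>\<^bsub>N\<^esub>k\<in>K. c k p \<odot>\<^bsub>N\<^esub> s k))"
proof -
  interpret N: module R N by fact
  let ?N = "transport_module N j"
  let ?M = "free_module R (j ` s ` K)"
  define S where "S \<phi> = (\<Oplus>\<^bsub>N\<^esub>k\<in>K. \<phi> (j (s k)) \<odot>\<^bsub>N\<^esub> s k)" for \<phi>
  have jinv: "the_inv_into (carrier N) j (j x) = x" if "x \<in> carrier N" for x
    using that j by (rule the_inv_into_f_f[rotated])
  have Mc: "\<phi> t \<in> carrier R" if "\<phi> \<in> carrier ?M" for \<phi> t
    using that by (simp add: free_module_def)
  have Sc: "S \<phi> \<in> carrier N" if "\<phi> \<in> carrier ?M" for \<phi>
    unfolding S_def using Mc[OF that] s by (intro N.finsum_closed) auto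
  have hom: "(\<lambda>\<phi>. j (S \<phi>)) \<in> mod_hom R ?M ?N"
  proof -
    have "S (\<phi> \<oplus>\<^bsub>?M\<^esub> \<phi>') = S \<phi> \<oplus>\<^bsub>N\<^esub> S \<phi>'" if "\<phi> \<in> carrier ?M" "\<phi>' \<in> carrier ?M" for \<phi> \<phi>'
    proof -
      have "S (\<phi> \<oplus>\<^bsub>?M\<^esub> \<phi>') = (\<Oplus>\<^bsub>N\<^esub>k\<in>K. \<phi> (j (s k)) \<odot>\<^bsub>N\<^esub> s k \<oplus>\<^bsub>N\<^esub> \<phi>' (j (s k)) \<odot>\<^bsub>N\<^esub> s k)"
        unfolding S_def using Mc[OF that(1)] Mc[OF that(2)] s
        by (intro N.finsum_cong') (auto simp: free_module_def N.smult_l_distr)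
      also have "\<dots> = S \<phi> \<oplus>\<^bsub>N\<^esub> S \<phi>'"
        unfolding S_def using Mc[OF that(1)] Mc[OF that(2)] s by (intro N.finsum_addf) auto
      finally show ?thesis .
    qed
    moreover have "S (r \<odot>\<^bsub>?M\<^esub> \<phi>) = r \<odot>\<^bsub>N\<^esub> S \<phi>" if "\<phi> \<in> carrier ?M" "r \<in> carrier R" for \<phi> r
    proof -
      have "S (r \<odot>\<^bsub>?M\<^esub> \<phi>) = (\<Oplus>\<^bsub>N\<^esub>k\<in>K. r \<odot>\<^bsub>N\<^esub> (\<phi> (j (s k)) \<odot>\<^bsub>N\<^esub> s k))"
        unfolding S_def using Mc[OF that(1)] that(2) s
        by (intro N.finsum_cong') (auto simp: free_module_def N.smult_assoc1)
      also have "\<dots> = r \<odot>\<^bsub>N\<^esub> S \<phi>"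
        unfolding S_def using Mc[OF that(1)] that(2) s K
        by (intro N.finsum_smult_ldistr[symmetric]) auto
      finally show ?thesis .
    qed
    ultimately show ?thesis
      using Sc by (auto simp: mod_hom_def transport_module_def jinv)
  qed
  have "(\<lambda>\<phi>. j (S \<phi>)) ` carrier ?M = carrier ?N"
  proof
    show "(\<lambda>\<phi>. j (S \<phi>)) ` carrier ?M \<subseteq> carrier ?N"
      using Sc by (auto simp: transport_module_def)
    show "carrier ?N \<subseteq> (\<lambda>\<phi>. j (S \<phi>)) ` carrier ?M"
    proof
      fix y assume "y \<in> carrier ?N"
      then obtain x where x: "x \<in> carrier N" "y = j x" by (auto simp: transport_module_def)
      obtain a where a: "\<And>k. k \<in> K \<Longrightarrow> a k \<in> carrier R" "x = (\<Oplus>\<^bsub>N\<^esub>k\<in>K. a k \<odot>\<^bsub>N\<^esub> s k)"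
        using gen[OF x(1)] by blast
      have js: "inj_on (\<lambda>k. j (s k)) K"
        using K(2) j s by (auto simp: inj_on_def)
      define \<phi> where "\<phi> t = (if t \<in> j ` s ` K then a (the_inv_into K (\<lambda>k. j (s k)) t) else \<zero>)" for t
      have \<phi>: "\<phi> (j (s k)) = a k" if "k \<in> K" for k
        using the_inv_into_f_f[OF js that] that by (auto simp: \<phi>_def)
      have "\<phi> \<in> carrier ?M"
        using \<phi> a(1) by (auto simp: free_module_def \<phi>_def)
      moreover have "S \<phi> = x"
        unfolding S_def a(2) using \<phi> a(1) s by (intro N.finsum_cong') auto
      ultimately show "y \<in> (\<lambda>\<phi>. j (S \<phi>)) ` carrier ?M" using x(2) by blast
    qed
  qed
  moreover have "(\<lambda>p. j (f p)) \<in> mod_hom R P ?N"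
    using f by (auto simp: mod_hom_def transport_module_def jinv Pi_iff)
  ultimately obtain h where h: "h \<in> mod_hom R P ?M" "\<And>p. p \<in> carrier P \<Longrightarrow> j (S (h p)) = j (f p)"
    using P free_module_module[of "j ` s ` K"] transport_module_module[OF N j] hom
    unfolding projective_module_def by meson
  have hM: "h p \<in> carrier ?M" if "p \<in> carrier P" for p using h(1) that by (auto simp: mod_hom_def)
  have "f p = S (h p)" if p: "p \<in> carrier P" for p
  proof -
    have "f p \<in> carrier N" using f p by (auto simp: mod_hom_def)
    then show ?thesis using h(2)[OF p] j Sc[OF hM[OF p]] by (simp add: inj_on_def)
  qed
  moreover have "(\<lambda>p. h p (j (s k))) \<in> mod_hom R P (regular_module R)" for k
  proof -
    have "h (p \<oplus>\<^bsub>P\<^esub> q) = h p \<oplus>\<^bsub>?M\<^esub> h q" if "p \<in> carrier P" "q \<in> carrier P" for p q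
      using h(1) that by (simp add: mod_hom_def)
    moreover have "h (r \<odot>\<^bsub>P\<^esub> p) = r \<odot>\<^bsub>?M\<^esub> h p" if "r \<in> carrier R" "p \<in> carrier P" for r p
      using h(1) that by (simp add: mod_hom_def)
    ultimately show ?thesis
      using Mc[OF hM] by (simp add: mod_hom_def regular_module_def free_module_def)
  qed
  ultimately show ?thesis
    unfolding S_def by (intro exI[of _ "\<lambda>k p. h p (j (s k))"]) auto
qed

text \<open>The multiplication of the quotient is a union over all representatives, which is constant
because \<open>I\<close> absorbs products.\<close>

lemma quotient_regular_simps:
  assumes "ideal I R"
  shows "carrier (quotient_module (regular_module R) I) = (\<lambda>a. I +> a) ` carrier R"
    "\<zero>\<^bsub>quotient_module (regular_module R) I\<^esub> = I"
    "\<And>a b. a \<in> carrier R \<Longrightarrow> b \<in> carrier R \<Longrightarrow>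
       (I +> a) \<oplus>\<^bsub>quotient_module (regular_module R) I\<^esub> (I +> b) = I +> (a \<oplus> b)"
    "\<And>r a. r \<in> carrier R \<Longrightarrow> a \<in> carrier R \<Longrightarrow>
       r \<odot>\<^bsub>quotient_module (regular_module R) I\<^esub> (I +> a) = I +> (r \<otimes> a)"
proof -
  interpret I: ideal I R by fact
  have coset: "I +>\<^bsub>regular_module R\<^esub> a = I +> a" for a
    by (simp add: a_r_coset_def' regular_module_def)
  have add: "A <+>\<^bsub>regular_module R\<^esub> B = A <+> B" for A B
    by (simp add: set_add_def' regular_module_def)
  show "carrier (quotient_module (regular_module R) I) = (\<lambda>a. I +> a) ` carrier R"
    by (auto simp: quotient_module_def A_RCOSETS_def' a_r_coset_def' regular_module_def)
  show "\<zero>\<^bsub>quotient_module (regular_module R) I\<^esub> = I" by (simp add: quotient_module_def)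
  show "(I +> a) \<oplus>\<^bsub>quotient_module (regular_module R) I\<^esub> (I +> b) = I +> (a \<oplus> b)"
    if "a \<in> carrier R" "b \<in> carrier R" for a b
    using I.a_rcos_sum[OF that] by (simp add: quotient_module_def add)
  show "r \<odot>\<^bsub>quotient_module (regular_module R) I\<^esub> (I +> a) = I +> (r \<otimes> a)"
    if r: "r \<in> carrier R" and a: "a \<in> carrier R" for r a
  proof -
    have eq: "I +> (r \<otimes> x) = I +> (r \<otimes> a)" if x: "x \<in> I +> a" for x
    proof -
      obtain i where i: "i \<in> I" "x = i \<oplus> a" using x by (auto simp: a_r_coset_def')
      have "r \<otimes> x \<ominus> r \<otimes> a = r \<otimes> i"
        using i r a I.Icarr by (simp add: r_distr minus_eq a_assoc r_neg)
      then show ?thesis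
        using I.I_l_closed[OF i(1) r] i r a I.Icarr
        by (subst quotient_eq_iff_same_a_r_cos[OF assms, symmetric]) auto
    qed
    have "a \<in> I +> a" using a I.zero_closed by (force simp: a_r_coset_def')
    then have "(\<Union>x\<in>I +> a. I +> (r \<otimes> x)) = I +> (r \<otimes> a)"
      using eq by (metis (no_types, lifting) SUP_eq_const empty_iff)
    then show ?thesis by (simp add: quotient_module_def coset, simp add: regular_module_def)
  qed
qed

lemma quotient_regular_module:
  assumes I: "ideal I R"
  shows "module R (quotient_module (regular_module R) I)"
proof -
  note simps = quotient_regular_simps[OF I]
  have zero: "I = I +> \<zero>"
    using a_rcos_zero[OF I, of \<zero>] additive_subgroup.zero_closed[OF ideal.axioms(1)[OF I]] by simp
  show ?thesis
  proof (rule moduleI)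
    show "cring R" by (rule is_cring)
    show "abelian_group (quotient_module (regular_module R) I)"
    proof (rule abelian_groupI)
      show "\<zero>\<^bsub>quotient_module (regular_module R) I\<^esub> \<in> carrier (quotient_module (regular_module R) I)"
        unfolding simps using zero by blast
      fix x assume "x \<in> carrier (quotient_module (regular_module R) I)"
      then obtain a where a: "a \<in> carrier R" "x = I +> a" by (auto simp: simps)
      have "(I +> \<zero>) \<oplus>\<^bsub>quotient_module (regular_module R) I\<^esub> x = x"
        unfolding a(2) using a(1) by (subst simps) auto
      then show "\<zero>\<^bsub>quotient_module (regular_module R) I\<^esub> \<oplus>\<^bsub>quotient_module (regular_module R) I\<^esub> x = x"
        using zero simps(2) by simp
      show "\<exists>y\<in>carrier (quotient_module (regular_module R) I).
          y \<oplus>\<^bsub>quotient_module (regular_module R) I\<^esub> x = \<zero>\<^bsub>quotient_module (regular_module R) I\<^esub>"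
        using a zero by (intro bexI[of _ "I +> (\<ominus> a)"]) (auto simp: simps l_neg)
    qed (auto simp: simps a_ac)
  qed (auto simp: simps l_distr r_distr m_assoc)
qed

end

section \<open>Comparing a resolution with the Koszul complex\<close>

definition ideal_module :: "('a, 'b) ring_scheme \<Rightarrow> 'a set \<Rightarrow> ('a, 'a) module" where
  "ideal_module R I = (regular_module R)\<lparr>carrier := I\<rparr>"

context cring
begin

lemma ideal_module_module:
  assumes "ideal I R"
  shows "module R (ideal_module R I)"
proof -
  interpret I: ideal I R by fact
  show ?thesis
    unfolding ideal_module_def
    by (rule submodule_moduleI[OF regular_module_module])
      (auto simp: regular_module_def I.I_l_closed I.Icarr)
qed

lemma finsum_ideal_module:
  assumes I: "ideal I R" and A: "finite A" and c: "\<And>k. k \<in> A \<Longrightarrow> c k \<in> I"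
  shows "finsum (ideal_module R I) c A = finsum R c A"
proof -
  interpret I: ideal I R by fact
  have "I \<subseteq> carrier (regular_module R)" using I.Icarr by (auto simp: regular_module_def)
  then have "finsum (ideal_module R I) c A = finsum (regular_module R) c A"
    using ideal_module_module[OF I] A c unfolding ideal_module_def
    by (intro finsum_submodule[OF regular_module_module])
  also have "\<dots> = finsum R c A" using A c I.Icarr by (intro finsum_regular_module) auto
  finally show ?thesis .
qed

lemma ideal_module_lincomb:
  assumes I: "ideal I R" and "\<And>k. k < n \<Longrightarrow> s k \<in> I" "\<And>k. k < n \<Longrightarrow> c k \<in> carrier R"
  shows "(\<Oplus>\<^bsub>ideal_module R I\<^esub>k\<in>{..<n}. c k \<odot>\<^bsub>ideal_module R I\<^esub> s k) = dot R n s c"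
proof -
  interpret I: ideal I R by fact
  have "(\<Oplus>\<^bsub>ideal_module R I\<^esub>k\<in>{..<n}. c k \<odot>\<^bsub>ideal_module R I\<^esub> s k)
      = finsum (ideal_module R I) (\<lambda>k. c k \<otimes> s k) {..<n}"
    by (simp add: ideal_module_def regular_module_def)
  also have "\<dots> = (\<Oplus>k\<in>{..<n}. c k \<otimes> s k)"
    using assms(2,3) by (intro finsum_ideal_module[OF I] I.I_l_closed) auto
  also have "\<dots> = dot R n s c"
    unfolding dot_def using assms(2,3) I.Icarr by (intro finsum_cong') (auto intro: m_comm)
  finally show ?thesis .
qed

lemma mod_hom_compose:
  "f \<in> mod_hom R M N \<Longrightarrow> g \<in> mod_hom R N L \<Longrightarrow> (\<lambda>x. g (f x)) \<in> mod_hom R M L"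
  by (auto simp: mod_hom_def Pi_iff)

lemma mod_hom_closed: "f \<in> mod_hom R M N \<Longrightarrow> x \<in> carrier M \<Longrightarrow> f x \<in> carrier N"
  by (auto simp: mod_hom_def)

lemma functional_closed:
  "f \<in> mod_hom R M (regular_module R) \<Longrightarrow> x \<in> carrier M \<Longrightarrow> f x \<in> carrier R"
  by (auto simp: mod_hom_def regular_module_def)

lemma functional_add:
  "f \<in> mod_hom R M (regular_module R) \<Longrightarrow> x \<in> carrier M \<Longrightarrow> y \<in> carrier M \<Longrightarrow>
    f (x \<oplus>\<^bsub>M\<^esub> y) = f x \<oplus> f y"
  by (auto simp: mod_hom_def regular_module_def)

lemma functional_smult:
  "f \<in> mod_hom R M (regular_module R) \<Longrightarrow> r \<in> carrier R \<Longrightarrow> x \<in> carrier M \<Longrightarrow>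
    f (r \<odot>\<^bsub>M\<^esub> x) = r \<otimes> f x"
  by (auto simp: mod_hom_def regular_module_def)

text \<open>The beginning of the chain maps between a resolution and \<open>R\<^sup>n \<rightarrow> R\<close>: \<open>\<beta>0\<close> and the coordinates
\<open>\<beta>1\<close> lead from the resolution to \<open>R\<^sup>n \<rightarrow> R\<close>, and \<open>1 \<mapsto> a\<close> leads back.  The last property says that
the composite \<open>R \<rightarrow> P 0 \<rightarrow> R\<close> differs from the identity by an element of \<open>I\<close>.\<close>

lemma resolution_comparison:
  fixes P :: "nat \<Rightarrow> ('a, nat \<Rightarrow> 'a) module"
  assumes xs: "set xs \<subseteq> carrier R" "distinct xs" and I: "I = Idl (set xs)"
    and res: "projective_resolution R (quotient_module (regular_module R) I) P \<delta> e"
  obtains \<beta>0 \<beta>1 a where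
    "\<beta>0 \<in> mod_hom R (P 0) (regular_module R)"
    "\<And>i. i < length xs \<Longrightarrow> \<beta>1 i \<in> mod_hom R (P 1) (regular_module R)"
    "\<And>q. q \<in> carrier (P 1) \<Longrightarrow> \<beta>0 (\<delta> 0 q) = dot R (length xs) ((!) xs) (\<lambda>i. \<beta>1 i q)"
    "a \<in> carrier (P 0)" "\<And>z. z \<in> I \<Longrightarrow> z \<odot>\<^bsub>P 0\<^esub> a \<in> \<delta> 0 ` carrier (P 1)"
    "\<one> \<ominus> \<beta>0 a \<in> I"
proof -
  let ?n = "length xs"
  let ?Q = "quotient_module (regular_module R) I"
  have Iid: "ideal I R" unfolding I by (rule genideal_ideal[OF xs(1)])
  interpret I: ideal I R by (rule Iid)
  interpret Q: module R ?Q by (rule quotient_regular_module[OF Iid])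
  note Q = quotient_regular_simps[OF Iid]
  have P0: "projective_module R (P 0)" and P1: "projective_module R (P 1)"
    and \<delta>: "\<delta> 0 \<in> mod_hom R (P 1) (P 0)" and e: "e \<in> mod_hom R (P 0) ?Q"
    and surj: "e ` carrier (P 0) = carrier ?Q"
    and exact: "\<delta> 0 ` carrier (P 1) = {p \<in> carrier (P 0). e p = I}"
    using res by (auto simp: projective_resolution_def a_kernel_def' Q(2))
  interpret P0: module R "P 0" using P0 by (simp add: projective_module_def)
  have coset_eq: "x \<in> I" if "I +> x = I" "x \<in> carrier R" for x
    using I.rcos_const_imp_mem[OF that(2,1)] .
  have coset_self: "x \<in> I +> x" if "x \<in> carrier R" for x
    using that I.zero_closed unfolding a_r_coset_def' by (intro UN_I[of \<zero>]) auto
  have coset_cong: "I +> x = I +> y" if xy: "x \<in> I +> y" "x \<in> carrier R" "y \<in> carrier R" for x y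
  proof -
    obtain i where i: "i \<in> I" "x = i \<oplus> y" using xy(1) by (auto simp: a_r_coset_def')
    have "x \<ominus> y = i" using i xy I.Icarr by (simp add: minus_eq a_assoc r_neg)
    then show ?thesis using i(1) quotient_eq_iff_same_a_r_cos[OF Iid xy(2,3)] by simp
  qed
  \<comment> \<open>Distinct cosets are disjoint, so a coset can be encoded by a chosen
    representative, stored as a constant function.\<close>
  have inj: "inj_on (\<lambda>A (_::nat). SOME x. x \<in> A) (carrier ?Q)"
  proof (rule inj_onI)
    fix A B assume AB: "A \<in> carrier ?Q" "B \<in> carrier ?Q"
      and eq: "(\<lambda>_::nat. SOME x. x \<in> A) = (\<lambda>_. SOME x. x \<in> B)"
    obtain a b where ab: "a \<in> carrier R" "A = I +> a" "b \<in> carrier R" "B = I +> b"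
      using AB by (auto simp: Q)
    define x where "x = (SOME x. x \<in> A)"
    have x': "x = (SOME x. x \<in> B)" using fun_cong[OF eq] by (simp only: x_def)
    have "x \<in> A" unfolding x_def ab(2) using coset_self[OF ab(1)] by (rule someI)
    moreover have "x \<in> B" unfolding x' ab(4) using coset_self[OF ab(3)] by (rule someI)
    moreover have "x \<in> carrier R"
      using \<open>x \<in> A\<close> ab(1) I.Icarr unfolding ab(2) by (auto simp: a_r_coset_def')
    ultimately show "A = B" using coset_cong ab by metis
  qed
  have one: "I +> \<one> \<in> carrier ?Q" by (auto simp: Q)
  \<comment> \<open>The quotient is generated by the single coset of \<open>\<one>\<close>.\<close>
  have "\<exists>c. (\<forall>k\<in>{0::nat}. c k \<in> mod_hom R (P 0) (regular_module R)) \<and>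
      (\<forall>p\<in>carrier (P 0). e p = (\<Oplus>\<^bsub>?Q\<^esub>k\<in>{0}. c k p \<odot>\<^bsub>?Q\<^esub> (I +> \<one>)))"
  proof (rule projective_coordinates[OF P0 Q.module_axioms inj _ _ _ _ e])
    fix x assume "x \<in> carrier ?Q"
    then obtain b where b: "b \<in> carrier R" "x = I +> b" by (auto simp: Q)
    have "b \<odot>\<^bsub>?Q\<^esub> (I +> \<one>) = x" using b by (simp add: Q)
    moreover have "(\<Oplus>\<^bsub>?Q\<^esub>k\<in>{0::nat}. b \<odot>\<^bsub>?Q\<^esub> (I +> \<one>)) = b \<odot>\<^bsub>?Q\<^esub> (I +> \<one>)"
      using b one by simp
    ultimately show "\<exists>a. (\<forall>k\<in>{0::nat}. a k \<in> carrier R) \<and> x = (\<Oplus>\<^bsub>?Q\<^esub>k\<in>{0}. a k \<odot>\<^bsub>?Q\<^esub> (I +> \<one>))"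
      using b by (intro exI[of _ "\<lambda>_. b"]) auto
  qed (use one in auto)
  then obtain c where c: "c (0::nat) \<in> mod_hom R (P 0) (regular_module R)"
    "\<And>p. p \<in> carrier (P 0) \<Longrightarrow> e p = (\<Oplus>\<^bsub>?Q\<^esub>k\<in>{0}. c k p \<odot>\<^bsub>?Q\<^esub> (I +> \<one>))"
    by blast
  define \<beta>0 where "\<beta>0 = c 0"
  have \<beta>0: "\<beta>0 \<in> mod_hom R (P 0) (regular_module R)" using c(1) by (simp add: \<beta>0_def)
  have e_eq: "e p = I +> \<beta>0 p" if p: "p \<in> carrier (P 0)" for p
  proof -
    have b: "\<beta>0 p \<in> carrier R" using functional_closed[OF \<beta>0 p] .
    have "e p = \<beta>0 p \<odot>\<^bsub>?Q\<^esub> (I +> \<one>)"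
      using c(2)[OF p] b one by (simp add: \<beta>0_def)
    then show ?thesis using b by (simp add: Q)
  qed
  obtain a where a: "a \<in> carrier (P 0)" "e a = I +> \<one>"
    using surj one by (metis (no_types, lifting) imageE)
  have u: "\<one> \<ominus> \<beta>0 a \<in> I"
    using quotient_eq_iff_same_a_r_cos[OF Iid, of \<one> "\<beta>0 a"] a e_eq functional_closed[OF \<beta>0 a(1)] by simp
  have za: "z \<odot>\<^bsub>P 0\<^esub> a \<in> \<delta> 0 ` carrier (P 1)" if z: "z \<in> I" for z
  proof -
    have zc: "z \<in> carrier R" using z by (rule I.Icarr)
    have "e (z \<odot>\<^bsub>P 0\<^esub> a) = z \<odot>\<^bsub>?Q\<^esub> (I +> \<one>)"
      using e a zc by (auto simp: mod_hom_def)
    also have "\<dots> = I" using zc a_rcos_zero[OF Iid z] by (simp add: Q)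
    finally show ?thesis unfolding exact using zc a by auto
  qed
  have "\<exists>c. (\<forall>k\<in>{..<?n}. c k \<in> mod_hom R (P 1) (regular_module R)) \<and>
      (\<forall>p\<in>carrier (P 1). \<beta>0 (\<delta> 0 p) = (\<Oplus>\<^bsub>ideal_module R I\<^esub>k\<in>{..<?n}. c k p \<odot>\<^bsub>ideal_module R I\<^esub> (xs ! k)))"
  proof (rule projective_coordinates[OF P1 ideal_module_module[OF Iid], of "\<lambda>x _. x"])
    show "inj_on (\<lambda>x (_::nat). x) (carrier (ideal_module R I))"
      by (auto simp: inj_on_def dest: fun_cong)
    show "inj_on ((!) xs) {..<?n}" using xs(2) by (auto simp: inj_on_def nth_eq_iff_index_eq)
    show "xs ! k \<in> carrier (ideal_module R I)" if "k \<in> {..<?n}" for k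
      using genideal_self[OF xs(1)] that by (auto simp: ideal_module_def I)
    show "(\<lambda>p. \<beta>0 (\<delta> 0 p)) \<in> mod_hom R (P 1) (ideal_module R I)"
    proof -
      have "\<beta>0 (\<delta> 0 p) \<in> I" if p: "p \<in> carrier (P 1)" for p
      proof -
        have "\<delta> 0 p \<in> carrier (P 0)" "e (\<delta> 0 p) = I" using p exact by auto
        then show ?thesis using e_eq coset_eq functional_closed[OF \<beta>0] by metis
      qed
      then show ?thesis using mod_hom_compose[OF \<delta> \<beta>0]
        by (auto simp: mod_hom_def ideal_module_def regular_module_def)
    qed
    fix x assume "x \<in> carrier (ideal_module R I)"
    then obtain v where v: "v \<in> carrier (free_module R {..<?n})" "x = dot R ?n ((!) xs) v"
      unfolding ideal_module_def I genideal_eq_dot[OF xs(1)] by auto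
    have vc: "v k \<in> carrier R" for k using v by (simp add: free_module_def)
    have "xs ! k \<in> I" if "k < ?n" for k using genideal_self[OF xs(1)] that by (auto simp: I)
    then have "x = (\<Oplus>\<^bsub>ideal_module R I\<^esub>k\<in>{..<?n}. v k \<odot>\<^bsub>ideal_module R I\<^esub> (xs ! k))"
      unfolding v(2) using vc by (intro ideal_module_lincomb[OF Iid, symmetric]) auto
    then show "\<exists>a. (\<forall>k\<in>{..<?n}. a k \<in> carrier R) \<and>
        x = (\<Oplus>\<^bsub>ideal_module R I\<^esub>k\<in>{..<?n}. a k \<odot>\<^bsub>ideal_module R I\<^esub> (xs ! k))"
      by (intro exI[of _ v] conjI ballI vc)
  qed auto
  then obtain \<beta>1 where \<beta>1: "\<And>k. k < ?n \<Longrightarrow> \<beta>1 k \<in> mod_hom R (P 1) (regular_module R)"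
    "\<And>p. p \<in> carrier (P 1) \<Longrightarrow>
      \<beta>0 (\<delta> 0 p) = (\<Oplus>\<^bsub>ideal_module R I\<^esub>k\<in>{..<?n}. \<beta>1 k p \<odot>\<^bsub>ideal_module R I\<^esub> (xs ! k))"
    by auto
  have "\<beta>0 (\<delta> 0 p) = dot R ?n ((!) xs) (\<lambda>i. \<beta>1 i p)" if p: "p \<in> carrier (P 1)" for p
  proof -
    have "xs ! k \<in> I" if "k < ?n" for k using genideal_self[OF xs(1)] that by (auto simp: I)
    then show ?thesis
      unfolding \<beta>1(2)[OF p] using functional_closed[OF \<beta>1(1) p]
      by (intro ideal_module_lincomb[OF Iid]) auto
  qed
  then show thesis using that[OF \<beta>0 \<beta>1(1) _ a(1) za u] by simp
qed

end

section \<open>Finite generation over Noetherian rings\<close>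

text \<open>Finite families in an induction on the rank are merged by taking unions; closure under the
module operations is then easier to handle than sums over two overlapping families.\<close>

inductive_set lin_span :: "('a, 'b) ring_scheme \<Rightarrow> (nat \<Rightarrow> 'a) set \<Rightarrow> (nat \<Rightarrow> 'a) set"
  for R (structure) and S where
  zero: "(\<lambda>i. \<zero>) \<in> lin_span R S"
| base: "s \<in> S \<Longrightarrow> s \<in> lin_span R S"
| add: "v \<in> lin_span R S \<Longrightarrow> w \<in> lin_span R S \<Longrightarrow> (\<lambda>i. v i \<oplus> w i) \<in> lin_span R S"
| smult: "r \<in> carrier R \<Longrightarrow> v \<in> lin_span R S \<Longrightarrow> (\<lambda>i. r \<otimes> v i) \<in> lin_span R S"

context cring
begin

lemma lin_span_mono: "z \<in> lin_span R S \<Longrightarrow> S \<subseteq> T \<Longrightarrow> z \<in> lin_span R T"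
  by (induction rule: lin_span.induct) (auto intro: lin_span.intros)

lemma lin_span_coefficients:
  assumes "z \<in> lin_span R S" and S: "finite S" "\<And>s i. s \<in> S \<Longrightarrow> s i \<in> carrier R"
  shows "\<exists>a. (\<forall>s\<in>S. a s \<in> carrier R) \<and> (\<forall>i. z i = (\<Oplus>s\<in>S. a s \<otimes> s i))"
  using assms(1)
proof (induction rule: lin_span.induct)
  case zero
  have "(\<Oplus>s\<in>S. \<zero> \<otimes> s i) = \<zero>" for i using S by (intro add.finprod_one_eqI) auto
  then show ?case by (intro exI[of _ "\<lambda>_. \<zero>"]) auto
next
  case (base t)
  have "(\<Oplus>s\<in>S. (if s = t then \<one> else \<zero>) \<otimes> s i) = t i" for i
  proof -
    have "(\<Oplus>s\<in>S. (if s = t then \<one> else \<zero>) \<otimes> s i) = (\<Oplus>s\<in>S. if s = t then t i else \<zero>)"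
      using S base by (intro finsum_cong') auto
    then show ?thesis using S base by (simp add: finsum_delta)
  qed
  then show ?case by (intro exI[of _ "\<lambda>s. if s = t then \<one> else \<zero>"]) auto
next
  case (add v w)
  then obtain a b where a: "\<forall>s\<in>S. a s \<in> carrier R" "\<forall>i. v i = (\<Oplus>s\<in>S. a s \<otimes> s i)"
    and b: "\<forall>s\<in>S. b s \<in> carrier R" "\<forall>i. w i = (\<Oplus>s\<in>S. b s \<otimes> s i)" by blast
  have "v i \<oplus> w i = (\<Oplus>s\<in>S. (a s \<oplus> b s) \<otimes> s i)" for i
  proof -
    have "v i \<oplus> w i = (\<Oplus>s\<in>S. a s \<otimes> s i \<oplus> b s \<otimes> s i)"
      unfolding a(2)[rule_format] b(2)[rule_format] using a(1) b(1) S
      by (intro finsum_addf[symmetric]) auto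
    also have "\<dots> = (\<Oplus>s\<in>S. (a s \<oplus> b s) \<otimes> s i)"
      using a(1) b(1) S by (intro finsum_cong') (auto simp: l_distr)
    finally show ?thesis .
  qed
  then show ?case using a(1) b(1) by (intro exI[of _ "\<lambda>s. a s \<oplus> b s"]) auto
next
  case (smult r v)
  then obtain a where a: "\<forall>s\<in>S. a s \<in> carrier R" "\<forall>i. v i = (\<Oplus>s\<in>S. a s \<otimes> s i)" by blast
  have "r \<otimes> v i = (\<Oplus>s\<in>S. (r \<otimes> a s) \<otimes> s i)" for i
  proof -
    have "r \<otimes> v i = (\<Oplus>s\<in>S. r \<otimes> (a s \<otimes> s i))"
      unfolding a(2)[rule_format] using a(1) S smult(1) by (intro finsum_rdistr) auto
    also have "\<dots> = (\<Oplus>s\<in>S. (r \<otimes> a s) \<otimes> s i)"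
      using a(1) S smult(1) by (intro finsum_cong') (auto simp: m_assoc)
    finally show ?thesis .
  qed
  then show ?case using a(1) smult(1) by (intro exI[of _ "\<lambda>s. r \<otimes> a s"]) auto
qed

lemma lin_span_lincomb:
  assumes "finite A" "\<And>k. k \<in> A \<Longrightarrow> c k \<in> carrier R" "\<And>k. k \<in> A \<Longrightarrow> z k \<in> lin_span R S"
    and "\<And>k i. k \<in> A \<Longrightarrow> z k i \<in> carrier R"
  shows "(\<lambda>i. \<Oplus>k\<in>A. c k \<otimes> z k i) \<in> lin_span R S"
  using assms
proof (induction A rule: finite_induct)
  case empty
  then show ?case by (simp add: lin_span.zero)
next
  case (insert a A)
  have "(\<lambda>i. \<Oplus>k\<in>insert a A. c k \<otimes> z k i) = (\<lambda>i. c a \<otimes> z a i \<oplus> (\<Oplus>k\<in>A. c k \<otimes> z k i))"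
    using insert by (intro ext) (subst finsum_insert, auto)
  also have "\<dots> \<in> lin_span R S"
    using insert by (intro lin_span.add lin_span.smult) auto
  finally show ?case .
qed

text \<open>Induction on the rank: the last coordinates of the elements of \<open>M\<close> form an ideal, and after
subtracting a combination of lifts of its generators the last coordinate vanishes.\<close>

lemma noetherian_submodule_finitely_spanned:
  assumes "noetherian_ring R" and M: "M \<subseteq> carrier (free_module R {..<n})" "(\<lambda>i. \<zero>) \<in> M"
    and add: "\<And>v w. v \<in> M \<Longrightarrow> w \<in> M \<Longrightarrow> (\<lambda>i. v i \<oplus> w i) \<in> M"
    and smult: "\<And>r v. r \<in> carrier R \<Longrightarrow> v \<in> M \<Longrightarrow> (\<lambda>i. r \<otimes> v i) \<in> M"
  shows "\<exists>S. finite S \<and> S \<subseteq> M \<and> M \<subseteq> lin_span R S"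
  using M add smult
proof (induction n arbitrary: M)
  case 0
  have "M \<subseteq> lin_span R {}"
  proof
    fix z assume "z \<in> M"
    then have "z = (\<lambda>i. \<zero>)" using 0(1) by (auto simp: free_module_def)
    then show "z \<in> lin_span R {}" by (simp add: lin_span.zero)
  qed
  then show ?case by (intro exI[of _ "{}"]) auto
next
  case (Suc n)
  interpret N: noetherian_ring R by fact
  have Mc: "v i \<in> carrier R" if "v \<in> M" for v i
    using Suc.prems(1) that by (auto simp: free_module_def)
  define J where "J = (\<lambda>v. v n) ` M"
  have J_intro: "a \<in> J" if "v \<in> M" "a = v n" for a v
    using that by (auto simp: J_def)
  have J_neg: "(\<lambda>i. \<ominus> \<one> \<otimes> v i) \<in> M" if "v \<in> M" for v
    using Suc.prems(4) that by blast
  have "ideal J R"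
  proof (rule idealI)
    show "ring R" by (rule ring_axioms)
    show "subgroup J (add_monoid R)"
    proof (rule add.subgroupI)
      show "J \<subseteq> carrier R" using Mc by (auto simp: J_def)
      show "J \<noteq> {}" using Suc.prems(2) by (auto simp: J_def)
      show "\<ominus> a \<in> J" if "a \<in> J" for a
      proof -
        obtain v where v: "v \<in> M" "a = v n" using \<open>a \<in> J\<close> by (auto simp: J_def)
        show ?thesis using v Mc by (intro J_intro[OF J_neg[OF v(1)]]) (simp add: l_minus)
      qed
      show "a \<oplus> b \<in> J" if "a \<in> J" "b \<in> J" for a b
      proof -
        obtain v w where vw: "v \<in> M" "a = v n" "w \<in> M" "b = w n"
          using \<open>a \<in> J\<close> \<open>b \<in> J\<close> by (auto simp: J_def)
        show ?thesis using vw by (intro J_intro[OF Suc.prems(3)[OF vw(1,3)]]) simp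
      qed
    qed
    have l: "r \<otimes> a \<in> J" if "a \<in> J" "r \<in> carrier R" for a r
    proof -
      obtain v where v: "v \<in> M" "a = v n" using \<open>a \<in> J\<close> by (auto simp: J_def)
      show ?thesis using v by (intro J_intro[OF Suc.prems(4)[OF \<open>r \<in> carrier R\<close> v(1)]]) simp
    qed
    show "r \<otimes> a \<in> J" if "a \<in> J" "r \<in> carrier R" for a r using l that .
    show "a \<otimes> r \<in> J" if "a \<in> J" "r \<in> carrier R" for a r
      using l[OF that] that Mc m_comm[of a r] by (auto simp: J_def)
  qed
  then obtain A where A: "A \<subseteq> carrier R" "finite A" "J = Idl A" using N.finetely_gen by blast
  obtain ys where ys: "set ys = A" using finite_list[OF A(2)] by blast
  have ysc: "set ys \<subseteq> carrier R" using A ys by simp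
  have "\<exists>v\<in>M. v n = ys ! k" if "k < length ys" for k
  proof -
    have "ys ! k \<in> J" using genideal_self[OF A(1)] A(3) ys that by auto
    then show ?thesis by (auto simp: J_def)
  qed
  then obtain \<zeta> where \<zeta>: "\<And>k. k < length ys \<Longrightarrow> \<zeta> k \<in> M" "\<And>k. k < length ys \<Longrightarrow> \<zeta> k n = ys ! k"
    by metis
  define M0 where "M0 = {v \<in> M. v n = \<zero>}"
  have "\<exists>S. finite S \<and> S \<subseteq> M0 \<and> M0 \<subseteq> lin_span R S"
  proof (rule Suc.IH)
    have "v i = \<zero>" if "v \<in> M0" "\<not> i < n" for v i
      using that Suc.prems(1) by (cases "i = n") (auto simp: M0_def free_module_def)
    then show "M0 \<subseteq> carrier (free_module R {..<n})"
      using Mc by (auto simp: M0_def free_module_def)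
  qed (use Suc.prems Mc in \<open>auto simp: M0_def\<close>)
  then obtain S where S: "finite S" "S \<subseteq> M0" "M0 \<subseteq> lin_span R S" by blast
  let ?T = "S \<union> \<zeta> ` {..<length ys}"
  have "M \<subseteq> lin_span R ?T"
  proof
    fix z assume z: "z \<in> M"
    have "z n \<in> Idl (set ys)" using z A(3) ys by (auto simp: J_def)
    then obtain v where v: "\<And>k. v k \<in> carrier R" "z n = dot R (length ys) ((!) ys) v"
      unfolding genideal_eq_dot[OF ysc] by (auto simp: free_module_def)
    define y where "y = (\<lambda>i. \<Oplus>k\<in>{..<length ys}. v k \<otimes> \<zeta> k i)"
    have y_span: "y \<in> lin_span R ?T"
      unfolding y_def using v \<zeta> Mc by (intro lin_span_lincomb lin_span.base) auto
    have yM: "(\<lambda>i. \<Oplus>k\<in>B. v k \<otimes> \<zeta> k i) \<in> M" if "finite B" "B \<subseteq> {..<length ys}" for B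
      using that
    proof (induction B rule: finite_induct)
      case empty
      then show ?case using Suc.prems(2) by simp
    next
      case (insert b B)
      have "(\<lambda>i. \<Oplus>k\<in>insert b B. v k \<otimes> \<zeta> k i) = (\<lambda>i. v b \<otimes> \<zeta> b i \<oplus> (\<Oplus>k\<in>B. v k \<otimes> \<zeta> k i))"
        using insert v \<zeta> Mc by (intro ext) (subst finsum_insert, auto)
      also have "\<dots> \<in> M"
        using insert \<zeta>(1)[of b] v(1) by (intro Suc.prems(3,4)) auto
      finally show ?case .
    qed
    have y: "y \<in> M" unfolding y_def by (intro yM) auto
    have "y n = z n"
      unfolding y_def v(2) dot_def using v(1) \<zeta>(2) ysc
      by (intro finsum_cong') (auto simp: m_comm subset_iff)
    then have "(\<lambda>i. z i \<oplus> \<ominus> \<one> \<otimes> y i) \<in> M0"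
      using Suc.prems(3)[OF z J_neg[OF y]] Mc[OF z] by (simp add: M0_def l_minus r_neg)
    then have "(\<lambda>i. z i \<oplus> \<ominus> \<one> \<otimes> y i) \<in> lin_span R ?T"
      using S(3) lin_span_mono[of _ S ?T] by blast
    then have "(\<lambda>i. (z i \<oplus> \<ominus> \<one> \<otimes> y i) \<oplus> y i) \<in> lin_span R ?T"
      using y_span by (rule lin_span.add)
    moreover have "(\<lambda>i. (z i \<oplus> \<ominus> \<one> \<otimes> y i) \<oplus> y i) = z"
      using Mc[OF z] Mc[OF y] by (auto simp: a_assoc l_minus l_neg)
    ultimately show "z \<in> lin_span R ?T" by simp
  qed
  moreover have "?T \<subseteq> M" using S(2) \<zeta>(1) by (auto simp: M0_def)
  ultimately show ?case using S(1) by (intro exI[of _ ?T]) auto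
qed

lemma dual_basis_of_finite:
  assumes M: "module R M" and A: "finite A" and f: "\<And>k. k \<in> A \<Longrightarrow> f k \<in> carrier M"
    and \<psi>: "\<And>k. k \<in> A \<Longrightarrow> \<psi> k \<in> mod_hom R M (regular_module R)"
    and exp: "\<And>z. z \<in> carrier M \<Longrightarrow> z = (\<Oplus>\<^bsub>M\<^esub>k\<in>A. \<psi> k z \<odot>\<^bsub>M\<^esub> f k)"
  shows "\<exists>m f \<psi>. dual_basis R M m f \<psi>"
proof -
  interpret M: module R M by fact
  obtain b where b: "bij_betw b {..<card A} A"
    using ex_bij_betw_nat_finite[OF A] by (auto simp: atLeast0LessThan)
  have bA: "b j \<in> A" if "j < card A" for j using b that by (auto simp: bij_betw_def)
  have "z = (\<Oplus>\<^bsub>M\<^esub>j\<in>{..<card A}. \<psi> (b j) z \<odot>\<^bsub>M\<^esub> f (b j))" if z: "z \<in> carrier M" for z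
  proof -
    have "(\<Oplus>\<^bsub>M\<^esub>k\<in>b ` {..<card A}. \<psi> k z \<odot>\<^bsub>M\<^esub> f k) = (\<Oplus>\<^bsub>M\<^esub>j\<in>{..<card A}. \<psi> (b j) z \<odot>\<^bsub>M\<^esub> f (b j))"
      using b z f functional_closed[OF \<psi> z]
      by (intro M.finsum_reindex) (auto simp: bij_betw_def)
    then show ?thesis using exp[OF z] b by (simp add: bij_betw_def)
  qed
  then have "dual_basis R M (card A) (f \<circ> b) (\<psi> \<circ> b)"
    using f \<psi> bA by (simp add: dual_basis_def)
  then show ?thesis by blast
qed

section \<open>Dual bases from short resolutions\<close>

lemma mod_hom_injective:
  assumes M: "module R M" and N: "module R N" and f: "f \<in> mod_hom R M N"
    and ker: "\<And>x. x \<in> carrier M \<Longrightarrow> f x = \<zero>\<^bsub>N\<^esub> \<Longrightarrow> x = \<zero>\<^bsub>M\<^esub>"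
  shows "inj_on f (carrier M)"
proof (rule inj_onI)
  interpret M: module R M by fact
  interpret N: module R N by fact
  fix x y assume xy: "x \<in> carrier M" "y \<in> carrier M" "f x = f y"
  let ?y = "(\<ominus> \<one>) \<odot>\<^bsub>M\<^esub> y"
  have y: "?y \<in> carrier M" using xy by simp
  have "f (x \<oplus>\<^bsub>M\<^esub> ?y) = f x \<oplus>\<^bsub>N\<^esub> f ?y"
    using f xy(1) y by (simp add: mod_hom_def)
  also have "f ?y = (\<ominus> \<one>) \<odot>\<^bsub>N\<^esub> f y" using f xy(2) by (simp add: mod_hom_def)
  also have "\<dots> = \<ominus>\<^bsub>N\<^esub> f y"
    using mod_hom_closed[OF f xy(2)] by (simp add: N.smult_l_minus)
  also have "f x \<oplus>\<^bsub>N\<^esub> \<ominus>\<^bsub>N\<^esub> f y = \<zero>\<^bsub>N\<^esub>"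
    using mod_hom_closed[OF f xy(2)] xy(3) by (simp add: N.r_neg)
  finally have "x \<oplus>\<^bsub>M\<^esub> ?y = \<zero>\<^bsub>M\<^esub>" using ker xy y by simp
  then have "x \<oplus>\<^bsub>M\<^esub> \<ominus>\<^bsub>M\<^esub> y = \<zero>\<^bsub>M\<^esub>" using xy by (simp add: M.smult_l_minus)
  then show "x = y" using xy by (metis M.add.inv_closed M.add.inv_equality M.minus_minus)
qed

lemma mod_hom_lift_injective:
  assumes M: "module R M" and P: "module R P" and N: "module R N"
    and \<delta>: "\<delta> \<in> mod_hom R P N" "inj_on \<delta> (carrier P)"
    and \<alpha>: "\<alpha> \<in> mod_hom R M N" "\<And>z. z \<in> carrier M \<Longrightarrow> \<alpha> z \<in> \<delta> ` carrier P"
  shows "\<exists>\<gamma>\<in>mod_hom R M P. \<forall>z\<in>carrier M. \<delta> (\<gamma> z) = \<alpha> z"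
proof -
  interpret M: module R M by fact
  interpret P: module R P by fact
  have "\<exists>p. p \<in> carrier P \<and> \<delta> p = \<alpha> z" if "z \<in> carrier M" for z using \<alpha>(2)[OF that] by auto
  then obtain \<gamma> where \<gamma>: "\<And>z. z \<in> carrier M \<Longrightarrow> \<gamma> z \<in> carrier P" "\<And>z. z \<in> carrier M \<Longrightarrow> \<delta> (\<gamma> z) = \<alpha> z"
    by metis
  have "\<gamma> (x \<oplus>\<^bsub>M\<^esub> y) = \<gamma> x \<oplus>\<^bsub>P\<^esub> \<gamma> y" if xy: "x \<in> carrier M" "y \<in> carrier M" for x y
  proof (rule inj_onD[OF \<delta>(2)])
    have "\<delta> (\<gamma> (x \<oplus>\<^bsub>M\<^esub> y)) = \<alpha> x \<oplus>\<^bsub>N\<^esub> \<alpha> y"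
      using \<gamma>(2)[of "x \<oplus>\<^bsub>M\<^esub> y"] \<alpha>(1) xy by (simp add: mod_hom_def)
    also have "\<dots> = \<delta> (\<gamma> x \<oplus>\<^bsub>P\<^esub> \<gamma> y)"
      using \<delta>(1) \<gamma> xy by (simp add: mod_hom_def)
    finally show "\<delta> (\<gamma> (x \<oplus>\<^bsub>M\<^esub> y)) = \<delta> (\<gamma> x \<oplus>\<^bsub>P\<^esub> \<gamma> y)" .
  qed (use \<gamma> xy in auto)
  moreover have "\<gamma> (r \<odot>\<^bsub>M\<^esub> x) = r \<odot>\<^bsub>P\<^esub> \<gamma> x" if rx: "r \<in> carrier R" "x \<in> carrier M" for r x
  proof (rule inj_onD[OF \<delta>(2)])
    have "\<delta> (\<gamma> (r \<odot>\<^bsub>M\<^esub> x)) = r \<odot>\<^bsub>N\<^esub> \<alpha> x"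
      using \<gamma>(2)[of "r \<odot>\<^bsub>M\<^esub> x"] \<alpha>(1) rx by (simp add: mod_hom_def)
    also have "\<dots> = \<delta> (r \<odot>\<^bsub>P\<^esub> \<gamma> x)"
      using \<delta>(1) \<gamma> rx by (simp add: mod_hom_def)
    finally show "\<delta> (\<gamma> (r \<odot>\<^bsub>M\<^esub> x)) = \<delta> (r \<odot>\<^bsub>P\<^esub> \<gamma> x)" .
  qed (use \<gamma> rx in auto)
  ultimately have "\<gamma> \<in> mod_hom R M P" using \<gamma>(1) by (simp add: mod_hom_def)
  then show ?thesis using \<gamma>(2) by blast
qed

text \<open>The kernel of \<open>\<delta> 0\<close> is trivial, so \<open>z \<odot> a\<close> lifts to \<open>P 1\<close> linearly in \<open>z \<in> I\<close>.  Splitting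
\<open>z = z \<otimes> \<beta>0 a \<oplus> z \<otimes> (\<one> \<ominus> \<beta>0 a)\<close> and expressing the first summand through \<open>\<beta>1\<close> gives coefficients
for the generators \<open>x\<^sub>i\<close> and the additional element \<open>\<one> \<ominus> \<beta>0 a\<close> of \<open>I\<close>.\<close>

lemma ideal_dual_basis:
  fixes P :: "nat \<Rightarrow> ('a, nat \<Rightarrow> 'a) module"
  assumes xs: "set xs \<subseteq> carrier R" "distinct xs" and I: "I = Idl (set xs)"
    and res: "projective_resolution R (quotient_module (regular_module R) I) P \<delta> e"
    and zero: "zero_module (P 2)"
  shows "\<exists>m f \<psi>. dual_basis R (ideal_module R I) m f \<psi>"
proof -
  let ?n = "length xs"
  let ?I = "ideal_module R I"
  have Iid: "ideal I R" unfolding I by (rule genideal_ideal[OF xs(1)])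
  interpret I: ideal I R by (rule Iid)
  interpret M: module R ?I by (rule ideal_module_module[OF Iid])
  obtain \<beta>0 \<beta>1 a where \<beta>0: "\<beta>0 \<in> mod_hom R (P 0) (regular_module R)"
    and \<beta>1: "\<And>i. i < ?n \<Longrightarrow> \<beta>1 i \<in> mod_hom R (P 1) (regular_module R)"
    and \<beta>: "\<And>q. q \<in> carrier (P 1) \<Longrightarrow> \<beta>0 (\<delta> 0 q) = dot R ?n ((!) xs) (\<lambda>i. \<beta>1 i q)"
    and a: "a \<in> carrier (P 0)" "\<And>z. z \<in> I \<Longrightarrow> z \<odot>\<^bsub>P 0\<^esub> a \<in> \<delta> 0 ` carrier (P 1)"
    and u: "\<one> \<ominus> \<beta>0 a \<in> I"
    using resolution_comparison[OF xs I res] by metis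
  have mods: "module R (P i)" for i
    using res by (simp add: projective_resolution_def projective_module_def)
  interpret P0: module R "P 0" by (rule mods)
  interpret P1: module R "P 1" by (rule mods)
  interpret P2: module R "P 2" by (rule mods)
  have \<delta>: "\<delta> 0 \<in> mod_hom R (P 1) (P 0)" "\<delta> 1 \<in> mod_hom R (P 2) (P 1)"
    using res unfolding projective_resolution_def by (auto simp: numeral_2_eq_2)
  have "\<delta> 1 ` carrier (P 2) = a_kernel (P 1) (P 0) (\<delta> 0)"
    using res unfolding projective_resolution_def by (auto simp: numeral_2_eq_2)
  moreover have "\<delta> 1 ` carrier (P 2) = {\<zero>\<^bsub>P 1\<^esub>}"
    using zero mod_hom_zero[OF mods mods \<delta>(2)] by (simp add: zero_module_def)
  ultimately have inj: "inj_on (\<delta> 0) (carrier (P 1))"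
    by (intro mod_hom_injective[OF mods mods \<delta>(1)]) (auto simp: a_kernel_def')
  have "(\<lambda>z. z \<odot>\<^bsub>P 0\<^esub> a) \<in> mod_hom R ?I (P 0)"
    using a(1) I.Icarr
    by (auto simp: mod_hom_def ideal_module_def regular_module_def P0.smult_l_distr P0.smult_assoc1)
  then obtain \<gamma> where \<gamma>: "\<gamma> \<in> mod_hom R ?I (P 1)" "\<And>z. z \<in> I \<Longrightarrow> \<delta> 0 (\<gamma> z) = z \<odot>\<^bsub>P 0\<^esub> a"
    using mod_hom_lift_injective[OF M.module_axioms mods mods \<delta>(1) inj, of "\<lambda>z. z \<odot>\<^bsub>P 0\<^esub> a"] a(2)
    by (auto simp: ideal_module_def)
  \<comment> \<open>Index \<open>?n\<close> carries the additional generator \<open>\<one> \<ominus> \<beta>0 a\<close>, whose coefficient is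
    \<open>z\<close> itself.\<close>
  define f where "f k = (if k < ?n then xs ! k else \<one> \<ominus> \<beta>0 a)" for k
  define \<psi> where "\<psi> k z = (if k < ?n then \<beta>1 k (\<gamma> z) else z)" for k and z :: 'a
  have fI: "f k \<in> I" for k
    using u genideal_self[OF xs(1)] by (auto simp: f_def I)
  have \<psi>: "\<psi> k \<in> mod_hom R ?I (regular_module R)" for k
  proof (cases "k < ?n")
    case True
    then have "\<psi> k = (\<lambda>z. \<beta>1 k (\<gamma> z))" by (auto simp: \<psi>_def)
    then show ?thesis using mod_hom_compose[OF \<gamma>(1) \<beta>1[OF True]] by simp
  next
    case False
    then show ?thesis using I.Icarr
      by (auto simp: \<psi>_def mod_hom_def ideal_module_def regular_module_def)
  qed
  have \<psi>c: "\<psi> k z \<in> carrier R" if "z \<in> I" for k z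
    using functional_closed[OF \<psi>, of z] that by (simp add: ideal_module_def)
  have "z = (\<Oplus>\<^bsub>?I\<^esub>k\<in>{..<Suc ?n}. \<psi> k z \<odot>\<^bsub>?I\<^esub> f k)" if z: "z \<in> I" for z
  proof -
    have zc: "z \<in> carrier R" using z by (rule I.Icarr)
    have \<gamma>z: "\<gamma> z \<in> carrier (P 1)" using mod_hom_closed[OF \<gamma>(1), of z] z by (simp add: ideal_module_def)
    have \<beta>a: "\<beta>0 a \<in> carrier R" using functional_closed[OF \<beta>0 a(1)] .
    have "(\<Oplus>\<^bsub>?I\<^esub>k\<in>{..<Suc ?n}. \<psi> k z \<odot>\<^bsub>?I\<^esub> f k) = dot R (Suc ?n) f (\<lambda>k. \<psi> k z)"
      using fI \<psi>c[OF z] by (intro ideal_module_lincomb[OF Iid]) auto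
    also have "\<dots> = dot R ?n f (\<lambda>k. \<psi> k z) \<oplus> f ?n \<otimes> \<psi> ?n z"
      using fI I.Icarr \<psi>c[OF z] by (intro dot_Suc) auto
    also have "dot R ?n f (\<lambda>k. \<psi> k z) = dot R ?n ((!) xs) (\<lambda>i. \<beta>1 i (\<gamma> z))"
      using xs(1) functional_closed[OF \<beta>1 \<gamma>z] by (intro dot_cong) (auto simp: f_def \<psi>_def)
    also have "\<dots> = \<beta>0 (z \<odot>\<^bsub>P 0\<^esub> a)" using \<beta>[OF \<gamma>z] \<gamma>(2)[OF z] by simp
    also have "\<dots> = z \<otimes> \<beta>0 a" using functional_smult[OF \<beta>0 zc a(1)] .
    also have "f ?n \<otimes> \<psi> ?n z = z \<ominus> z \<otimes> \<beta>0 a"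
      using zc \<beta>a by (simp add: f_def \<psi>_def minus_eq m_comm[of _ z] r_distr r_minus)
    also have "z \<otimes> \<beta>0 a \<oplus> (z \<ominus> z \<otimes> \<beta>0 a) = z"
      using zc \<beta>a by (simp add: minus_eq a_lcomm[of "z \<otimes> \<beta>0 a"] r_neg)
    finally show ?thesis by simp
  qed
  then show ?thesis
    using fI \<psi> unfolding dual_basis_def
    by (intro exI[of _ "Suc ?n"] exI[of _ f] exI[of _ \<psi>]) (auto simp: ideal_module_def)
qed

lemma finsum_smult_rdistr:
  assumes M: "module R M" and "finite A" "\<And>k. k \<in> A \<Longrightarrow> c k \<in> carrier R" "x \<in> carrier M"
  shows "(\<Oplus>\<^bsub>M\<^esub>k\<in>A. c k \<odot>\<^bsub>M\<^esub> x) = (\<Oplus>k\<in>A. c k) \<odot>\<^bsub>M\<^esub> x"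
proof -
  interpret M: module R M by fact
  show ?thesis using assms(2-)
  proof (induction A rule: finite_induct)
    case (insert b A)
    have "(\<Oplus>\<^bsub>M\<^esub>k\<in>insert b A. c k \<odot>\<^bsub>M\<^esub> x) = c b \<odot>\<^bsub>M\<^esub> x \<oplus>\<^bsub>M\<^esub> (\<Oplus>k\<in>A. c k) \<odot>\<^bsub>M\<^esub> x"
      using insert by (subst M.finsum_insert) auto
    also have "\<dots> = (c b \<oplus> (\<Oplus>k\<in>A. c k)) \<odot>\<^bsub>M\<^esub> x"
      using insert by (intro M.smult_l_distr[symmetric] finsum_closed) auto
    also have "c b \<oplus> (\<Oplus>k\<in>A. c k) = (\<Oplus>k\<in>insert b A. c k)"
      using insert by (subst finsum_insert) auto
    finally show ?case .
  qed simp
qed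

lemma syzygy_lincomb:
  assumes xs: "set xs \<subseteq> carrier R" and "finite A" "\<And>k. k \<in> A \<Longrightarrow> c k \<in> carrier R"
    and s: "\<And>k. k \<in> A \<Longrightarrow> s k \<in> syzygies R xs"
  shows "(\<Oplus>\<^bsub>syzygy_module R xs\<^esub>k\<in>A. c k \<odot>\<^bsub>syzygy_module R xs\<^esub> s k) = (\<lambda>i. \<Oplus>k\<in>A. c k \<otimes> s k i)"
proof -
  let ?M = "syzygy_module R xs"
  interpret M: module R ?M by (rule syzygy_module_module[OF xs])
  have "c k \<odot>\<^bsub>?M\<^esub> s k \<in> syzygies R xs" if "k \<in> A" for k
    using M.smult_closed[of "c k" "s k"] assms that by (simp add: syzygy_module_def)
  then have "(\<Oplus>\<^bsub>?M\<^esub>k\<in>A. c k \<odot>\<^bsub>?M\<^esub> s k) = (\<lambda>i. \<Oplus>k\<in>A. (c k \<odot>\<^bsub>?M\<^esub> s k) i)"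
    using syzygy_module_module[OF xs] assms(2) unfolding syzygy_module_def
    by (intro finsum_free_submodule syzygies_subset) auto
  then show ?thesis by (simp add: syzygy_module_def free_module_def)
qed

text \<open>Schanuel's lemma in explicit form.  Let \<open>\<alpha>\<close> and \<open>\<beta>1\<close> be the comparison maps between \<open>R\<^sup>n\<close>
and \<open>P 1\<close>.  A homotopy corrects \<open>v - \<beta>1 (\<alpha> v)\<close> to a map \<open>t\<close> from \<open>R\<^sup>n\<close> into the syzygies, and the
correction vanishes on syzygies.  So a syzygy \<open>z\<close> is the sum of \<open>t z\<close>, which is a combination of
the values of \<open>t\<close> on the standard basis with the coordinates of \<open>z\<close> as coefficients, and
\<open>\<beta>1 (\<alpha> z)\<close>.  The latter factors through the projective module \<open>P 2\<close> because \<open>\<alpha> z\<close> lies in the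
kernel of \<open>\<delta> 0\<close> and \<open>\<delta> 1\<close> is injective.\<close>

lemma syzygies_dual_basis:
  fixes P :: "nat \<Rightarrow> ('a, nat \<Rightarrow> 'a) module"
  assumes noeth: "noetherian_ring R"
    and xs: "set xs \<subseteq> carrier R" "distinct xs" and I: "I = Idl (set xs)"
    and res: "projective_resolution R (quotient_module (regular_module R) I) P \<delta> e"
    and zero: "zero_module (P 3)"
  shows "\<exists>m f \<psi>. dual_basis R (syzygy_module R xs) m f \<psi>"
proof -
  let ?n = "length xs"
  let ?Z = "syzygy_module R xs"
  let ?V = "carrier (free_module R {..<?n})"
  let ?d = "dot R ?n ((!) xs)"
  have Iid: "ideal I R" unfolding I by (rule genideal_ideal[OF xs(1)])
  interpret I: ideal I R by (rule Iid)
  interpret Z: module R ?Z by (rule syzygy_module_module[OF xs(1)])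
  have xsc: "xs ! k \<in> carrier R" if "k < ?n" for k using xs(1) that by auto
  have Zc: "z i \<in> carrier R" if "z \<in> syzygies R xs" for z i
    using that by (simp add: syzygies_def free_module_def)
  have carrZ: "carrier ?Z = syzygies R xs" by (simp add: syzygy_module_def)
  obtain \<beta>0 \<beta>1 a where \<beta>0: "\<beta>0 \<in> mod_hom R (P 0) (regular_module R)"
    and \<beta>1: "\<And>i. i < ?n \<Longrightarrow> \<beta>1 i \<in> mod_hom R (P 1) (regular_module R)"
    and \<beta>: "\<And>q. q \<in> carrier (P 1) \<Longrightarrow> \<beta>0 (\<delta> 0 q) = ?d (\<lambda>i. \<beta>1 i q)"
    and a: "a \<in> carrier (P 0)" "\<And>z. z \<in> I \<Longrightarrow> z \<odot>\<^bsub>P 0\<^esub> a \<in> \<delta> 0 ` carrier (P 1)"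
    and u: "\<one> \<ominus> \<beta>0 a \<in> I"
    using resolution_comparison[OF xs I res] by metis
  have mods: "module R (P i)" for i
    using res by (simp add: projective_resolution_def projective_module_def)
  interpret P0: module R "P 0" by (rule mods)
  interpret P1: module R "P 1" by (rule mods)
  interpret P2: module R "P 2" by (rule mods)
  have proj2: "projective_module R (P 2)" using res by (simp add: projective_resolution_def)
  have \<delta>: "\<delta> 0 \<in> mod_hom R (P 1) (P 0)" "\<delta> 1 \<in> mod_hom R (P 2) (P 1)" "\<delta> 2 \<in> mod_hom R (P 3) (P 2)"
    using res unfolding projective_resolution_def by (auto simp: numeral_2_eq_2 numeral_3_eq_3)
  have exact: "\<delta> 1 ` carrier (P 2) = a_kernel (P 1) (P 0) (\<delta> 0)"
    "\<delta> 2 ` carrier (P 3) = a_kernel (P 2) (P 1) (\<delta> 1)"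
    using res unfolding projective_resolution_def by (auto simp: numeral_2_eq_2 numeral_3_eq_3)
  note One_nat_def [simp del]
  have "\<delta> 2 ` carrier (P 3) = {\<zero>\<^bsub>P 2\<^esub>}"
    using zero mod_hom_zero[OF mods mods \<delta>(3)] by (simp add: zero_module_def)
  with exact(2) have inj: "inj_on (\<delta> 1) (carrier (P 2))"
    by (intro mod_hom_injective[OF mods mods \<delta>(2)]) (auto simp: a_kernel_def')
  have \<beta>a: "\<beta>0 a \<in> carrier R" using functional_closed[OF \<beta>0 a(1)] .
  have "\<exists>q. q \<in> carrier (P 1) \<and> \<delta> 0 q = (xs ! k) \<odot>\<^bsub>P 0\<^esub> a" if "k < ?n" for k
  proof -
    have "xs ! k \<in> I" using genideal_self[OF xs(1)] that by (auto simp: I)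
    from a(2)[OF this] show ?thesis by auto
  qed
  then obtain p where p: "\<And>k. k < ?n \<Longrightarrow> p k \<in> carrier (P 1)"
    "\<And>k. k < ?n \<Longrightarrow> \<delta> 0 (p k) = (xs ! k) \<odot>\<^bsub>P 0\<^esub> a"
    by metis
  obtain g where g: "g \<in> ?V" "\<one> \<ominus> \<beta>0 a = ?d g"
    using u unfolding I genideal_eq_dot[OF xs(1)] by auto
  have gc: "g i \<in> carrier R" for i using g(1) by (simp add: free_module_def)
  define \<alpha> where "\<alpha> z = (\<Oplus>\<^bsub>P 1\<^esub>k\<in>{..<?n}. z k \<odot>\<^bsub>P 1\<^esub> p k)" for z
  have \<alpha>c: "\<alpha> z \<in> carrier (P 1)" if "z \<in> syzygies R xs" for z
    unfolding \<alpha>_def using Zc[OF that] p(1) by (intro P1.finsum_closed) auto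
  have \<alpha>_hom: "\<alpha> \<in> mod_hom R ?Z (P 1)"
  proof -
    have "\<alpha> (\<lambda>i. z i \<oplus> w i) = \<alpha> z \<oplus>\<^bsub>P 1\<^esub> \<alpha> w" if "z \<in> syzygies R xs" "w \<in> syzygies R xs" for z w
    proof -
      have "\<alpha> (\<lambda>i. z i \<oplus> w i) = (\<Oplus>\<^bsub>P 1\<^esub>k\<in>{..<?n}. z k \<odot>\<^bsub>P 1\<^esub> p k \<oplus>\<^bsub>P 1\<^esub> w k \<odot>\<^bsub>P 1\<^esub> p k)"
        unfolding \<alpha>_def using Zc[OF that(1)] Zc[OF that(2)] p(1)
        by (intro P1.finsum_cong') (auto simp: P1.smult_l_distr)
      also have "\<dots> = \<alpha> z \<oplus>\<^bsub>P 1\<^esub> \<alpha> w"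
        unfolding \<alpha>_def using Zc[OF that(1)] Zc[OF that(2)] p(1) by (intro P1.finsum_addf) auto
      finally show ?thesis .
    qed
    moreover have "\<alpha> (\<lambda>i. r \<otimes> z i) = r \<odot>\<^bsub>P 1\<^esub> \<alpha> z" if "r \<in> carrier R" "z \<in> syzygies R xs" for r z
    proof -
      have "\<alpha> (\<lambda>i. r \<otimes> z i) = (\<Oplus>\<^bsub>P 1\<^esub>k\<in>{..<?n}. r \<odot>\<^bsub>P 1\<^esub> (z k \<odot>\<^bsub>P 1\<^esub> p k))"
        unfolding \<alpha>_def using that(1) Zc[OF that(2)] p(1)
        by (intro P1.finsum_cong') (auto simp: P1.smult_assoc1)
      also have "\<dots> = r \<odot>\<^bsub>P 1\<^esub> \<alpha> z"
        unfolding \<alpha>_def using that(1) Zc[OF that(2)] p(1)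
        by (intro P1.finsum_smult_ldistr[symmetric]) auto
      finally show ?thesis .
    qed
    ultimately show ?thesis
      using \<alpha>c by (simp add: mod_hom_def syzygy_module_def free_module_def)
  qed
  have "\<alpha> z \<in> \<delta> 1 ` carrier (P 2)" if z: "z \<in> syzygies R xs" for z
  proof -
    have "\<delta> 0 (\<alpha> z) = (\<Oplus>\<^bsub>P 0\<^esub>k\<in>{..<?n}. z k \<odot>\<^bsub>P 0\<^esub> \<delta> 0 (p k))"
      unfolding \<alpha>_def using Zc[OF z] p(1) by (intro mod_hom_lincomb[OF mods mods \<delta>(1)]) auto
    also have "\<dots> = (\<Oplus>\<^bsub>P 0\<^esub>k\<in>{..<?n}. (xs ! k \<otimes> z k) \<odot>\<^bsub>P 0\<^esub> a)"
    proof (intro P0.finsum_cong')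
      fix k assume k: "k \<in> {..<?n}"
      then have "z k \<odot>\<^bsub>P 0\<^esub> ((xs ! k) \<odot>\<^bsub>P 0\<^esub> a) = (z k \<otimes> xs ! k) \<odot>\<^bsub>P 0\<^esub> a"
        using Zc[OF z] xsc a(1) by (intro P0.smult_assoc1[symmetric]) auto
      then show "z k \<odot>\<^bsub>P 0\<^esub> \<delta> 0 (p k) = (xs ! k \<otimes> z k) \<odot>\<^bsub>P 0\<^esub> a"
        using k p(2) m_comm[OF Zc[OF z] xsc, of k k] by simp
    qed (use Zc[OF z] xsc a(1) in auto)
    also have "\<dots> = ?d z \<odot>\<^bsub>P 0\<^esub> a"
      unfolding dot_def using Zc[OF z] xsc a(1) by (intro finsum_smult_rdistr[OF mods]) auto
    also have "\<dots> = \<zero>\<^bsub>P 0\<^esub>" using z a(1) by (simp add: syzygies_def)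
    finally show ?thesis unfolding exact(1) a_kernel_def' using \<alpha>c[OF z] by simp
  qed
  then obtain \<gamma> where \<gamma>: "\<gamma> \<in> mod_hom R ?Z (P 2)" "\<And>z. z \<in> syzygies R xs \<Longrightarrow> \<delta> 1 (\<gamma> z) = \<alpha> z"
    using mod_hom_lift_injective[OF Z.module_axioms mods mods \<delta>(2) inj \<alpha>_hom] carrZ by metis
  define \<phi> where "\<phi> q i = (if i < ?n then \<beta>1 i (\<delta> 1 q) else \<zero>)" for q i
  have \<phi>: "\<phi> \<in> mod_hom R (P 2) ?Z"
  proof -
    have b: "(\<lambda>q. \<beta>1 i (\<delta> 1 q)) \<in> mod_hom R (P 2) (regular_module R)" if "i < ?n" for i
      using mod_hom_compose[OF \<delta>(2) \<beta>1[OF that]] .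
    have \<phi>c: "\<phi> q \<in> ?V" if "q \<in> carrier (P 2)" for q
      using functional_closed[OF b that] by (auto simp: \<phi>_def free_module_def)
    have "\<phi> q \<in> syzygies R xs" if q: "q \<in> carrier (P 2)" for q
    proof -
      have q1: "\<delta> 1 q \<in> carrier (P 1)" "\<delta> 0 (\<delta> 1 q) = \<zero>\<^bsub>P 0\<^esub>"
        using exact(1) q by (auto simp: a_kernel_def')
      have "?d (\<phi> q) = ?d (\<lambda>i. \<beta>1 i (\<delta> 1 q))"
        using functional_closed[OF b q] xsc by (intro dot_cong) (auto simp: \<phi>_def)
      also have "\<dots> = \<beta>0 \<zero>\<^bsub>P 0\<^esub>" using \<beta>[OF q1(1)] q1(2) by simp
      also have "\<dots> = \<zero>"
        using mod_hom_zero[OF mods regular_module_module \<beta>0] by (simp add: regular_module_def)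
      finally show ?thesis using \<phi>c[OF q] by (simp add: syzygies_def)
    qed
    moreover have "\<phi> (q \<oplus>\<^bsub>P 2\<^esub> q') = (\<lambda>i. \<phi> q i \<oplus> \<phi> q' i)" if "q \<in> carrier (P 2)" "q' \<in> carrier (P 2)" for q q'
      using functional_add[OF b that] by (auto simp: \<phi>_def)
    moreover have "\<phi> (r \<odot>\<^bsub>P 2\<^esub> q) = (\<lambda>i. r \<otimes> \<phi> q i)" if "r \<in> carrier R" "q \<in> carrier (P 2)" for r q
      using functional_smult[OF b that] that(1) by (auto simp: \<phi>_def)
    ultimately show ?thesis
      by (simp add: mod_hom_def syzygy_module_def free_module_def)
  qed
  have "\<exists>S. finite S \<and> S \<subseteq> syzygies R xs \<and> syzygies R xs \<subseteq> lin_span R S"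
  proof (rule noetherian_submodule_finitely_spanned[OF noeth syzygies_subset])
    show "(\<lambda>i. \<zero>) \<in> syzygies R xs"
      using Z.zero_closed by (simp add: syzygy_module_def free_module_def)
    show "(\<lambda>i. v i \<oplus> w i) \<in> syzygies R xs" if "v \<in> syzygies R xs" "w \<in> syzygies R xs" for v w
      using Z.add.m_closed[of v w] that by (simp add: syzygy_module_def free_module_def)
    show "(\<lambda>i. r \<otimes> v i) \<in> syzygies R xs" if "r \<in> carrier R" "v \<in> syzygies R xs" for r v
      using Z.smult_closed[of r v] that by (simp add: syzygy_module_def free_module_def)
  qed
  then obtain S where S: "finite S" "S \<subseteq> syzygies R xs" "syzygies R xs \<subseteq> lin_span R S" by blast
  have "\<exists>c. (\<forall>k\<in>S. c k \<in> mod_hom R (P 2) (regular_module R)) \<and>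
    (\<forall>q\<in>carrier (P 2). \<phi> q = (\<Oplus>\<^bsub>?Z\<^esub>k\<in>S. c k q \<odot>\<^bsub>?Z\<^esub> k))"
  proof (rule projective_coordinates[OF proj2 Z.module_axioms, of "\<lambda>x. x" S "\<lambda>x. x"])
    fix z assume "z \<in> carrier ?Z"
    then have "z \<in> lin_span R S" using S(3) carrZ by auto
    then obtain b where b: "\<forall>s\<in>S. b s \<in> carrier R" "\<forall>i. z i = (\<Oplus>s\<in>S. b s \<otimes> s i)"
      using lin_span_coefficients[of z S] S(1,2) Zc by blast
    have "(\<Oplus>\<^bsub>?Z\<^esub>k\<in>S. b k \<odot>\<^bsub>?Z\<^esub> k) = (\<lambda>i. \<Oplus>s\<in>S. b s \<otimes> s i)"
      using b(1) S by (intro syzygy_lincomb[OF xs(1)]) auto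
    also have "\<dots> = z" using b(2) by (intro ext) simp
    finally show "\<exists>b. (\<forall>k\<in>S. b k \<in> carrier R) \<and> z = (\<Oplus>\<^bsub>?Z\<^esub>k\<in>S. b k \<odot>\<^bsub>?Z\<^esub> k)"
      using b(1) by (intro exI[of _ b] conjI) auto
  qed (use S \<phi> carrZ in auto)
  then obtain c where c: "\<And>s. s \<in> S \<Longrightarrow> c s \<in> mod_hom R (P 2) (regular_module R)"
    "\<And>q. q \<in> carrier (P 2) \<Longrightarrow> \<phi> q = (\<Oplus>\<^bsub>?Z\<^esub>s\<in>S. c s q \<odot>\<^bsub>?Z\<^esub> s)"
    by blast
  \<comment> \<open>The \<open>k\<close>-th standard basis vector minus its image under \<open>\<beta>1 \<circ> \<alpha>\<close>, corrected
    by the homotopy \<open>v \<mapsto> d v \<cdot> g\<close> with \<open>d g = \<one> \<ominus> \<beta>0 a\<close>.\<close>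
  define t where "t k i = (if i < ?n then (if k = i then \<one> else \<zero>) \<ominus> (\<beta>1 i (p k) \<oplus> xs ! k \<otimes> g i) else \<zero>)" for k i
  have \<beta>p: "\<beta>1 i (p k) \<in> carrier R" if "i < ?n" "k < ?n" for i k
    using functional_closed[OF \<beta>1 p(1)] that by blast
  have tc: "t k i \<in> carrier R" if "k < ?n" for k i
    using \<beta>p that xsc gc by (auto simp: t_def)
  have t: "t k \<in> syzygies R xs" if k: "k < ?n" for k
  proof -
    have "?d (t k) = ?d (\<lambda>i. (if i = k then \<one> else \<zero>) \<ominus> (\<beta>1 i (p k) \<oplus> xs ! k \<otimes> g i))"
      using \<beta>p k xsc gc by (intro dot_cong) (auto simp: t_def)
    also have "\<dots> = ?d (\<lambda>i. if i = k then \<one> else \<zero>) \<ominus> ?d (\<lambda>i. \<beta>1 i (p k) \<oplus> xs ! k \<otimes> g i)"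
      using \<beta>p k xsc gc by (intro dot_minus) auto
    also have "?d (\<lambda>i. if i = k then \<one> else \<zero>) = xs ! k"
      using xsc k by (intro dot_unit) auto
    also have "?d (\<lambda>i. \<beta>1 i (p k) \<oplus> xs ! k \<otimes> g i) = ?d (\<lambda>i. \<beta>1 i (p k)) \<oplus> ?d (\<lambda>i. xs ! k \<otimes> g i)"
      using \<beta>p k xsc gc by (intro dot_add) auto
    also have "?d (\<lambda>i. xs ! k \<otimes> g i) = xs ! k \<otimes> ?d g"
      using k xsc gc by (intro dot_smult) auto
    also have "?d (\<lambda>i. \<beta>1 i (p k)) = \<beta>0 ((xs ! k) \<odot>\<^bsub>P 0\<^esub> a)"
      using \<beta>[OF p(1)[OF k]] p(2)[OF k] by simp
    also have "\<dots> = xs ! k \<otimes> \<beta>0 a" using xsc k a(1) by (intro functional_smult[OF \<beta>0]) auto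
    also have "xs ! k \<otimes> \<beta>0 a \<oplus> xs ! k \<otimes> ?d g = xs ! k \<otimes> (\<beta>0 a \<oplus> (\<one> \<ominus> \<beta>0 a))"
      unfolding g(2)[symmetric] using xsc[OF k] \<beta>a by (intro r_distr[symmetric]) auto
    also have "\<beta>0 a \<oplus> (\<one> \<ominus> \<beta>0 a) = \<one>"
      using \<beta>a by (simp add: minus_eq a_lcomm[of "\<beta>0 a"] r_neg)
    finally have "?d (t k) = \<zero>" using xsc[OF k] by (simp add: minus_eq r_neg)
    then show ?thesis using tc[OF k] by (simp add: syzygies_def free_module_def t_def)
  qed
  \<comment> \<open>The standard basis indices contribute the vectors \<open>t k\<close>, the set \<open>S\<close>
    generates the syzygies.\<close>
  define A :: "(nat + (nat \<Rightarrow> 'a)) set" where "A = Inl ` {..<?n} \<union> Inr ` S"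
  define F where "F = case_sum t (\<lambda>s. s)"
  define \<psi> where "\<psi> = case_sum (\<lambda>k z. z k) (\<lambda>s z. c s (\<gamma> z))"
  have \<psi>: "\<psi> k \<in> mod_hom R ?Z (regular_module R)" if "k \<in> A" for k
  proof (cases k)
    case (Inl l)
    then show ?thesis using Zc
      by (simp add: \<psi>_def mod_hom_def syzygy_module_def free_module_def regular_module_def)
  next
    case (Inr s)
    then show ?thesis using mod_hom_compose[OF \<gamma>(1) c(1)] that by (auto simp: \<psi>_def A_def)
  qed
  have F: "F k \<in> syzygies R xs" if "k \<in> A" for k
    using that t S(2) by (auto simp: F_def A_def)
  have "z = (\<Oplus>\<^bsub>?Z\<^esub>k\<in>A. \<psi> k z \<odot>\<^bsub>?Z\<^esub> F k)" if "z \<in> carrier ?Z" for z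
  proof -
    have z: "z \<in> syzygies R xs" using that carrZ by simp
    have \<psi>z: "\<psi> k z \<in> carrier R" if "k \<in> A" for k
      using functional_closed[OF \<psi>[OF that], of z] z carrZ by simp
    have \<gamma>z: "\<gamma> z \<in> carrier (P 2)" using mod_hom_closed[OF \<gamma>(1), of z] z carrZ by simp
    have csz: "c s (\<gamma> z) \<in> carrier R" if "s \<in> S" for s using functional_closed[OF c(1)[OF that] \<gamma>z] .
    have "z i = (\<Oplus>k\<in>A. \<psi> k z \<otimes> F k i)" for i
    proof -
      have "(\<Oplus>k\<in>A. \<psi> k z \<otimes> F k i)
          = (\<Oplus>k\<in>Inl ` {..<?n}. \<psi> k z \<otimes> F k i) \<oplus> (\<Oplus>k\<in>Inr ` S. \<psi> k z \<otimes> F k i)"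
        unfolding A_def using \<psi>z F Zc S(1) by (intro finsum_Un_disjoint) (auto simp: A_def)
      also have "(\<Oplus>k\<in>Inl ` {..<?n}. \<psi> k z \<otimes> F k i) = (\<Oplus>k\<in>{..<?n}. z k \<otimes> t k i)"
        using Zc[OF z] tc by (subst finsum_reindex) (auto simp: \<psi>_def F_def)
      also have "(\<Oplus>k\<in>Inr ` S. \<psi> k z \<otimes> F k i) = (\<Oplus>s\<in>S. c s (\<gamma> z) \<otimes> s i)"
        using csz S(2) Zc by (subst finsum_reindex) (auto simp: \<psi>_def F_def)
      also have "\<dots> = \<phi> (\<gamma> z) i"
        unfolding c(2)[OF \<gamma>z] using csz S by (subst syzygy_lincomb[OF xs(1)]) auto
      also have "(\<Oplus>k\<in>{..<?n}. z k \<otimes> t k i) \<oplus> \<phi> (\<gamma> z) i = z i"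
      proof (cases "i < ?n")
        case True
        let ?B = "\<lambda>k. \<beta>1 i (p k)"
        have "(\<Oplus>k\<in>{..<?n}. z k \<otimes> t k i) = dot R ?n z (\<lambda>k. (if k = i then \<one> else \<zero>) \<ominus> (?B k \<oplus> g i \<otimes> xs ! k))"
          unfolding dot_def[of R ?n z] using True Zc[OF z] \<beta>p xsc gc
          by (intro finsum_cong') (auto simp: t_def m_comm[of _ "g i"])
        also have "\<dots> = dot R ?n z (\<lambda>k. if k = i then \<one> else \<zero>) \<ominus> dot R ?n z (\<lambda>k. ?B k \<oplus> g i \<otimes> xs ! k)"
          using True Zc[OF z] \<beta>p xsc gc by (intro dot_minus) auto
        also have "dot R ?n z (\<lambda>k. if k = i then \<one> else \<zero>) = z i"
          using True Zc[OF z] by (intro dot_unit) auto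
        also have "dot R ?n z (\<lambda>k. ?B k \<oplus> g i \<otimes> xs ! k) = dot R ?n z ?B \<oplus> dot R ?n z (\<lambda>k. g i \<otimes> xs ! k)"
          using True Zc[OF z] \<beta>p xsc gc by (intro dot_add) auto
        also have "dot R ?n z (\<lambda>k. g i \<otimes> xs ! k) = g i \<otimes> dot R ?n z ((!) xs)"
          using Zc[OF z] xsc gc by (intro dot_smult) auto
        also have "dot R ?n z ((!) xs) = \<zero>"
          using z Zc[OF z] xsc dot_comm[of ?n z "(!) xs"] by (simp add: syzygies_def)
        also have "dot R ?n z ?B = \<beta>1 i (\<alpha> z)"
          unfolding \<alpha>_def dot_def using True Zc[OF z] p(1)
          by (intro functional_lincomb[OF mods \<beta>1, symmetric]) auto
        finally have "(\<Oplus>k\<in>{..<?n}. z k \<otimes> t k i) = z i \<ominus> \<beta>1 i (\<alpha> z)"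
          using gc functional_closed[OF \<beta>1[OF True] \<alpha>c[OF z]] by simp
        moreover have "\<phi> (\<gamma> z) i = \<beta>1 i (\<alpha> z)" using True \<gamma>(2)[OF z] by (simp add: \<phi>_def)
        ultimately show ?thesis
          using Zc[OF z] functional_closed[OF \<beta>1[OF True] \<alpha>c[OF z]]
          by (simp add: minus_eq a_assoc l_neg)
      next
        case False
        then have "z i = \<zero>" using z by (simp add: syzygies_def free_module_def)
        moreover have "(\<Oplus>k\<in>{..<?n}. z k \<otimes> t k i) = \<zero>"
          using False Zc[OF z] by (intro add.finprod_one_eqI) (auto simp: t_def)
        ultimately show ?thesis using False by (simp add: \<phi>_def)
      qed
      finally show ?thesis by simp
    qed
    moreover have "(\<Oplus>\<^bsub>?Z\<^esub>k\<in>A. \<psi> k z \<odot>\<^bsub>?Z\<^esub> F k) = (\<lambda>i. \<Oplus>k\<in>A. \<psi> k z \<otimes> F k i)"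
      using \<psi>z F S(1) by (intro syzygy_lincomb[OF xs(1)]) (auto simp: A_def)
    ultimately show ?thesis by (metis (no_types, lifting) ext)
  qed
  then show ?thesis
    using \<psi> F S(1) by (intro dual_basis_of_finite[OF Z.module_axioms, of A F \<psi>]) (auto simp: A_def carrZ)
qed

end

section \<open>Bases over local rings\<close>

definition invertible :: "('a, 'b) ring_scheme \<Rightarrow> 'a \<Rightarrow> bool" where
  "invertible R a \<longleftrightarrow> (\<exists>v\<in>carrier R. a \<otimes>\<^bsub>R\<^esub> v = \<one>\<^bsub>R\<^esub>)"

text \<open>The elementwise form of locality for nontrivial rings, which is what the elimination steps
for dual bases consume.\<close>

definition local_cring :: "('a, 'b) ring_scheme \<Rightarrow> bool" where
  "local_cring R \<longleftrightarrow> \<one>\<^bsub>R\<^esub> \<noteq> \<zero>\<^bsub>R\<^esub> \<and>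
     (\<forall>a\<in>carrier R. invertible R a \<or> invertible R (\<one>\<^bsub>R\<^esub> \<ominus>\<^bsub>R\<^esub> a))"

lemma (in noetherian_ring) exists_maximal_in_family:
  assumes "\<F> \<noteq> {}" "\<And>J. J \<in> \<F> \<Longrightarrow> ideal J R"
  shows "\<exists>M\<in>\<F>. \<forall>J\<in>\<F>. M \<subseteq> J \<longrightarrow> J = M"
proof (rule subset_Zorn_nonempty[OF assms(1)])
  fix C assume C: "C \<noteq> {}" "subset.chain \<F> C"
  then have "subset.chain {I. ideal I R} C"
    using assms(2) by (auto simp: pred_on.chain_def)
  then have "\<Union>C \<in> C" by (rule ideal_chain_is_trivial[OF C(1)])
  then show "\<Union>C \<in> \<F>" using C(2) by (auto simp: pred_on.chain_def)
qed

text \<open>A noninvertible element lies in some maximal ideal, hence in the only one, and \<open>\<one>\<close> is not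
the sum of two elements of it.\<close>

lemma (in noetherian_local_ring) nonunits_complementary: "local_cring R"
proof -
  obtain M where M: "maximalideal M R" "\<And>M'. maximalideal M' R \<Longrightarrow> M' = M"
    using unique_maximalideal by blast
  interpret M: maximalideal M R by (rule M(1))
  have in_M: "a \<in> M" if a: "a \<in> carrier R" "\<not> invertible R a" for a
  proof -
    define \<F> where "\<F> = {J. ideal J R \<and> a \<in> J \<and> \<one> \<notin> J}"
    have "\<one> \<notin> PIdl a"
    proof
      assume "\<one> \<in> PIdl a"
      then obtain v where "v \<in> carrier R" "\<one> = v \<otimes> a" by (auto simp: cgenideal_def)
      then show False using a m_comm[of a v] by (auto simp: invertible_def)
    qed
    then have "PIdl a \<in> \<F>"
      using cgenideal_ideal[OF a(1)] cgenideal_self[OF a(1)] by (simp add: \<F>_def)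
    then have "\<F> \<noteq> {}" by blast
    then have "\<exists>N\<in>\<F>. \<forall>J\<in>\<F>. N \<subseteq> J \<longrightarrow> J = N"
      by (rule exists_maximal_in_family) (simp add: \<F>_def)
    then obtain N where N: "N \<in> \<F>" "\<forall>J\<in>\<F>. N \<subseteq> J \<longrightarrow> J = N" ..
    have "maximalideal N R"
    proof (rule maximalidealI)
      show "ideal N R" "carrier R \<noteq> N" using N(1) one_closed by (auto simp: \<F>_def)
      show "J = N \<or> J = carrier R" if J: "ideal J R" "N \<subseteq> J" "J \<subseteq> carrier R" for J
      proof (cases "\<one> \<in> J")
        case True
        then show ?thesis using ideal.one_imp_carrier[OF J(1)] by simp
      next
        case False
        then have "J \<in> \<F>" using J N(1) by (auto simp: \<F>_def)
        then show ?thesis using N(2) J(2) by simp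
      qed
    qed
    then show ?thesis using M(2) N(1) by (auto simp: \<F>_def)
  qed
  have one: "\<one> \<notin> M" using M.one_imp_carrier M.I_notcarr by blast
  have "invertible R a \<or> invertible R (\<one> \<ominus> a)" if a: "a \<in> carrier R" for a
  proof (rule ccontr)
    assume "\<not> ?thesis"
    then have "a \<oplus> (\<one> \<ominus> a) \<in> M" using in_M a by (intro M.a_closed) auto
    moreover have "a \<oplus> (\<one> \<ominus> a) = \<one>" using a by (simp add: minus_eq a_lcomm[of a] r_neg)
    ultimately show False using one by simp
  qed
  moreover have "\<one> \<noteq> \<zero>" using one M.zero_closed by metis
  ultimately show ?thesis by (simp add: local_cring_def)
qed

context cring
begin

lemma local_sum_invertible:
  assumes "local_cring R" "finite A" "\<And>i. i \<in> A \<Longrightarrow> t i \<in> carrier R"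
    and "invertible R (\<Oplus>i\<in>A. t i)"
  shows "\<exists>i\<in>A. invertible R (t i)"
  using assms(2-)
proof (induction A rule: finite_induct)
  case empty
  then show ?case using assms(1) by (auto simp: invertible_def local_cring_def)
next
  case (insert b A)
  let ?s = "\<Oplus>i\<in>A. t i"
  have s: "?s \<in> carrier R" "t b \<in> carrier R" using insert by (auto intro!: finsum_closed)
  have "(\<Oplus>i\<in>insert b A. t i) = t b \<oplus> ?s" using insert by (intro finsum_insert) auto
  then obtain v where v: "v \<in> carrier R" "(t b \<oplus> ?s) \<otimes> v = \<one>"
    using insert.prems(2) by (auto simp: invertible_def)
  have eq: "\<one> \<ominus> t b \<otimes> v = ?s \<otimes> v"
  proof -
    have "\<one> \<ominus> t b \<otimes> v = (t b \<otimes> v \<oplus> ?s \<otimes> v) \<ominus> t b \<otimes> v"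
      using v s by (simp add: l_distr)
    also have "\<dots> = ?s \<otimes> v"
      using v s by (simp add: minus_eq a_comm[of "t b \<otimes> v" "?s \<otimes> v"] a_assoc r_neg)
    finally show ?thesis .
  qed
  have "invertible R (t b \<otimes> v) \<or> invertible R (?s \<otimes> v)"
    using assms(1) s v eq unfolding local_cring_def by (metis m_closed)
  then have "invertible R (t b) \<or> invertible R ?s"
    using s v unfolding invertible_def by (metis m_assoc m_closed)
  then show ?case using insert by auto
qed

lemma functional_add_multiple:
  assumes M: "module R M" and f: "f \<in> mod_hom R M (regular_module R)"
    and g: "g \<in> mod_hom R M (regular_module R)" and c: "c \<in> carrier R"
  shows "(\<lambda>z. f z \<oplus> g z \<otimes> c) \<in> mod_hom R M (regular_module R)"
proof -
  interpret M: module R M by fact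
  note fc = functional_closed[OF f] and gc = functional_closed[OF g]
  have "f (x \<oplus>\<^bsub>M\<^esub> y) \<oplus> g (x \<oplus>\<^bsub>M\<^esub> y) \<otimes> c = (f x \<oplus> g x \<otimes> c) \<oplus> (f y \<oplus> g y \<otimes> c)"
    if "x \<in> carrier M" "y \<in> carrier M" for x y
    using that fc gc c by (simp add: functional_add[OF f] functional_add[OF g] l_distr a_ac)
  moreover have "f (r \<odot>\<^bsub>M\<^esub> x) \<oplus> g (r \<odot>\<^bsub>M\<^esub> x) \<otimes> c = r \<otimes> (f x \<oplus> g x \<otimes> c)"
    if "r \<in> carrier R" "x \<in> carrier M" for r x
    using that fc gc c by (simp add: functional_smult[OF f] functional_smult[OF g] r_distr m_assoc)
  ultimately show ?thesis using fc gc c by (simp add: mod_hom_def regular_module_def)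
qed

lemma functional_multiple:
  assumes "module R M" and f: "f \<in> mod_hom R M (regular_module R)" and c: "c \<in> carrier R"
  shows "(\<lambda>z. c \<otimes> f z) \<in> mod_hom R M (regular_module R)"
proof -
  interpret M: module R M by fact
  show ?thesis
    using functional_closed[OF f] functional_add[OF f] functional_smult[OF f] c
    by (simp add: mod_hom_def regular_module_def r_distr m_lcomm)
qed

text \<open>The expansion of \<open>f m\<close> contains \<open>f m\<close> itself with coefficient \<open>\<psi> m (f m)\<close>.  If
\<open>\<one> \<ominus> \<psi> m (f m)\<close> is invertible, it can be solved for \<open>f m\<close>, which makes the last generator
redundant.\<close>

lemma dual_basis_eliminate:
  assumes M: "module R M" and db: "dual_basis R M (Suc m) f \<psi>"
    and inv: "invertible R (\<one> \<ominus> \<psi> m (f m))"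
  shows "\<exists>\<psi>'. dual_basis R M m f \<psi>'"
proof -
  interpret M: module R M by fact
  have f: "f j \<in> carrier M" if "j < Suc m" for j using db that by (simp add: dual_basis_def)
  have \<psi>: "\<psi> j \<in> mod_hom R M (regular_module R)" if "j < Suc m" for j
    using db that by (simp add: dual_basis_def)
  have \<psi>c: "\<psi> j z \<in> carrier R" if "j < Suc m" "z \<in> carrier M" for j z
    using functional_closed[OF \<psi>] that by blast
  have exp: "z = \<psi> m z \<odot>\<^bsub>M\<^esub> f m \<oplus>\<^bsub>M\<^esub> (\<Oplus>\<^bsub>M\<^esub>j\<in>{..<m}. \<psi> j z \<odot>\<^bsub>M\<^esub> f j)" if z: "z \<in> carrier M" for z
  proof -
    have "z = (\<Oplus>\<^bsub>M\<^esub>j\<in>{..<Suc m}. \<psi> j z \<odot>\<^bsub>M\<^esub> f j)" using db z by (simp add: dual_basis_def)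
    also have "\<dots> = \<psi> m z \<odot>\<^bsub>M\<^esub> f m \<oplus>\<^bsub>M\<^esub> (\<Oplus>\<^bsub>M\<^esub>j\<in>{..<m}. \<psi> j z \<odot>\<^bsub>M\<^esub> f j)"
      unfolding lessThan_Suc using f \<psi>c z by (intro M.finsum_insert) auto
    finally show ?thesis .
  qed
  obtain v where v: "v \<in> carrier R" "(\<one> \<ominus> \<psi> m (f m)) \<otimes> v = \<one>" using inv by (auto simp: invertible_def)
  let ?c = "\<psi> m (f m)"
  let ?s = "\<Oplus>\<^bsub>M\<^esub>j\<in>{..<m}. \<psi> j (f m) \<odot>\<^bsub>M\<^esub> f j"
  have c: "?c \<in> carrier R" and fm: "f m \<in> carrier M" using \<psi>c f by auto
  have s: "?s \<in> carrier M" using \<psi>c f by (intro M.finsum_closed) auto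
  have "(\<one> \<ominus> ?c) \<odot>\<^bsub>M\<^esub> f m = f m \<oplus>\<^bsub>M\<^esub> \<ominus>\<^bsub>M\<^esub> (?c \<odot>\<^bsub>M\<^esub> f m)"
    using c fm by (simp add: minus_eq M.smult_l_distr M.smult_l_minus)
  also have "\<dots> = (?c \<odot>\<^bsub>M\<^esub> f m \<oplus>\<^bsub>M\<^esub> ?s) \<oplus>\<^bsub>M\<^esub> \<ominus>\<^bsub>M\<^esub> (?c \<odot>\<^bsub>M\<^esub> f m)"
    using exp[OF fm] by simp
  also have "\<dots> = ?s"
    using c fm s by (simp add: M.a_comm[of "?c \<odot>\<^bsub>M\<^esub> f m" ?s] M.a_assoc M.r_neg)
  finally have "v \<odot>\<^bsub>M\<^esub> ((\<one> \<ominus> ?c) \<odot>\<^bsub>M\<^esub> f m) = v \<odot>\<^bsub>M\<^esub> ?s" by simp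
  moreover have "v \<odot>\<^bsub>M\<^esub> ((\<one> \<ominus> ?c) \<odot>\<^bsub>M\<^esub> f m) = f m"
    using v c fm m_comm[of v "\<one> \<ominus> ?c"] by (simp add: M.smult_assoc1[symmetric])
  moreover have "v \<odot>\<^bsub>M\<^esub> ?s = (\<Oplus>\<^bsub>M\<^esub>j\<in>{..<m}. (v \<otimes> \<psi> j (f m)) \<odot>\<^bsub>M\<^esub> f j)"
  proof -
    have "v \<odot>\<^bsub>M\<^esub> ?s = (\<Oplus>\<^bsub>M\<^esub>j\<in>{..<m}. v \<odot>\<^bsub>M\<^esub> (\<psi> j (f m) \<odot>\<^bsub>M\<^esub> f j))"
      using v(1) \<psi>c f by (intro M.finsum_smult_ldistr) auto
    also have "\<dots> = (\<Oplus>\<^bsub>M\<^esub>j\<in>{..<m}. (v \<otimes> \<psi> j (f m)) \<odot>\<^bsub>M\<^esub> f j)"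
      using v(1) \<psi>c f by (intro M.finsum_cong') (auto simp: M.smult_assoc1)
    finally show ?thesis .
  qed
  ultimately have fm_eq: "f m = (\<Oplus>\<^bsub>M\<^esub>j\<in>{..<m}. (v \<otimes> \<psi> j (f m)) \<odot>\<^bsub>M\<^esub> f j)" by simp
  define \<psi>' where "\<psi>' j z = \<psi> j z \<oplus> \<psi> m z \<otimes> (v \<otimes> \<psi> j (f m))" for j z
  have "\<psi>' j \<in> mod_hom R M (regular_module R)" if "j < m" for j
    unfolding \<psi>'_def using \<psi> v(1) \<psi>c f that by (intro functional_add_multiple[OF M]) auto
  moreover have "z = (\<Oplus>\<^bsub>M\<^esub>j\<in>{..<m}. \<psi>' j z \<odot>\<^bsub>M\<^esub> f j)" if z: "z \<in> carrier M" for z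
  proof -
    have "(\<Oplus>\<^bsub>M\<^esub>j\<in>{..<m}. \<psi>' j z \<odot>\<^bsub>M\<^esub> f j)
        = (\<Oplus>\<^bsub>M\<^esub>j\<in>{..<m}. \<psi> j z \<odot>\<^bsub>M\<^esub> f j \<oplus>\<^bsub>M\<^esub> \<psi> m z \<odot>\<^bsub>M\<^esub> ((v \<otimes> \<psi> j (f m)) \<odot>\<^bsub>M\<^esub> f j))"
      unfolding \<psi>'_def using v(1) \<psi>c f z
      by (intro M.finsum_cong') (auto simp: M.smult_l_distr M.smult_assoc1)
    also have "\<dots> = (\<Oplus>\<^bsub>M\<^esub>j\<in>{..<m}. \<psi> j z \<odot>\<^bsub>M\<^esub> f j)
        \<oplus>\<^bsub>M\<^esub> (\<Oplus>\<^bsub>M\<^esub>j\<in>{..<m}. \<psi> m z \<odot>\<^bsub>M\<^esub> ((v \<otimes> \<psi> j (f m)) \<odot>\<^bsub>M\<^esub> f j))"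
      using v(1) \<psi>c f z by (intro M.finsum_addf) auto
    also have "(\<Oplus>\<^bsub>M\<^esub>j\<in>{..<m}. \<psi> m z \<odot>\<^bsub>M\<^esub> ((v \<otimes> \<psi> j (f m)) \<odot>\<^bsub>M\<^esub> f j))
        = \<psi> m z \<odot>\<^bsub>M\<^esub> (\<Oplus>\<^bsub>M\<^esub>j\<in>{..<m}. (v \<otimes> \<psi> j (f m)) \<odot>\<^bsub>M\<^esub> f j)"
      using v(1) \<psi>c f z by (intro M.finsum_smult_ldistr[symmetric]) auto
    also have "\<dots> = \<psi> m z \<odot>\<^bsub>M\<^esub> f m" using fm_eq by simp
    also have "(\<Oplus>\<^bsub>M\<^esub>j\<in>{..<m}. \<psi> j z \<odot>\<^bsub>M\<^esub> f j) \<oplus>\<^bsub>M\<^esub> \<psi> m z \<odot>\<^bsub>M\<^esub> f m = z"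
      using exp[OF z] \<psi>c f z by (subst M.a_comm) (auto intro!: M.finsum_closed)
    finally show ?thesis by simp
  qed
  ultimately have "dual_basis R M m f \<psi>'" using f by (simp add: dual_basis_def)
  then show ?thesis by blast
qed

lemma functional_kernel_module:
  assumes M: "module R M" and \<phi>: "\<phi> \<in> mod_hom R M (regular_module R)"
  shows "module R (M\<lparr>carrier := {z \<in> carrier M. \<phi> z = \<zero>}\<rparr>)"
proof -
  interpret M: module R M by fact
  show ?thesis
    using mod_hom_zero[OF M regular_module_module \<phi>]
    by (intro submodule_moduleI[OF M])
      (auto simp: functional_add[OF \<phi>] functional_smult[OF \<phi>], simp add: regular_module_def)
qed

text \<open>If a functional takes the value one at \<open>b\<close>, the module is the direct sum of \<open>R b\<close> and the
kernel of the functional.\<close>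

lemma free_basis_split:
  assumes M: "module R M" and \<phi>: "\<phi> \<in> mod_hom R M (regular_module R)"
    and b: "b \<in> carrier M" "\<phi> b = \<one>"
    and fb: "free_basis R (M\<lparr>carrier := {z \<in> carrier M. \<phi> z = \<zero>}\<rparr>) k f \<psi>"
  shows "\<exists>f \<psi>. free_basis R M (Suc k) f \<psi>"
proof -
  let ?H = "{z \<in> carrier M. \<phi> z = \<zero>}"
  let ?K = "M\<lparr>carrier := ?H\<rparr>"
  interpret M: module R M by fact
  interpret K: module R ?K by (rule functional_kernel_module[OF M \<phi>])
  have \<phi>c: "\<phi> z \<in> carrier R" if "z \<in> carrier M" for z using functional_closed[OF \<phi> that] .
  have f: "f j \<in> ?H" if "j < k" for j using fb that by (simp add: free_basis_def dual_basis_def)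
  have \<psi>: "\<psi> j \<in> mod_hom R ?K (regular_module R)" if "j < k" for j
    using fb that by (simp add: free_basis_def dual_basis_def)
  have exp: "z = (\<Oplus>\<^bsub>?K\<^esub>j\<in>{..<k}. \<psi> j z \<odot>\<^bsub>M\<^esub> f j)" if "z \<in> ?H" for z
    using fb that by (simp add: free_basis_def dual_basis_def)
  have \<psi>f: "\<psi> i (f j) = (if i = j then \<one> else \<zero>)" if "i < k" "j < k" for i j
    using fb that by (simp add: free_basis_def)
  have \<psi>c: "\<psi> j z \<in> carrier R" if "j < k" "z \<in> ?H" for j z
    using functional_closed[OF \<psi>[OF that(1)], of z] that(2) by simp
  define \<rho> where "\<rho> z = z \<oplus>\<^bsub>M\<^esub> (\<ominus> \<phi> z) \<odot>\<^bsub>M\<^esub> b" for z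
  have \<rho>: "\<rho> z \<in> ?H" if z: "z \<in> carrier M" for z
  proof -
    have "\<phi> (\<rho> z) = \<phi> z \<oplus> (\<ominus> \<phi> z) \<otimes> \<phi> b"
      unfolding \<rho>_def using z b \<phi>c by (simp add: functional_add[OF \<phi>] functional_smult[OF \<phi>])
    then show ?thesis using z b \<phi>c by (simp add: \<rho>_def r_neg)
  qed
  have \<rho>_hom: "\<rho> \<in> mod_hom R M ?K"
  proof -
    have "\<rho> (x \<oplus>\<^bsub>M\<^esub> y) = \<rho> x \<oplus>\<^bsub>M\<^esub> \<rho> y" if "x \<in> carrier M" "y \<in> carrier M" for x y
    proof -
      have "\<ominus> (\<phi> x \<oplus> \<phi> y) = \<ominus> \<phi> x \<oplus> \<ominus> \<phi> y" using \<phi>c that by (simp add: minus_add)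
      then show ?thesis
        unfolding \<rho>_def using that b \<phi>c
        by (simp add: functional_add[OF \<phi>] M.smult_l_distr M.a_ac)
    qed
    moreover have "\<rho> (r \<odot>\<^bsub>M\<^esub> x) = r \<odot>\<^bsub>M\<^esub> \<rho> x" if "r \<in> carrier R" "x \<in> carrier M" for r x
    proof -
      have "\<ominus> (r \<otimes> \<phi> x) = r \<otimes> (\<ominus> \<phi> x)" using \<phi>c that by (simp add: r_minus)
      then show ?thesis
        unfolding \<rho>_def using that b \<phi>c
        by (simp add: functional_smult[OF \<phi>] M.smult_r_distr M.smult_assoc1)
    qed
    ultimately show ?thesis using \<rho> by (simp add: mod_hom_def)
  qed
  have \<rho>_H: "\<rho> z = z" if "z \<in> ?H" for z using that b by (simp add: \<rho>_def)
  have \<rho>_b: "\<rho> b = \<zero>\<^bsub>M\<^esub>" using b by (simp add: \<rho>_def M.smult_l_minus M.r_neg)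
  define F where "F j = (if j < k then f j else b)" for j
  define \<Psi> where "\<Psi> j z = (if j < k then \<psi> j (\<rho> z) else \<phi> z)" for j z
  have \<Psi>: "\<Psi> j \<in> mod_hom R M (regular_module R)" for j
  proof (cases "j < k")
    case True
    then have "\<Psi> j = (\<lambda>z. \<psi> j (\<rho> z))" by (auto simp: \<Psi>_def)
    then show ?thesis using mod_hom_compose[OF \<rho>_hom \<psi>[OF True]] by simp
  next
    case False
    then have "\<Psi> j = \<phi>" by (auto simp: \<Psi>_def)
    then show ?thesis using \<phi> by simp
  qed
  have F: "F j \<in> carrier M" for j using f b by (auto simp: F_def)
  have "z = (\<Oplus>\<^bsub>M\<^esub>j\<in>{..<Suc k}. \<Psi> j z \<odot>\<^bsub>M\<^esub> F j)" if z: "z \<in> carrier M" for z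
  proof -
    have \<Psi>c: "\<Psi> j z \<in> carrier R" for j using functional_closed[OF \<Psi> z] .
    have "(\<Oplus>\<^bsub>M\<^esub>j\<in>{..<Suc k}. \<Psi> j z \<odot>\<^bsub>M\<^esub> F j)
        = \<Psi> k z \<odot>\<^bsub>M\<^esub> F k \<oplus>\<^bsub>M\<^esub> (\<Oplus>\<^bsub>M\<^esub>j\<in>{..<k}. \<Psi> j z \<odot>\<^bsub>M\<^esub> F j)"
      unfolding lessThan_Suc using F \<Psi>c by (intro M.finsum_insert) auto
    also have "(\<Oplus>\<^bsub>M\<^esub>j\<in>{..<k}. \<Psi> j z \<odot>\<^bsub>M\<^esub> F j) = (\<Oplus>\<^bsub>M\<^esub>j\<in>{..<k}. \<psi> j (\<rho> z) \<odot>\<^bsub>M\<^esub> f j)"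
      using \<psi>c f \<rho>[OF z] by (intro M.finsum_cong') (auto simp: \<Psi>_def F_def)
    also have "\<dots> = (\<Oplus>\<^bsub>?K\<^esub>j\<in>{..<k}. \<psi> j (\<rho> z) \<odot>\<^bsub>M\<^esub> f j)"
    proof (rule finsum_submodule[OF M K.module_axioms, symmetric])
      show "\<psi> j (\<rho> z) \<odot>\<^bsub>M\<^esub> f j \<in> ?H" if "j \<in> {..<k}" for j
        using K.smult_closed[of "\<psi> j (\<rho> z)" "f j"] \<psi>c[OF _ \<rho>[OF z]] f that by simp
    qed auto
    also have "\<dots> = \<rho> z" using exp[OF \<rho>[OF z]] by simp
    also have "\<Psi> k z \<odot>\<^bsub>M\<^esub> F k \<oplus>\<^bsub>M\<^esub> \<rho> z = z"
    proof -
      have pb: "\<phi> z \<odot>\<^bsub>M\<^esub> b \<in> carrier M" using \<phi>c[OF z] b by simp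
      have "\<Psi> k z \<odot>\<^bsub>M\<^esub> F k \<oplus>\<^bsub>M\<^esub> \<rho> z = \<phi> z \<odot>\<^bsub>M\<^esub> b \<oplus>\<^bsub>M\<^esub> (z \<oplus>\<^bsub>M\<^esub> \<ominus>\<^bsub>M\<^esub> (\<phi> z \<odot>\<^bsub>M\<^esub> b))"
        using \<phi>c[OF z] b by (simp add: \<Psi>_def F_def \<rho>_def M.smult_l_minus)
      also have "\<dots> = z"
        using pb z by (simp add: M.a_lcomm[of "\<phi> z \<odot>\<^bsub>M\<^esub> b" z] M.r_neg)
      finally show ?thesis .
    qed
    finally show ?thesis by simp
  qed
  moreover have "\<Psi> i (F j) = (if i = j then \<one> else \<zero>)" if ij: "i < Suc k" "j < Suc k" for i j
  proof -
    consider "i < k" "j < k" | "i < k" "j = k" | "i = k" "j < k" | "i = k" "j = k" using ij by linarith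
    then show ?thesis
    proof cases
      case 1
      then show ?thesis using \<psi>f \<rho>_H[OF f] by (simp add: \<Psi>_def F_def)
    next
      case 2
      have "\<psi> i \<zero>\<^bsub>?K\<^esub> = \<zero>\<^bsub>regular_module R\<^esub>"
        by (rule mod_hom_zero[OF K.module_axioms regular_module_module \<psi>[OF 2(1)]])
      then show ?thesis using 2 \<rho>_b by (simp add: \<Psi>_def F_def regular_module_def)
    next
      case 3
      then show ?thesis using f by (simp add: \<Psi>_def F_def)
    next
      case 4
      then show ?thesis using b by (simp add: \<Psi>_def F_def)
    qed
  qed
  ultimately have "free_basis R M (Suc k) F \<Psi>"
    using F \<Psi> by (simp add: free_basis_def dual_basis_def)
  then show ?thesis by blast
qed

text \<open>Project the generators to the kernel of \<open>\<phi>\<close> along \<open>f m\<close>.  The last generator becomes zero,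
so the kernel has a dual basis with one element less; the functionals stay the same.\<close>

lemma dual_basis_kernel:
  assumes M: "module R M" and db: "dual_basis R M (Suc m) f \<psi>"
    and v: "v \<in> carrier R" "\<psi> m (f m) \<otimes> v = \<one>"
  defines "\<phi> \<equiv> \<lambda>z. v \<otimes> \<psi> m z"
  shows "\<exists>f'. dual_basis R (M\<lparr>carrier := {z \<in> carrier M. \<phi> z = \<zero>}\<rparr>) m f' \<psi>"
proof -
  let ?H = "{z \<in> carrier M. \<phi> z = \<zero>}"
  let ?K = "M\<lparr>carrier := ?H\<rparr>"
  interpret M: module R M by fact
  have f: "f j \<in> carrier M" if "j < Suc m" for j using db that by (simp add: dual_basis_def)
  have \<psi>: "\<psi> j \<in> mod_hom R M (regular_module R)" if "j < Suc m" for j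
    using db that by (simp add: dual_basis_def)
  have \<psi>c: "\<psi> j z \<in> carrier R" if "j < Suc m" "z \<in> carrier M" for j z
    using functional_closed[OF \<psi>] that by blast
  have \<phi>: "\<phi> \<in> mod_hom R M (regular_module R)"
    unfolding \<phi>_def using \<psi> v by (intro functional_multiple[OF M]) auto
  interpret K: module R ?K by (rule functional_kernel_module[OF M \<phi>])
  have \<phi>c: "\<phi> z \<in> carrier R" if "z \<in> carrier M" for z using functional_closed[OF \<phi> that] .
  have fm: "f m \<in> carrier M" and \<phi>fm: "\<phi> (f m) = \<one>"
    using f v \<psi>c[of m "f m"] m_comm[of v "\<psi> m (f m)"] by (auto simp: \<phi>_def)
  define f' where "f' j = f j \<oplus>\<^bsub>M\<^esub> (\<ominus> \<phi> (f j)) \<odot>\<^bsub>M\<^esub> f m" for j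
  have f': "f' j \<in> ?H" if j: "j < m" for j
  proof -
    have "\<phi> (f' j) = \<phi> (f j) \<oplus> (\<ominus> \<phi> (f j)) \<otimes> \<phi> (f m)"
      unfolding f'_def using f j fm \<phi>c by (simp add: functional_add[OF \<phi>] functional_smult[OF \<phi>])
    then show ?thesis using f j fm \<phi>c \<phi>fm by (simp add: f'_def r_neg)
  qed
  have \<psi>K: "\<psi> j \<in> mod_hom R ?K (regular_module R)" if "j < m" for j
    using \<psi>[of j] that by (auto simp: mod_hom_def)
  have "z = (\<Oplus>\<^bsub>?K\<^esub>j\<in>{..<m}. \<psi> j z \<odot>\<^bsub>M\<^esub> f' j)" if z: "z \<in> ?H" for z
  proof -
    have zM: "z \<in> carrier M" and \<phi>z: "\<phi> z = \<zero>" using z by auto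
    have "\<psi> m z = (\<psi> m (f m) \<otimes> v) \<otimes> \<psi> m z" using v \<psi>c[of m z] zM by simp
    also have "\<dots> = \<psi> m (f m) \<otimes> \<phi> z"
      unfolding \<phi>_def using v(1) \<psi>c[of m z] \<psi>c[of m "f m"] zM fm by (intro m_assoc) auto
    also have "\<dots> = \<zero>" using \<phi>z \<psi>c[of m "f m"] fm by simp
    finally have \<psi>mz: "\<psi> m z = \<zero>" .
    have z_eq: "z = (\<Oplus>\<^bsub>M\<^esub>j\<in>{..<m}. \<psi> j z \<odot>\<^bsub>M\<^esub> f j)"
    proof -
      have "z = (\<Oplus>\<^bsub>M\<^esub>j\<in>{..<Suc m}. \<psi> j z \<odot>\<^bsub>M\<^esub> f j)" using db zM by (simp add: dual_basis_def)
      also have "\<dots> = \<psi> m z \<odot>\<^bsub>M\<^esub> f m \<oplus>\<^bsub>M\<^esub> (\<Oplus>\<^bsub>M\<^esub>j\<in>{..<m}. \<psi> j z \<odot>\<^bsub>M\<^esub> f j)"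
        unfolding lessThan_Suc using f \<psi>c zM by (intro M.finsum_insert) auto
      also have "\<dots> = (\<Oplus>\<^bsub>M\<^esub>j\<in>{..<m}. \<psi> j z \<odot>\<^bsub>M\<^esub> f j)"
        using f \<psi>c zM fm \<psi>mz by (simp add: Pi_def)
      finally show ?thesis .
    qed
    have "(\<Oplus>\<^bsub>?K\<^esub>j\<in>{..<m}. \<psi> j z \<odot>\<^bsub>M\<^esub> f' j) = (\<Oplus>\<^bsub>M\<^esub>j\<in>{..<m}. \<psi> j z \<odot>\<^bsub>M\<^esub> f' j)"
    proof (rule finsum_submodule[OF M K.module_axioms])
      show "\<psi> j z \<odot>\<^bsub>M\<^esub> f' j \<in> ?H" if "j \<in> {..<m}" for j
        using K.smult_closed[of "\<psi> j z" "f' j"] \<psi>c[of j z] f' zM that by simp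
    qed auto
    also have "\<dots> = (\<Oplus>\<^bsub>M\<^esub>j\<in>{..<m}. \<psi> j z \<odot>\<^bsub>M\<^esub> f j \<oplus>\<^bsub>M\<^esub> (\<ominus> (\<psi> j z \<otimes> \<phi> (f j))) \<odot>\<^bsub>M\<^esub> f m)"
    proof (intro M.finsum_cong')
      fix j assume j: "j \<in> {..<m}"
      have "\<psi> j z \<odot>\<^bsub>M\<^esub> f' j = \<psi> j z \<odot>\<^bsub>M\<^esub> f j \<oplus>\<^bsub>M\<^esub> (\<psi> j z \<otimes> \<ominus> \<phi> (f j)) \<odot>\<^bsub>M\<^esub> f m"
        unfolding f'_def using j f fm \<psi>c zM \<phi>c by (simp add: M.smult_r_distr M.smult_assoc1)
      then show "\<psi> j z \<odot>\<^bsub>M\<^esub> f' j = \<psi> j z \<odot>\<^bsub>M\<^esub> f j \<oplus>\<^bsub>M\<^esub> (\<ominus> (\<psi> j z \<otimes> \<phi> (f j))) \<odot>\<^bsub>M\<^esub> f m"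
        using j f \<psi>c zM \<phi>c by (simp add: r_minus)
    qed (use f fm \<psi>c zM \<phi>c in auto)
    also have "\<dots> = (\<Oplus>\<^bsub>M\<^esub>j\<in>{..<m}. \<psi> j z \<odot>\<^bsub>M\<^esub> f j)
        \<oplus>\<^bsub>M\<^esub> (\<Oplus>\<^bsub>M\<^esub>j\<in>{..<m}. (\<ominus> (\<psi> j z \<otimes> \<phi> (f j))) \<odot>\<^bsub>M\<^esub> f m)"
      using f fm \<psi>c zM \<phi>c by (intro M.finsum_addf) auto
    also have "(\<Oplus>\<^bsub>M\<^esub>j\<in>{..<m}. (\<ominus> (\<psi> j z \<otimes> \<phi> (f j))) \<odot>\<^bsub>M\<^esub> f m)
        = (\<Oplus>j\<in>{..<m}. \<ominus> (\<psi> j z \<otimes> \<phi> (f j))) \<odot>\<^bsub>M\<^esub> f m"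
      using f fm \<psi>c zM \<phi>c by (intro finsum_smult_rdistr[OF M]) auto
    also have "(\<Oplus>j\<in>{..<m}. \<ominus> (\<psi> j z \<otimes> \<phi> (f j))) = \<ominus> \<one> \<otimes> (\<Oplus>j\<in>{..<m}. \<psi> j z \<otimes> \<phi> (f j))"
      using f \<psi>c zM \<phi>c by (subst finsum_rdistr) (auto simp: l_minus intro!: finsum_cong')
    also have "(\<Oplus>j\<in>{..<m}. \<psi> j z \<otimes> \<phi> (f j)) = \<phi> (\<Oplus>\<^bsub>M\<^esub>j\<in>{..<m}. \<psi> j z \<odot>\<^bsub>M\<^esub> f j)"
      using f \<psi>c zM by (intro functional_lincomb[OF M \<phi>, symmetric]) auto
    also have "(\<Oplus>\<^bsub>M\<^esub>j\<in>{..<m}. \<psi> j z \<odot>\<^bsub>M\<^esub> f j) = z" by (rule z_eq[symmetric])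
    finally show ?thesis using \<phi>z fm zM by simp
  qed
  then have "dual_basis R ?K m f' \<psi>"
    using f' \<psi>K by (simp add: dual_basis_def)
  then show ?thesis by blast
qed

text \<open>Finitely generated projective modules over a local ring are free.  Either \<open>\<psi> m (f m)\<close> is
invertible, and a free summand splits off, or \<open>\<one> \<ominus> \<psi> m (f m)\<close> is, and the last generator is
redundant.  Both cases shorten the dual basis.\<close>

theorem local_free_basis:
  assumes loc: "local_cring R" and "module R M" "dual_basis R M m f \<psi>"
  shows "\<exists>k f \<psi>. free_basis R M k f \<psi>"
  using assms(2-)
proof (induction m arbitrary: M f \<psi>)
  case 0
  then have "free_basis R M 0 f \<psi>" by (simp add: free_basis_def)
  then show ?case by blast
next
  case (Suc m)
  have f: "f m \<in> carrier M" and \<psi>: "\<psi> m \<in> mod_hom R M (regular_module R)"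
    using Suc.prems(2) by (auto simp: dual_basis_def)
  have c: "\<psi> m (f m) \<in> carrier R" using functional_closed[OF \<psi> f] .
  show ?case
  proof (cases "invertible R (\<psi> m (f m))")
    case True
    then obtain v where v: "v \<in> carrier R" "\<psi> m (f m) \<otimes> v = \<one>" by (auto simp: invertible_def)
    let ?\<phi> = "\<lambda>z. v \<otimes> \<psi> m z"
    let ?K = "M\<lparr>carrier := {z \<in> carrier M. ?\<phi> z = \<zero>}\<rparr>"
    have \<phi>: "?\<phi> \<in> mod_hom R M (regular_module R)"
      by (rule functional_multiple[OF Suc.prems(1) \<psi> v(1)])
    obtain f' where "dual_basis R ?K m f' \<psi>"
      using dual_basis_kernel[OF Suc.prems v] by blast
    then obtain k f'' \<psi>'' where fb: "free_basis R ?K k f'' \<psi>''"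
      using Suc.IH[OF functional_kernel_module[OF Suc.prems(1) \<phi>]] by blast
    have "v \<otimes> \<psi> m (f m) = \<one>" using v c m_comm[of v "\<psi> m (f m)"] by simp
    from free_basis_split[OF Suc.prems(1) \<phi> f this fb] show ?thesis by blast
  next
    case False
    then have "invertible R (\<one> \<ominus> \<psi> m (f m))" using loc c by (auto simp: local_cring_def)
    then obtain \<psi>' where "dual_basis R M m f \<psi>'"
      using dual_basis_eliminate[OF Suc.prems] by blast
    then show ?thesis using Suc.IH[OF Suc.prems(1)] by blast
  qed
qed

text \<open>Two elements \<open>a, b\<close> of an ideal satisfy the relation \<open>b \<cdot> a - a \<cdot> b = 0\<close>, so they are not
part of a basis.\<close>

lemma free_ideal_rank_le_one:
  assumes I: "ideal I R" and "\<one> \<noteq> \<zero>" and fb: "free_basis R (ideal_module R I) m f \<psi>"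
  shows "m \<le> 1"
proof (rule ccontr)
  assume "\<not> m \<le> 1"
  then have m: "0 < m" "1 < m" by auto
  interpret I: ideal I R by fact
  have f: "f 0 \<in> I" "f 1 \<in> I" using fb m by (auto simp: free_basis_def dual_basis_def ideal_module_def)
  have fc: "f 0 \<in> carrier R" "f 1 \<in> carrier R" using f I.Icarr by auto
  have \<psi>: "\<psi> i (r \<otimes> z) = r \<otimes> \<psi> i z" if "i < m" "r \<in> carrier R" "z \<in> I" for i r z
  proof -
    have "\<psi> i \<in> mod_hom R (ideal_module R I) (regular_module R)"
      using fb that(1) by (simp add: free_basis_def dual_basis_def)
    then show ?thesis using that by (simp add: mod_hom_def ideal_module_def regular_module_def)
  qed
  have d: "\<psi> 0 (f 0) = \<one>" "\<psi> 0 (f 1) = \<zero>" "\<psi> 1 (f 1) = \<one>"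
    using fb m unfolding free_basis_def by (metis zero_neq_one)+
  have "f 1 = f 1 \<otimes> \<psi> 0 (f 0)" using d fc by simp
  also have "\<dots> = \<psi> 0 (f 1 \<otimes> f 0)" using \<psi> m f fc by simp
  also have "\<dots> = \<psi> 0 (f 0 \<otimes> f 1)" using fc m_comm by metis
  also have "\<dots> = f 0 \<otimes> \<psi> 0 (f 1)" using \<psi> m f fc by blast
  also have "\<dots> = \<zero>" using d fc by simp
  finally have "f 1 = \<zero>" .
  then have "\<psi> 1 (\<zero> \<otimes> f 1) = \<one>" using d by simp
  then show False using \<psi>[of 1 \<zero> "f 1"] m f d assms(2) by simp
qed

section \<open>Regular sequences and height\<close>

text \<open>The products of powers of \<open>z\<close> with elements outside \<open>P\<close> form a multiplicative set, which
misses \<open>J\<close> because \<open>z\<close> is a nonzerodivisor modulo \<open>J\<close>.  An ideal that is maximal among those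
containing \<open>J\<close> and missing the set is prime, is contained in \<open>P\<close>, and does not contain \<open>z\<close>.\<close>

lemma exists_prime_avoiding:
  assumes noeth: "noetherian_ring R" and J: "ideal J R" and P: "primeideal P R" and "J \<subseteq> P"
    and z: "z \<in> P" and reg: "\<And>a. a \<in> carrier R \<Longrightarrow> z \<otimes> a \<in> J \<Longrightarrow> a \<in> J"
  shows "\<exists>Q. primeideal Q R \<and> J \<subseteq> Q \<and> Q \<subset> P"
proof -
  interpret N: noetherian_ring R by fact
  interpret P: primeideal P R by fact
  have zc: "z \<in> carrier R" using z by (rule P.Icarr)
  have one: "\<one> \<notin> P" using P.one_imp_carrier P.I_notcarr by blast
  define T where "T = {z [^] (k::nat) \<otimes> s | k s. s \<in> carrier R - P}"
  have T_mult: "t \<otimes> t' \<in> T" if "t \<in> T" "t' \<in> T" for t t'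
  proof -
    obtain k s k' s' where ks: "t = z [^] (k::nat) \<otimes> s" "s \<in> carrier R - P"
      "t' = z [^] (k'::nat) \<otimes> s'" "s' \<in> carrier R - P"
      using \<open>t \<in> T\<close> \<open>t' \<in> T\<close> by (auto simp: T_def)
    have "t \<otimes> t' = z [^] (k + k') \<otimes> (s \<otimes> s')"
      unfolding ks(1,3) nat_pow_mult[OF zc, symmetric] using ks(2,4) zc
      by (simp add: m_assoc m_lcomm[of s])
    moreover have "s \<otimes> s' \<in> carrier R - P" using P.I_prime[of s s'] ks(2,4) by auto
    ultimately show ?thesis unfolding T_def by blast
  qed
  have T_compl: "s \<in> T" if "s \<in> carrier R - P" for s
  proof -
    have "s = z [^] (0::nat) \<otimes> s" using that by simp
    then show ?thesis unfolding T_def using that by blast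
  qed
  have zT: "z \<in> T"
  proof -
    have "z = z [^] (1::nat) \<otimes> \<one>" using zc by simp
    then show ?thesis unfolding T_def using one by blast
  qed
  define \<F> where "\<F> = {K. ideal K R \<and> J \<subseteq> K \<and> K \<inter> T = {}}"
  have "J \<inter> T = {}"
  proof -
    have "z [^] (k::nat) \<otimes> s \<notin> J" if s: "s \<in> carrier R - P" for k s
    proof (induction k)
      case 0
      then show ?case using s \<open>J \<subseteq> P\<close> by auto
    next
      case (Suc k)
      then show ?case using reg[of "z [^] k \<otimes> s"] s zc nat_pow_Suc_mult[of z s k] by auto
    qed
    then show ?thesis by (auto simp: T_def)
  qed
  then have "\<F> \<noteq> {}" using J by (auto simp: \<F>_def)
  then have "\<exists>Q\<in>\<F>. \<forall>K\<in>\<F>. Q \<subseteq> K \<longrightarrow> K = Q"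
    by (rule N.exists_maximal_in_family) (simp add: \<F>_def)
  then obtain Q where Q: "Q \<in> \<F>" and max: "\<And>K. K \<in> \<F> \<Longrightarrow> Q \<subseteq> K \<Longrightarrow> K = Q" by blast
  have QI: "ideal Q R" and QJ: "J \<subseteq> Q" and QT: "Q \<inter> T = {}" using Q by (auto simp: \<F>_def)
  interpret Q: ideal Q R by (rule QI)
  have meets: "\<exists>q\<in>Q. \<exists>r\<in>carrier R. q \<oplus> r \<otimes> a \<in> T" if a: "a \<in> carrier R" "a \<notin> Q" for a
  proof -
    let ?K = "Q <+>\<^bsub>R\<^esub> PIdl a"
    have K: "ideal ?K R" by (rule add_ideals[OF QI cgenideal_ideal[OF a(1)]])
    have QK: "Q \<subseteq> ?K"
    proof
      fix q assume q: "q \<in> Q"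
      have "q = q \<oplus> \<zero> \<otimes> a" using q a Q.Icarr by simp
      then show "q \<in> ?K" using q unfolding set_add_def' cgenideal_def by blast
    qed
    have "a = \<zero> \<oplus> \<one> \<otimes> a" using a by simp
    then have "a \<in> ?K" using Q.zero_closed unfolding set_add_def' cgenideal_def by blast
    then have "?K \<notin> \<F>" using max[OF _ QK] a(2) by blast
    then have "?K \<inter> T \<noteq> {}" using K QK QJ by (auto simp: \<F>_def)
    then show ?thesis unfolding set_add_def' cgenideal_def by blast
  qed
  have "primeideal Q R"
  proof (rule primeidealI[OF QI is_cring])
    show "carrier R \<noteq> Q" using QT T_compl[of \<one>] one by auto
    fix a b assume ab: "a \<in> carrier R" "b \<in> carrier R" "a \<otimes> b \<in> Q"
    show "a \<in> Q \<or> b \<in> Q"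
    proof (rule ccontr)
      assume "\<not> (a \<in> Q \<or> b \<in> Q)"
      then obtain q r q' r' where q: "q \<in> Q" "r \<in> carrier R" "q \<oplus> r \<otimes> a \<in> T"
        "q' \<in> Q" "r' \<in> carrier R" "q' \<oplus> r' \<otimes> b \<in> T"
        using meets[OF ab(1)] meets[OF ab(2)] by blast
      have qc: "q \<in> carrier R" "q' \<in> carrier R" using q Q.Icarr by auto
      have "(q \<oplus> r \<otimes> a) \<otimes> (q' \<oplus> r' \<otimes> b) = q \<otimes> (q' \<oplus> r' \<otimes> b) \<oplus> (r \<otimes> a) \<otimes> (q' \<oplus> r' \<otimes> b)"
        using q(2,5) qc ab by (intro l_distr) auto
      also have "(r \<otimes> a) \<otimes> (q' \<oplus> r' \<otimes> b) = (r \<otimes> a) \<otimes> q' \<oplus> (r \<otimes> a) \<otimes> (r' \<otimes> b)"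
        using q(2,5) qc ab by (intro r_distr) auto
      also have "(r \<otimes> a) \<otimes> (r' \<otimes> b) = (r \<otimes> r') \<otimes> (a \<otimes> b)"
        using q(2,5) ab by (simp add: m_assoc m_lcomm[of a])
      also have "q \<otimes> (q' \<oplus> r' \<otimes> b) \<oplus> ((r \<otimes> a) \<otimes> q' \<oplus> (r \<otimes> r') \<otimes> (a \<otimes> b)) \<in> Q"
        using q(2,5) qc ab(1,2)
        by (intro Q.a_closed Q.I_r_closed[OF q(1)] Q.I_l_closed[OF q(4)] Q.I_l_closed[OF ab(3)]) auto
      finally show False using T_mult[OF q(3,6)] QT by blast
    qed
  qed
  moreover have "Q \<subseteq> P"
  proof
    fix q assume "q \<in> Q"
    then show "q \<in> P" using QT T_compl[of q] Q.Icarr by blast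
  qed
  ultimately show ?thesis using QJ QT zT z by blast
qed

text \<open>Each term of the sequence is a nonzerodivisor modulo the previous ones, so
\<open>exists_prime_avoiding\<close> descends by one step in the chain of primes for every term removed from
the end.\<close>

lemma regular_sequence_chain:
  assumes noeth: "noetherian_ring R" and reg: "regular_sequence R ys"
    and "k \<le> length ys" "primeideal P R" "set (take k ys) \<subseteq> P"
  shows "\<exists>Q. prime_chain R k Q \<and> Q k = P"
  using assms(3-)
proof (induction k arbitrary: P)
  case 0
  then show ?case by (intro exI[of _ "\<lambda>_. P"]) (simp add: prime_chain_def)
next
  case (Suc k)
  have ys: "set ys \<subseteq> carrier R" using reg by (simp add: regular_sequence_def)
  let ?J = "Idl (set (take k ys))"
  have tk: "set (take k ys) \<subseteq> carrier R" using ys set_take_subset[of k ys] by blast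
  have take: "set (take (Suc k) ys) = insert (ys ! k) (set (take k ys))"
    using Suc.prems(1) by (simp add: take_Suc_conv_app_nth)
  interpret P: primeideal P R by (rule Suc.prems(2))
  have J: "ideal ?J R" by (rule genideal_ideal[OF tk])
  have "?J \<subseteq> P" using Suc.prems(3) take by (intro genideal_minimal[OF P.is_ideal]) auto
  moreover have "ys ! k \<in> P" using Suc.prems(3) take by auto
  moreover have "a \<in> ?J" if "a \<in> carrier R" "ys ! k \<otimes> a \<in> ?J" for a
    using reg that Suc.prems(1) by (simp add: regular_sequence_def)
  ultimately obtain Q where Q: "primeideal Q R" "?J \<subseteq> Q" "Q \<subset> P"
    using exists_prime_avoiding[OF noeth J Suc.prems(2)] by blast
  have "set (take k ys) \<subseteq> Q" using genideal_self[OF tk] Q(2) by blast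
  then obtain C where C: "prime_chain R k C" "C k = Q"
    using Suc.IH[OF _ Q(1)] Suc.prems(1) by auto
  have "prime_chain R (Suc k) (C(Suc k := P))"
    using C Q(3) Suc.prems(2) unfolding prime_chain_def by (auto simp: le_Suc_eq less_Suc_eq)
  moreover have "(C(Suc k := P)) (Suc k) = P" by simp
  ultimately show ?case by blast
qed

lemma regular_sequence_length_le_height:
  assumes noeth: "noetherian_ring R" and reg: "regular_sequence R ys" and "set ys \<subseteq> I"
  shows "enat (length ys) \<le> ideal_height R I"
  unfolding ideal_height_def
proof (rule Inf_greatest)
  fix h assume "h \<in> {prime_height R P |P. primeideal P R \<and> I \<subseteq> P}"
  then obtain P where P: "primeideal P R" "I \<subseteq> P" "h = prime_height R P" by blast
  have "\<exists>Q. prime_chain R (length ys) Q \<and> Q (length ys) = P"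
    using assms(3) P by (intro regular_sequence_chain[OF noeth reg]) auto
  then show "enat (length ys) \<le> h"
    unfolding P(3) prime_height_def by (intro Sup_upper) blast
qed

section \<open>Koszul homology of principal ideals\<close>

text \<open>The unit form is a cycle of degree \<open>0\<close>, and the boundaries in that degree are its multiples
by elements of the ideal.\<close>

lemma annihilator_koszul_homology_0:
  assumes xs: "set xs \<subseteq> carrier R"
  shows "annihilator R (koszul_homology R xs 0) = Idl (set xs)"
proof
  let ?n = "length xs"
  have nth: "xs ! i \<in> carrier R" if "i < ?n" for i using xs that by auto
  show "annihilator R (koszul_homology R xs 0) \<subseteq> Idl (set xs)"
  proof
    fix r assume "r \<in> annihilator R (koszul_homology R xs 0)"
    then have r: "r \<in> carrier R"
      and kill: "\<And>w. w \<in> koszul_cycles R xs 0 \<Longrightarrow> (\<lambda>T. r \<otimes> w T) \<in> koszul_boundaries R xs 0"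
      by (auto simp: annihilator_koszul_homology[OF xs])
    let ?e = "\<lambda>T::nat set. if T = {} then \<one> else \<zero>"
    have "koszul_diff R xs ?e = contract R ?n ((!) xs) ?e"
      by (rule koszul_diff_eq_contract[OF xs]) auto
    also have "\<dots> = (\<lambda>T. \<zero>)" using nth by (intro ext contract_unit)
    finally have "koszul_diff R xs ?e = (\<lambda>T. \<zero>)" .
    moreover have "?e \<in> carrier (ext_power R ?n 0)"
      using finite_subset[of _ "{..<?n}"] by (auto simp: ext_power_def)
    ultimately have "?e \<in> koszul_cycles R xs 0" by (simp add: koszul_cycles_def)
    from kill[OF this] obtain b where b: "b \<in> carrier (ext_power R ?n (Suc 0))"
      "(\<lambda>T. r \<otimes> ?e T) = contract R ?n ((!) xs) b"
      unfolding koszul_boundaries_iff[OF xs] by (elim bexE)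
    have bc: "b T \<in> carrier R" for T using b(1) by (simp add: ext_power_def)
    define v where "v i = (if i < ?n then contract_at R i b {} else \<zero>)" for i
    have v: "v \<in> carrier (free_module R {..<?n})" using bc by (auto simp: v_def free_module_def)
    have "r = contract R ?n ((!) xs) b {}" using fun_cong[OF b(2), of "{}"] r by simp
    also have "\<dots> = dot R ?n ((!) xs) v"
      unfolding contract_def dot_def using nth bc by (intro finsum_cong') (auto simp: v_def)
    finally show "r \<in> Idl (set xs)" unfolding genideal_eq_dot[OF xs] using v by blast
  qed
qed (rule ideal_subset_annihilator[OF xs])

lemma koszul_homology_vanishes_le_one:
  assumes xs: "set xs \<subseteq> carrier R" "length xs \<le> 1" and p: "0 < p"
    and reg: "\<And>x a. x \<in> set xs \<Longrightarrow> a \<in> carrier R \<Longrightarrow> x \<otimes> a = \<zero> \<Longrightarrow> a = \<zero>"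
  shows "zero_module (koszul_homology R xs p)"
proof (rule zero_module_koszul_homology[OF xs(1)], rule subsetI)
  fix w assume w: "w \<in> koszul_cycles R xs p"
  let ?n = "length xs"
  have wc: "w T \<in> carrier R" for T using koszul_cycles_closed[OF w] .
  have we: "w \<in> carrier (ext_power R ?n p)" and "koszul_diff R xs w = (\<lambda>T. \<zero>)"
    using w by (auto simp: koszul_cycles_def)
  then have cyc: "contract R ?n ((!) xs) w T = \<zero>" for T
    using koszul_diff_eq_contract[OF xs(1), of w] wc by metis
  have "w T = \<zero>" for T
  proof (cases "?n < p")
    case True
    then show ?thesis using ext_power_trivial[OF we] by blast
  next
    case False
    then have n: "?n = 1" "p = 1" using xs(2) p by linarith+
    then have x: "xs ! 0 \<in> set xs" "xs ! 0 \<in> carrier R" using xs(1) by auto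
    have "contract R ?n ((!) xs) w {} = xs ! 0 \<otimes> w {0}"
    proof -
      have "{..<?n} = {0}" using n by auto
      then show ?thesis using wc x by (simp add: contract_def contract_at_def koszul_sign_def)
    qed
    then have "w {0} = \<zero>" using reg[OF x(1) wc] cyc by metis
    moreover have "w T = \<zero>" if "T \<noteq> {0}"
    proof -
      have "\<not> (T \<subseteq> {..<?n} \<and> card T = p)"
        using that n by (auto simp: card_1_singleton_iff)
      then show ?thesis using we by (auto simp: ext_power_def)
    qed
    ultimately show ?thesis by (cases "T = {0}") simp_all
  qed
  then have "w = (\<lambda>T. \<zero>)" by (rule ext)
  then show "w \<in> koszul_boundaries R xs p" using koszul_boundaries_zero[OF xs(1)] by simp
qed

text \<open>A free ideal is zero or generated by a nonzerodivisor \<open>f\<close>.  In the second case, \<open>f\<close> is a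
combination of the given generators, which are multiples of \<open>f\<close>; comparing coefficients and using
that the ring is local, one of the generators is \<open>f\<close> up to a unit, and by minimality it is the
only one.\<close>

lemma minimal_generators_of_free_ideal:
  assumes loc: "local_cring R" and I: "ideal I R" and min: "minimal_generating_list R I xs"
    and fb: "free_basis R (ideal_module R I) m f \<psi>"
  shows "length xs \<le> 1 \<and> (\<forall>x\<in>set xs. \<forall>a\<in>carrier R. x \<otimes> a = \<zero> \<longrightarrow> a = \<zero>)"
proof -
  interpret I: ideal I R by fact
  have xs: "set xs \<subseteq> carrier R" "distinct xs" "Idl (set xs) = I"
    and minimal: "\<And>S. S \<subset> set xs \<Longrightarrow> Idl S \<noteq> I"
    using min by (auto simp: minimal_generating_list_def)
  interpret M: module R "ideal_module R I" by (rule ideal_module_module[OF I])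
  have nt: "\<one> \<noteq> \<zero>" using loc by (simp add: local_cring_def)
  have exp: "z = (\<Oplus>\<^bsub>ideal_module R I\<^esub>j\<in>{..<m}. \<psi> j z \<odot>\<^bsub>ideal_module R I\<^esub> f j)" if "z \<in> I" for z
    using fb that by (simp add: free_basis_def dual_basis_def ideal_module_def)
  have "m = 0 \<or> m = 1" using free_ideal_rank_le_one[OF I nt fb] by auto
  then show ?thesis
  proof
    assume m: "m = 0"
    have zero: "z = \<zero>" if "z \<in> I" for z
    proof -
      have "z = \<zero>\<^bsub>ideal_module R I\<^esub>" using exp[OF that] m by simp
      then show ?thesis by (simp add: ideal_module_def regular_module_def)
    qed
    have "Idl {} = I"
    proof
      show "Idl {} \<subseteq> I" by (rule genideal_minimal[OF I]) simp
      show "I \<subseteq> Idl {}"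
        using zero additive_subgroup.zero_closed[OF ideal.axioms(1)[OF genideal_ideal[of "{}"]]] by auto
    qed
    then have "set xs = {}" using minimal[of "{}"] by blast
    then show ?thesis by simp
  next
    assume m: "m = 1"
    have f: "f 0 \<in> I" and \<psi>h: "\<psi> 0 \<in> mod_hom R (ideal_module R I) (regular_module R)"
      and \<psi>f: "\<psi> 0 (f 0) = \<one>"
      using fb m by (auto simp: free_basis_def dual_basis_def ideal_module_def)
    have fc: "f 0 \<in> carrier R" using f by (rule I.Icarr)
    have \<psi>c: "\<psi> 0 z \<in> carrier R" if "z \<in> I" for z
      using functional_closed[OF \<psi>h, of z] that by (simp add: ideal_module_def)
    have \<psi>s: "\<psi> 0 (r \<otimes> z) = r \<otimes> \<psi> 0 z" if "r \<in> carrier R" "z \<in> I" for r z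
      using functional_smult[OF \<psi>h, of r z] that by (simp add: ideal_module_def regular_module_def)
    have gen: "z = \<psi> 0 z \<otimes> f 0" if z: "z \<in> I" for z
    proof -
      have one_m: "{..<m} = {0}" using m by auto
      have "\<psi> 0 z \<odot>\<^bsub>ideal_module R I\<^esub> f 0 \<in> carrier (ideal_module R I)"
        using \<psi>c[OF z] f by (intro M.smult_closed) (auto simp: ideal_module_def)
      then have "z = \<psi> 0 z \<odot>\<^bsub>ideal_module R I\<^esub> f 0" using exp[OF z] unfolding one_m by simp
      then show ?thesis by (simp add: ideal_module_def regular_module_def)
    qed
    have xsI: "xs ! i \<in> I" if "i < length xs" for i
      using genideal_self[OF xs(1)] xs(3) that by auto
    have freg: "a = \<zero>" if a: "a \<in> carrier R" "f 0 \<otimes> a = \<zero>" for a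
    proof -
      have "a = \<psi> 0 (a \<otimes> f 0)" using \<psi>s[OF a(1) f] \<psi>f a by simp
      also have "\<dots> = \<psi> 0 (\<zero> \<otimes> f 0)" using a fc m_comm[of a "f 0"] by simp
      also have "\<dots> = \<zero>" using \<psi>s[OF zero_closed f] \<psi>f by simp
      finally show ?thesis .
    qed
    have "f 0 \<in> Idl (set xs)" using f xs(3) by simp
    then obtain c where c: "\<And>i. c i \<in> carrier R" "f 0 = dot R (length xs) ((!) xs) c"
      unfolding genideal_eq_dot[OF xs(1)] by (auto simp: free_module_def)
    have "f 0 = (\<Oplus>\<^bsub>ideal_module R I\<^esub>i\<in>{..<length xs}. c i \<odot>\<^bsub>ideal_module R I\<^esub> (xs ! i))"
      unfolding c(2) using c(1) xsI by (intro ideal_module_lincomb[OF I, symmetric]) auto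
    then have "\<one> = \<psi> 0 (\<Oplus>\<^bsub>ideal_module R I\<^esub>i\<in>{..<length xs}. c i \<odot>\<^bsub>ideal_module R I\<^esub> (xs ! i))"
      using \<psi>f by simp
    also have "\<dots> = (\<Oplus>i\<in>{..<length xs}. c i \<otimes> \<psi> 0 (xs ! i))"
      using c(1) xsI by (intro functional_lincomb[OF M.module_axioms \<psi>h]) (auto simp: ideal_module_def)
    finally have sum: "\<one> = (\<Oplus>i\<in>{..<length xs}. c i \<otimes> \<psi> 0 (xs ! i))" .
    have "invertible R \<one>" by (auto simp: invertible_def)
    then have "invertible R (\<Oplus>i\<in>{..<length xs}. c i \<otimes> \<psi> 0 (xs ! i))" using sum by (simp only:)
    then have "\<exists>i\<in>{..<length xs}. invertible R (c i \<otimes> \<psi> 0 (xs ! i))"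
      using c(1) \<psi>c xsI by (intro local_sum_invertible[OF loc]) auto
    then obtain i v where i: "i < length xs" and v: "v \<in> carrier R" "c i \<otimes> \<psi> 0 (xs ! i) \<otimes> v = \<one>"
      by (auto simp: invertible_def)
    define x where "x = xs ! i"
    have xI: "x \<in> I" and xx: "x \<in> set xs" using xsI[OF i] i by (auto simp: x_def)
    have xc: "x \<in> carrier R" using xI by (rule I.Icarr)
    define u where "u = c i \<otimes> v"
    have u: "u \<in> carrier R" "u \<otimes> \<psi> 0 x = \<one>"
      using c(1)[of i] v \<psi>c[OF xI]
      by (auto simp: u_def x_def m_assoc m_comm[of v])
    have "u \<otimes> x = u \<otimes> (\<psi> 0 x \<otimes> f 0)" using gen[OF xI] by simp
    also have "\<dots> = f 0" using u \<psi>c[OF xI] fc by (simp add: m_assoc[symmetric])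
    finally have fx: "f 0 = u \<otimes> x" by simp
    have "Idl {x} = I"
    proof
      show "Idl {x} \<subseteq> I" using xI by (intro genideal_minimal[OF I]) simp
      interpret X: ideal "Idl {x}" R using xc by (intro genideal_ideal) simp
      have "f 0 \<in> Idl {x}" unfolding fx using genideal_self'[OF xc] u(1) by (intro X.I_l_closed)
      then show "I \<subseteq> Idl {x}" using gen \<psi>c X.I_l_closed by (metis subsetI)
    qed
    then have "set xs = {x}" using minimal[of "{x}"] xx by blast
    moreover from this have "length xs = 1" using distinct_card[OF xs(2)] by simp
    moreover have "a = \<zero>" if a: "a \<in> carrier R" "x \<otimes> a = \<zero>" for a
    proof (rule freg[OF a(1)])
      show "f 0 \<otimes> a = \<zero>" unfolding fx using u(1) xc a by (simp add: m_assoc)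
    qed
    ultimately show ?thesis by simp
  qed
qed

end

section \<open>The annihilators of the Koszul homology modules\<close>

lemma Inf_enat_attained:
  fixes A :: "enat set"
  assumes "Inf A < \<infinity>"
  shows "Inf A \<in> A"
proof -
  have "A \<noteq> {}" using assms by (auto simp: Inf_enat_def)
  then show ?thesis unfolding Inf_enat_def by (auto intro: LeastI)
qed

theorem proposition2p10:
  fixes R :: "('a, 'b) ring_scheme" and I :: "'a set" and xs :: "'a list"
  assumes "cohen_macaulay_local_ring R"
    and "ideal I R"
    and "ideal_height R I = 2"
    and "perfect_ideal R I"
    and "minimal_generating_list R I xs"
  shows "\<forall>i. \<not> zero_module (koszul_homology R xs i) \<longrightarrow>
           annihilator R (koszul_homology R xs i) = I"
proof (intro allI impI)
  fix p assume nonzero: "\<not> zero_module (koszul_homology R xs p)"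
  interpret noetherian_local_ring R
    using assms(1) by (rule cohen_macaulay_local_ring.axioms)
  have noeth: "noetherian_ring R" by (rule noetherian_ring_axioms)
  have loc: "local_cring R" by (rule nonunits_complementary)
  have xs: "set xs \<subseteq> carrier R" "distinct xs" "I = Idl\<^bsub>R\<^esub> (set xs)"
    using assms(5) by (auto simp: minimal_generating_list_def)
  let ?Q = "quotient_module (regular_module R) I"
  let ?D = "{enat n | n. \<exists>(P :: nat \<Rightarrow> ('a, nat \<Rightarrow> 'a) module) \<delta> e.
    projective_resolution R ?Q P \<delta> e \<and> (\<forall>i>n. zero_module (P i))}"
  have pd: "proj_dim TYPE(nat \<Rightarrow> 'a) R ?Q = grade R I"
    using assms(4) by (simp add: perfect_ideal_def)
  have "grade R I \<le> 2"
    unfolding grade_def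
  proof (rule Sup_least)
    fix l assume "l \<in> {enat (length ys) |ys. regular_sequence R ys \<and> set ys \<subseteq> I}"
    then show "l \<le> 2" using regular_sequence_length_le_height[OF noeth] unfolding assms(3)[symmetric] by blast
  qed
  then have D: "Inf ?D \<le> 2" using pd by (simp add: proj_dim_def)
  have "Inf ?D < \<infinity>" using D by (rule order.strict_trans1) (simp add: numeral_eq_enat)
  then have "Inf ?D \<in> ?D" by (rule Inf_enat_attained)
  then obtain l P \<delta> e where l: "Inf ?D = enat l"
    and res: "projective_resolution R ?Q (P :: nat \<Rightarrow> ('a, nat \<Rightarrow> 'a) module) \<delta> e"
    and zero: "\<And>i. l < i \<Longrightarrow> zero_module (P i)"
    by blast
  have l2: "l \<le> 2" using D l by (simp add: numeral_eq_enat)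
  \<comment> \<open>Here \<open>l\<close> is the common value of the grade and the projective dimension; the
    first case comprises \<open>l = 0\<close> and \<open>l = 1\<close>.\<close>
  show "annihilator R (koszul_homology R xs p) = I"
  proof (cases "l = 2")
    case False
    then have "zero_module (P 2)" using l2 by (intro zero) simp
    then obtain m f \<psi> where "dual_basis R (ideal_module R I) m f \<psi>"
      using ideal_dual_basis[OF xs res] by blast
    then obtain k f' \<psi>' where "free_basis R (ideal_module R I) k f' \<psi>'"
      using local_free_basis[OF loc ideal_module_module[OF assms(2)]] by blast
    then have "length xs \<le> 1" "\<And>x a. x \<in> set xs \<Longrightarrow> a \<in> carrier R \<Longrightarrow> x \<otimes>\<^bsub>R\<^esub> a = \<zero>\<^bsub>R\<^esub> \<Longrightarrow> a = \<zero>\<^bsub>R\<^esub>"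
      using minimal_generators_of_free_ideal[OF loc assms(2,5)] by blast+
    then have "p = 0"
      using nonzero koszul_homology_vanishes_le_one[OF xs(1)] by blast
    then show ?thesis using annihilator_koszul_homology_0[OF xs(1)] xs(3) by simp
  next
    case True
    have "\<exists>ys. regular_sequence R ys \<and> set ys \<subseteq> I \<and> 2 \<le> length ys"
    proof (rule ccontr)
      assume "\<not> ?thesis"
      then have "grade R I \<le> 1"
        unfolding grade_def by (intro Sup_least) (auto simp: one_enat_def not_le less_Suc_eq_le numeral_2_eq_2)
      then show False using pd l True by (simp add: proj_dim_def one_enat_def)
    qed
    then obtain ys where ys: "regular_sequence R ys" "set ys \<subseteq> I" "2 \<le> length ys" by blast
    then obtain x y ys' where ys': "ys = x # y # ys'"
      by (cases ys; cases "tl ys") auto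
    have xy: "x \<in> I" "y \<in> I" "x \<in> carrier R" "y \<in> carrier R"
      using ys ys' by (auto simp: regular_sequence_def)
    obtain g h where g: "g \<in> carrier (free_module R {..<length xs})" "x = dot R (length xs) ((!) xs) g"
      and h: "h \<in> carrier (free_module R {..<length xs})" "y = dot R (length xs) ((!) xs) h"
      using xy(1,2) unfolding xs(3) genideal_eq_dot[OF xs(1)] by blast
    have zero_ideal: "Idl\<^bsub>R\<^esub> {} = {\<zero>\<^bsub>R\<^esub>}"
      using genideal_minimal[OF zeroideal, of "{}"]
        additive_subgroup.zero_closed[OF ideal.axioms(1)[OF genideal_ideal[of "{}"]]] by auto
    have seq: "ys ! i \<otimes>\<^bsub>R\<^esub> a \<in> Idl\<^bsub>R\<^esub> (set (take i ys)) \<Longrightarrow> a \<in> Idl\<^bsub>R\<^esub> (set (take i ys))"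
      if "i < length ys" "a \<in> carrier R" for i a
      using ys(1) that by (simp add: regular_sequence_def)
    have reg1: "a = \<zero>\<^bsub>R\<^esub>" if "a \<in> carrier R" "x \<otimes>\<^bsub>R\<^esub> a = \<zero>\<^bsub>R\<^esub>" for a
      using seq[of 0 a] that ys' zero_ideal by simp
    have reg2: "\<exists>c\<in>carrier R. a = x \<otimes>\<^bsub>R\<^esub> c"
      if "a \<in> carrier R" "b \<in> carrier R" "y \<otimes>\<^bsub>R\<^esub> a = x \<otimes>\<^bsub>R\<^esub> b" for a b
    proof -
      have px: "Idl\<^bsub>R\<^esub> {x} = PIdl\<^bsub>R\<^esub> x" using cgenideal_eq_genideal[OF xy(3)] by simp
      have "x \<otimes>\<^bsub>R\<^esub> b \<in> Idl\<^bsub>R\<^esub> {x}"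
        unfolding px cgenideal_def using that(2) xy(3) m_comm by blast
      then have "a \<in> Idl\<^bsub>R\<^esub> {x}" using seq[of 1 a] that ys' by simp
      then show ?thesis unfolding px cgenideal_def using xy(3) m_comm by blast
    qed
    have "zero_module (P 3)" using l2 by (intro zero) simp
    then obtain m f \<psi> where "dual_basis R (syzygy_module R xs) m f \<psi>"
      using syzygies_dual_basis[OF noeth xs res] by blast
    then obtain k f' \<psi>' where fb: "free_basis R (syzygy_module R xs) k f' \<psi>'"
      using local_free_basis[OF loc syzygy_module_module[OF xs(1)]] by blast
    interpret free_syzygies R xs g h k f' \<psi>'
    proof
      show "\<one>\<^bsub>R\<^esub> \<noteq> \<zero>\<^bsub>R\<^esub>" using loc by (simp add: local_cring_def)
    qed (use xs(1) g h reg1 reg2 fb in auto)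
    show ?thesis using annihilator_koszul_homology_eq[OF nonzero] xs(3) by simp
  qed
qed

end
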